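(* Let $(\eta,\omega_1,\omega_2,\omega_3)$ be an $SU(2)$-structure on a $5$-manifold $N^5$. The following conditions are equivalent: (i) $(\eta,\omega_i)$ is a double hypo structure; (ii) $(\eta,\omega_i)$ satisfies $$d(\eta\wedge\omega_1)=0,\quad d\omega_1=3\eta\wedge\omega_2,\quad d(\eta\wedge\omega_3)=-2\omega_1\wedge\omega_1,\quad d\omega_3=0;$$ (iii) the sin-cone $N^5\times(0,\pi)$, with coordinate $t\in(0,\pi)$, equipped with the $SU(3)$-structure $$\begin{aligned}F&=\sin^2t\,(\sin t\,\omega_1+\cos t\,\omega_3)+\sin t\,\eta\wedge dt,\\ \Psi_+&=\sin^3t\,\eta\wedge\omega_2-\sin^2t\,(-\cos t\,\omega_1+\sin t\,\omega_3)\wedge dt,\\ \Psi_-&=\sin^3t\,(-\cos t\,\omega_1+\sin t\,\omega_3)\wedge\eta+\sin^2t\,\omega_2\wedge dt\end{aligned}$$ is half-flat.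
   Context: An $SU(2)$-structure on a $5$-manifold is a quadruplet $(\eta,\omega_1,\omega_2,\omega_3)$ of a $1$-form $\eta$ and $2$-forms $\omega_i$ with $\omega_i\wedge\omega_j=\delta_{ij}v$ for some $4$-form $v$ with $v\wedge\eta$ nowhere zero, and such that $X\lrcorner\omega_1=Y\lrcorner\omega_2$ implies $\omega_3(X,Y)\ge 0$. It is nearly hypo if $d\omega_1=3\eta\wedge\omega_2$ and $d(\eta\wedge\omega_3)=-2\omega_1\wedge\omega_1$. It is double hypo if it is nearly hypo and also hypo, where here hypo is understood with $\omega_3$ as the closed form, i.e. $d\omega_3=0$, $d(\eta\wedge\omega_1)=0$, $d(\eta\wedge\omega_2)=0$. An $SU(3)$-structure $(F,\Psi_+,\Psi_-)$ on a $6$-manifold (locally $F=e^{12}+e^{34}+e^{56}$, $\Psi_++i\Psi_-=(e^1+ie^2)\wedge(e^3+ie^4)\wedge(e^5+ie^6)$ for some coframe) is half-flat if $dF\wedge F=0$ and $d\Psi_+=0$. *)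

theory Defs
  imports "HOL-Analysis.Analysis"
begin

section \<open>Smooth maps between open subsets of Euclidean spaces\<close>

text \<open>Only used on open sets \<open>S\<close>, so that \<open>at x\<close> and \<open>at x within S\<close> agree.\<close>

primrec Ck_on :: "nat \<Rightarrow> 'e::euclidean_space set \<Rightarrow> ('e \<Rightarrow> 'b::real_normed_vector) \<Rightarrow> bool" where
  "Ck_on 0 S f \<longleftrightarrow> continuous_on S f"
| "Ck_on (Suc k) S f \<longleftrightarrow>
     (\<forall>x\<in>S. f differentiable (at x)) \<and> (\<forall>v. Ck_on k S (\<lambda>x. frechet_derivative f (at x) v))"

definition smooth_on :: "'e::euclidean_space set \<Rightarrow> ('e \<Rightarrow> 'b::real_normed_vector) \<Rightarrow> bool" where
  "smooth_on S f \<longleftrightarrow> (\<forall>k. Ck_on k S f)"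


section \<open>Smooth manifolds\<close>

text \<open>
  A manifold is a topological space with an atlas indexed by \<open>charts\<close>: for \<open>i \<in> charts M\<close>, the map
  \<open>chart_map M i\<close> is a homeomorphism of the open set \<open>chart_dom M i\<close> onto an open set of \<open>'e\<close>.
  The dimension is \<open>DIM('e)\<close>.
\<close>

record ('a, 'i, 'e) manifold =
  mtop :: "'a topology"
  charts :: "'i set"
  chart_dom :: "'i \<Rightarrow> 'a set"
  chart_map :: "'i \<Rightarrow> 'a \<Rightarrow> 'e"

definition chart_img :: "('a, 'i, 'e) manifold \<Rightarrow> 'i \<Rightarrow> 'e set" where
  "chart_img M i = chart_map M i ` chart_dom M i"

definition overlap :: "('a, 'i, 'e) manifold \<Rightarrow> 'i \<Rightarrow> 'i \<Rightarrow> 'e set" where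
  "overlap M i j = chart_map M i ` (chart_dom M i \<inter> chart_dom M j)"

definition transition :: "('a, 'i, 'e) manifold \<Rightarrow> 'i \<Rightarrow> 'i \<Rightarrow> 'e \<Rightarrow> 'e" where
  "transition M i j x = chart_map M j (inv_into (chart_dom M i) (chart_map M i) x)"

definition smooth_manifold :: "('a, 'i, 'e::euclidean_space) manifold \<Rightarrow> bool" where
  "smooth_manifold M \<longleftrightarrow>
     Hausdorff_space (mtop M) \<and> second_countable (mtop M) \<and>
     (\<Union>i\<in>charts M. chart_dom M i) = topspace (mtop M) \<and>
     (\<forall>i\<in>charts M. openin (mtop M) (chart_dom M i) \<and> open (chart_img M i) \<and>
        homeomorphic_map (subtopology (mtop M) (chart_dom M i)) (top_of_set (chart_img M i))
          (chart_map M i)) \<and>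
     (\<forall>i\<in>charts M. \<forall>j\<in>charts M. smooth_on (overlap M i j) (transition M i j))"


section \<open>Exterior algebra\<close>

text \<open>
  A \<open>k\<close>-covector on \<open>'e\<close> is an alternating \<open>k\<close>-linear function of the list of its \<open>k\<close> arguments,
  extended by \<open>0\<close> to lists of any other length.
\<close>

definition covector :: "nat \<Rightarrow> ('e::real_vector list \<Rightarrow> real) \<Rightarrow> bool" where
  "covector k \<alpha> \<longleftrightarrow>
     (\<forall>vs. length vs \<noteq> k \<longrightarrow> \<alpha> vs = 0) \<and>
     (\<forall>vs i. length vs = k \<and> i < k \<longrightarrow> linear (\<lambda>u. \<alpha> (vs[i := u]))) \<and>
     (\<forall>vs. length vs = k \<and> \<not> distinct vs \<longrightarrow> \<alpha> vs = 0)"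

text \<open>
  The wedge product as the signed sum over shuffles, with the normalisation
  \<open>(a \<and> b)(v,w) = a(v) b(w) - a(w) b(v)\<close>. The set \<open>S\<close> contains the positions of the arguments
  that go to the first factor; if \<open>\<alpha>\<close> is a \<open>p\<close>-covector, only the \<open>S\<close> with \<open>card S = p\<close>
  contribute. The values may be real or complex.
\<close>

definition wedge ::
  "('e list \<Rightarrow> 'b::real_normed_field) \<Rightarrow> ('e list \<Rightarrow> 'b) \<Rightarrow> 'e list \<Rightarrow> 'b" where
  "wedge \<alpha> \<beta> vs =
     (\<Sum>S\<in>Pow {..<length vs}.
        (- 1) ^ card {(a, b). a \<in> S \<and> b \<in> {..<length vs} - S \<and> b < a}
          * \<alpha> (nths vs S) * \<beta> (nths vs (- S)))"

definition interior_product :: "'e \<Rightarrow> ('e list \<Rightarrow> real) \<Rightarrow> 'e list \<Rightarrow> real" where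
  "interior_product X \<alpha> = (\<lambda>vs. \<alpha> (X # vs))"


section \<open>Differential forms\<close>

text \<open>
  A differential form on a manifold is the family of its coordinate expressions in the charts:
  \<open>\<alpha> i x\<close> is the value of the form in the chart \<open>i\<close> at the point with coordinates \<open>x\<close>. Values at
  points outside \<open>chart_img M i\<close> carry no meaning, so equality of forms is \<open>form_eq\<close> below.
\<close>

type_synonym ('i, 'e) form = "'i \<Rightarrow> 'e \<Rightarrow> 'e list \<Rightarrow> real"

definition smooth_covector_field ::
  "nat \<Rightarrow> 'e::euclidean_space set \<Rightarrow> ('e \<Rightarrow> 'e list \<Rightarrow> real) \<Rightarrow> bool" where
  "smooth_covector_field k S \<alpha> \<longleftrightarrow>
     (\<forall>x\<in>S. covector k (\<alpha> x)) \<and> (\<forall>vs. smooth_on S (\<lambda>x. \<alpha> x vs))"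

definition diff_form ::
  "('a, 'i, 'e::euclidean_space) manifold \<Rightarrow> nat \<Rightarrow> ('i, 'e) form \<Rightarrow> bool" where
  "diff_form M k \<alpha> \<longleftrightarrow>
     (\<forall>i\<in>charts M. smooth_covector_field k (chart_img M i) (\<alpha> i)) \<and>
     (\<forall>i\<in>charts M. \<forall>j\<in>charts M. \<forall>x\<in>overlap M i j. \<forall>vs.
        \<alpha> i x vs =
        \<alpha> j (transition M i j x) (map (frechet_derivative (transition M i j) (at x)) vs))"

definition form_eq ::
  "('i, 'e) form \<Rightarrow> ('a, 'i, 'e) manifold \<Rightarrow> ('i, 'e) form \<Rightarrow> bool"
  ("(_/ =\<^bsub>_\<^esub> _)" [51, 0, 51] 50) where
  "\<alpha> =\<^bsub>M\<^esub> \<beta> \<longleftrightarrow> (\<forall>i\<in>charts M. \<forall>x\<in>chart_img M i. \<alpha> i x = \<beta> i x)"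

definition form_zero :: "('i, 'e) form" ("0\<^sub>f") where
  "0\<^sub>f = (\<lambda>i x vs. 0)"

definition form_add :: "('i, 'e) form \<Rightarrow> ('i, 'e) form \<Rightarrow> ('i, 'e) form" (infixl "+\<^sub>f" 65) where
  "\<alpha> +\<^sub>f \<beta> = (\<lambda>i x vs. \<alpha> i x vs + \<beta> i x vs)"

definition form_diff :: "('i, 'e) form \<Rightarrow> ('i, 'e) form \<Rightarrow> ('i, 'e) form" (infixl "-\<^sub>f" 65) where
  "\<alpha> -\<^sub>f \<beta> = (\<lambda>i x vs. \<alpha> i x vs - \<beta> i x vs)"

definition form_scale :: "real \<Rightarrow> ('i, 'e) form \<Rightarrow> ('i, 'e) form" (infixr "*\<^sub>f" 70) where
  "c *\<^sub>f \<alpha> = (\<lambda>i x vs. c * \<alpha> i x vs)"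

definition form_wedge :: "('i, 'e) form \<Rightarrow> ('i, 'e) form \<Rightarrow> ('i, 'e) form"
  (infixl "\<and>\<^sub>f" 75) where
  "\<alpha> \<and>\<^sub>f \<beta> = (\<lambda>i x. wedge (\<alpha> i x) (\<beta> i x))"

definition ext_d :: "('i, 'e::euclidean_space) form \<Rightarrow> ('i, 'e) form" where
  "ext_d \<alpha> = (\<lambda>i x vs. \<Sum>m<length vs.
     (- 1) ^ m * frechet_derivative (\<lambda>y. \<alpha> i y (take m vs @ drop (Suc m) vs)) (at x) (vs ! m))"


section \<open>SU(2)-structures on 5-manifolds\<close>

text \<open>
  The three 2-forms are \<open>\<omega> 1\<close>, \<open>\<omega> 2\<close>, \<open>\<omega> 3\<close>; the function \<open>\<omega>\<close> is irrelevant at other indices.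
\<close>

definition su2_structure ::
  "('a, 'i, 'e::euclidean_space) manifold \<Rightarrow> ('i, 'e) form \<Rightarrow> (nat \<Rightarrow> ('i, 'e) form) \<Rightarrow> bool" where
  "su2_structure N \<eta> \<omega> \<longleftrightarrow>
     DIM('e) = 5 \<and>
     diff_form N 1 \<eta> \<and> (\<forall>p\<in>{1, 2, 3}. diff_form N 2 (\<omega> p)) \<and>
     (\<exists>v. diff_form N 4 v \<and>
        (\<forall>p\<in>{1, 2, 3}. \<forall>q\<in>{1, 2, 3}. \<omega> p \<and>\<^sub>f \<omega> q =\<^bsub>N\<^esub> (if p = q then v else 0\<^sub>f)) \<and>
        (\<forall>i\<in>charts N. \<forall>x\<in>chart_img N i. (v \<and>\<^sub>f \<eta>) i x \<noteq> (\<lambda>vs. 0))) \<and>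
     (\<forall>i\<in>charts N. \<forall>x\<in>chart_img N i. \<forall>X Y.
        interior_product X (\<omega> 1 i x) = interior_product Y (\<omega> 2 i x) \<longrightarrow> \<omega> 3 i x [X, Y] \<ge> 0)"

definition nearly_hypo ::
  "('a, 'i, 'e::euclidean_space) manifold \<Rightarrow> ('i, 'e) form \<Rightarrow> (nat \<Rightarrow> ('i, 'e) form) \<Rightarrow> bool" where
  "nearly_hypo N \<eta> \<omega> \<longleftrightarrow>
     su2_structure N \<eta> \<omega> \<and>
     ext_d (\<omega> 1) =\<^bsub>N\<^esub> 3 *\<^sub>f (\<eta> \<and>\<^sub>f \<omega> 2) \<and>
     ext_d (\<eta> \<and>\<^sub>f \<omega> 3) =\<^bsub>N\<^esub> (- 2) *\<^sub>f (\<omega> 1 \<and>\<^sub>f \<omega> 1)"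

text \<open>The closed 2-form of the hypo structure is taken to be \<open>\<omega> 3\<close>.\<close>

definition hypo ::
  "('a, 'i, 'e::euclidean_space) manifold \<Rightarrow> ('i, 'e) form \<Rightarrow> (nat \<Rightarrow> ('i, 'e) form) \<Rightarrow> bool" where
  "hypo N \<eta> \<omega> \<longleftrightarrow>
     su2_structure N \<eta> \<omega> \<and>
     ext_d (\<omega> 3) =\<^bsub>N\<^esub> 0\<^sub>f \<and>
     ext_d (\<eta> \<and>\<^sub>f \<omega> 1) =\<^bsub>N\<^esub> 0\<^sub>f \<and>
     ext_d (\<eta> \<and>\<^sub>f \<omega> 2) =\<^bsub>N\<^esub> 0\<^sub>f"

definition double_hypo ::
  "('a, 'i, 'e::euclidean_space) manifold \<Rightarrow> ('i, 'e) form \<Rightarrow> (nat \<Rightarrow> ('i, 'e) form) \<Rightarrow> bool" where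
  "double_hypo N \<eta> \<omega> \<longleftrightarrow> nearly_hypo N \<eta> \<omega> \<and> hypo N \<eta> \<omega>"


section \<open>SU(3)-structures on 6-manifolds\<close>

definition coframe_on ::
  "'e::euclidean_space set \<Rightarrow> (nat \<Rightarrow> 'e \<Rightarrow> 'e list \<Rightarrow> real) \<Rightarrow> bool" where
  "coframe_on V e \<longleftrightarrow>
     (\<forall>j\<in>{1..DIM('e)}. smooth_covector_field 1 V (e j)) \<and>
     (\<forall>y\<in>V. \<forall>c. (\<forall>vs. (\<Sum>j=1..DIM('e). c j * e j y vs) = 0) \<longrightarrow> (\<forall>j\<in>{1..DIM('e)}. c j = 0))"

definition cplx_covector :: "('e list \<Rightarrow> real) \<Rightarrow> ('e list \<Rightarrow> real) \<Rightarrow> 'e list \<Rightarrow> complex" where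
  "cplx_covector \<alpha> \<beta> = (\<lambda>vs. Complex (\<alpha> vs) (\<beta> vs))"

definition su3_structure ::
  "('a, 'i, 'e::euclidean_space) manifold \<Rightarrow>
   ('i, 'e) form \<Rightarrow> ('i, 'e) form \<Rightarrow> ('i, 'e) form \<Rightarrow> bool" where
  "su3_structure M F \<Psi>p \<Psi>m \<longleftrightarrow>
     DIM('e) = 6 \<and>
     diff_form M 2 F \<and> diff_form M 3 \<Psi>p \<and> diff_form M 3 \<Psi>m \<and>
     (\<forall>i\<in>charts M. \<forall>x\<in>chart_img M i. \<exists>V e.
        open V \<and> x \<in> V \<and> V \<subseteq> chart_img M i \<and> coframe_on V e \<and>
        (\<forall>y\<in>V.
           F i y = (\<lambda>vs. wedge (e 1 y) (e 2 y) vs + wedge (e 3 y) (e 4 y) vs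
                           + wedge (e 5 y) (e 6 y) vs) \<and>
           cplx_covector (\<Psi>p i y) (\<Psi>m i y) =
             wedge (wedge (cplx_covector (e 1 y) (e 2 y)) (cplx_covector (e 3 y) (e 4 y)))
               (cplx_covector (e 5 y) (e 6 y))))"

definition half_flat ::
  "('a, 'i, 'e::euclidean_space) manifold \<Rightarrow>
   ('i, 'e) form \<Rightarrow> ('i, 'e) form \<Rightarrow> ('i, 'e) form \<Rightarrow> bool" where
  "half_flat M F \<Psi>p \<Psi>m \<longleftrightarrow>
     su3_structure M F \<Psi>p \<Psi>m \<and>
     ext_d F \<and>\<^sub>f F =\<^bsub>M\<^esub> 0\<^sub>f \<and>
     ext_d \<Psi>p =\<^bsub>M\<^esub> 0\<^sub>f"


section \<open>The sin-cone\<close>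

text \<open>
  The product \<open>N \<times> (0, \<pi>)\<close> with the product charts \<open>(p, t) \<mapsto> (\<phi>\<^sub>i p, t)\<close>, which are indexed by the
  charts of \<open>N\<close>. The coordinate \<open>t\<close> is the second component of a point in every chart.
\<close>

definition sin_cone :: "('a, 'i, 'e) manifold \<Rightarrow> ('a \<times> real, 'i, 'e \<times> real) manifold" where
  "sin_cone N =
     \<lparr> mtop = prod_topology (mtop N) (top_of_set {0<..<pi}),
       charts = charts N,
       chart_dom = (\<lambda>i. chart_dom N i \<times> {0<..<pi}),
       chart_map = (\<lambda>i (p, t). (chart_map N i p, t)) \<rparr>"

text \<open>The pullback along the projection \<open>N \<times> (0, \<pi>) \<rightarrow> N\<close>, left implicit in the usual notation.\<close>

definition cone_pull :: "('i, 'e) form \<Rightarrow> ('i, 'e \<times> real) form" where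
  "cone_pull \<alpha> = (\<lambda>i (x, t) vs. \<alpha> i x (map fst vs))"

definition cone_dt :: "('i, 'e \<times> real) form" where
  "cone_dt = (\<lambda>i y vs. if length vs = 1 then snd (hd vs) else 0)"

text \<open>Multiplication of a form on \<open>N \<times> (0, \<pi>)\<close> by a function of \<open>t\<close>.\<close>

definition cone_scale :: "(real \<Rightarrow> real) \<Rightarrow> ('i, 'e \<times> real) form \<Rightarrow> ('i, 'e \<times> real) form"
  (infixr "*\<^sub>t" 70) where
  "f *\<^sub>t \<alpha> = (\<lambda>i (x, t) vs. f t * \<alpha> i (x, t) vs)"

definition cone_F ::
  "('i, 'e) form \<Rightarrow> (nat \<Rightarrow> ('i, 'e) form) \<Rightarrow> ('i, 'e \<times> real) form" where
  "cone_F \<eta> \<omega> =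
     (\<lambda>t. (sin t)\<^sup>2) *\<^sub>t ((\<lambda>t. sin t) *\<^sub>t cone_pull (\<omega> 1) +\<^sub>f (\<lambda>t. cos t) *\<^sub>t cone_pull (\<omega> 3))
     +\<^sub>f (\<lambda>t. sin t) *\<^sub>t (cone_pull \<eta> \<and>\<^sub>f cone_dt)"

definition cone_Psi_plus ::
  "('i, 'e) form \<Rightarrow> (nat \<Rightarrow> ('i, 'e) form) \<Rightarrow> ('i, 'e \<times> real) form" where
  "cone_Psi_plus \<eta> \<omega> =
     (\<lambda>t. (sin t) ^ 3) *\<^sub>t (cone_pull \<eta> \<and>\<^sub>f cone_pull (\<omega> 2))
     -\<^sub>f (\<lambda>t. (sin t)\<^sup>2) *\<^sub>t
          (((\<lambda>t. - cos t) *\<^sub>t cone_pull (\<omega> 1) +\<^sub>f (\<lambda>t. sin t) *\<^sub>t cone_pull (\<omega> 3)) \<and>\<^sub>f cone_dt)"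

definition cone_Psi_minus ::
  "('i, 'e) form \<Rightarrow> (nat \<Rightarrow> ('i, 'e) form) \<Rightarrow> ('i, 'e \<times> real) form" where
  "cone_Psi_minus \<eta> \<omega> =
     (\<lambda>t. (sin t) ^ 3) *\<^sub>t
       (((\<lambda>t. - cos t) *\<^sub>t cone_pull (\<omega> 1) +\<^sub>f (\<lambda>t. sin t) *\<^sub>t cone_pull (\<omega> 3)) \<and>\<^sub>f cone_pull \<eta>)
     +\<^sub>f (\<lambda>t. (sin t)\<^sup>2) *\<^sub>t (cone_pull (\<omega> 2) \<and>\<^sub>f cone_dt)"

end

theory Submission
  imports Defs
begin

text \<open>
  Let \<open>v\<close> be the common square of the \<open>\<omega>\<^sub>p\<close>. Sorting by \<open>dt\<close> on the sin-cone gives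
  \<open>d\<Psi>\<^sub>+ = sin\<^sup>3 t d(\<eta> \<and> \<omega>\<^sub>2) + dt \<and> (sin\<^sup>2 t cos t (3 \<eta> \<and> \<omega>\<^sub>2 - d\<omega>\<^sub>1) + sin\<^sup>3 t d\<omega>\<^sub>3)\<close>.
  This vanishes for all \<open>t\<close> if and only if \<open>d(\<eta> \<and> \<omega>\<^sub>2) = 0\<close>, \<open>d\<omega>\<^sub>3 = 0\<close> (take \<open>t = \<pi>/2\<close>) and
  \<open>d\<omega>\<^sub>1 = 3 \<eta> \<and> \<omega>\<^sub>2\<close> (take any other \<open>t\<close>). Once these hold, the component of \<open>dF \<and> F\<close> without \<open>dt\<close>
  contains only \<open>\<eta> \<and> \<omega>\<^sub>2 \<and> \<omega>\<^sub>1 = 0\<close> and \<open>\<eta> \<and> \<omega>\<^sub>2 \<and> \<omega>\<^sub>3 = 0\<close>, and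
  \<open>dF \<and> F = dt \<and> (sin\<^sup>3 t cos t (2 v + d(\<eta> \<and> \<omega>\<^sub>3)) + sin\<^sup>4 t d(\<eta> \<and> \<omega>\<^sub>1))\<close>.
  Its vanishing for all \<open>t\<close> is the remaining pair of equations of a double hypo structure. These
  computations are the lemmas \<open>ext_d_cone_Psi_plus\<close>, \<open>ext_d_cone_F\<close> and \<open>wedge_ext_d_cone_F\<close>; they are
  combined in \<open>half_flat_equations_iff\<close>. Condition (ii) differs from (i) only by
  \<open>d(\<eta> \<and> \<omega>\<^sub>2) = 0\<close>, which follows from \<open>d\<omega>\<^sub>1 = 3 \<eta> \<and> \<omega>\<^sub>2\<close> and \<open>d\<^sup>2 = 0\<close>, that is, from the symmetry of
  second derivatives.

  A half-flat structure is by definition an SU(3)-structure, so a local coframe that brings \<open>F\<close> and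
  \<open>\<Psi>\<^sub>\<plusminus>\<close> into normal form must be produced as well. It comes from a smooth local coframe on \<open>N\<close> with
  \<open>\<omega>\<^sub>1 = e\<^sup>1\<^sup>2 + e\<^sup>3\<^sup>4\<close>, \<open>\<omega>\<^sub>2 = e\<^sup>1\<^sup>3 - e\<^sup>2\<^sup>4\<close>, \<open>\<omega>\<^sub>3 = e\<^sup>1\<^sup>4 + e\<^sup>2\<^sup>3\<close> and \<open>e\<^sup>5 = \<eta>\<close>, by a rotation through
  the angle that \<open>t\<close> prescribes (\<open>cone_coframe\<close>). The coframe on \<open>N\<close> is written down explicitly
  (\<open>local_adapted_coframe\<close>): for a constant vector \<open>b\<close>, the contractions of \<open>\<omega>\<^sub>1, \<omega>\<^sub>2, \<omega>\<^sub>3\<close> with \<open>b\<close> are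
  proportional to \<open>e\<^sup>2, e\<^sup>3, e\<^sup>4\<close>, the metric dual of \<open>b\<close> is proportional to \<open>e\<^sup>1\<close> and is a rational
  expression in the \<open>\<omega>\<^sub>p\<close>, and one square root normalizes all four. That the radicand is positive is exactly the
  orientation condition on \<open>\<omega>\<^sub>3(X, Y)\<close>. Explicit formulas make smoothness automatic; that they work
  is linear algebra at a point, in the locale \<open>definite_triple\<close>.
\<close>

section \<open>Calculus of smooth functions\<close>

lemma Ck_on_cong:
  fixes f g :: "'e::euclidean_space \<Rightarrow> 'b::real_normed_vector"
  assumes "open S" "\<And>x. x \<in> S \<Longrightarrow> f x = g x"
  shows "Ck_on k S f \<longleftrightarrow> Ck_on k S g"
proof -
  have "Ck_on k S f \<Longrightarrow> Ck_on k S g" if fg: "\<And>x. x \<in> S \<Longrightarrow> f x = g x"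
    for f g :: "'e \<Rightarrow> 'b"
    using fg
  proof (induction k arbitrary: f g)
    case 0
    then show ?case by (auto cong: continuous_on_cong)
  next
    case (Suc k)
    have D: "(g has_derivative frechet_derivative f (at x)) (at x)" if "x \<in> S" for x
      using Suc.prems that assms(1)
      by (auto simp: frechet_derivative_works intro: has_derivative_transform_within_open)
    then have *: "frechet_derivative g (at x) = frechet_derivative f (at x)" if "x \<in> S" for x
      using frechet_derivative_at[OF D[OF that]] by simp
    have "g differentiable at x" if "x \<in> S" for x
      using D that by (auto simp: differentiable_def)
    moreover have "Ck_on k S (\<lambda>x. frechet_derivative g (at x) v)" for v
      using Suc.IH[of "\<lambda>x. frechet_derivative f (at x) v"] Suc.prems(1) * by auto
    ultimately show ?case by simp
  qed
  from this[of f g] this[of g f] show ?thesis using assms(2) by auto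
qed

lemma Ck_on_SucI:
  assumes "open S" "\<And>x. x \<in> S \<Longrightarrow> (f has_derivative f' x) (at x)"
    and "\<And>v. Ck_on k S (\<lambda>x. f' x v)"
  shows "Ck_on (Suc k) S f"
proof -
  have "frechet_derivative f (at x) = f' x" if "x \<in> S" for x
    using frechet_derivative_at[OF assms(2)[OF that]] by simp
  then have "Ck_on k S (\<lambda>x. frechet_derivative f (at x) v)" for v
    using Ck_on_cong[OF assms(1), of "\<lambda>x. frechet_derivative f (at x) v" "\<lambda>x. f' x v" k] assms(3)
    by auto
  then show ?thesis using assms(2) by (auto simp: differentiable_def)
qed

lemma Ck_on_has_derivative:
  "Ck_on (Suc k) S f \<Longrightarrow> x \<in> S \<Longrightarrow> (f has_derivative frechet_derivative f (at x)) (at x)"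
  by (simp add: frechet_derivative_works)

lemma Ck_on_lower: "Ck_on (Suc k) S f \<Longrightarrow> Ck_on k S f"
proof (induction k arbitrary: f)
  case 0
  then have "\<forall>x\<in>S. isCont f x" by (auto intro: differentiable_imp_continuous_within)
  then show ?case by (simp add: continuous_at_imp_continuous_on)
qed auto

lemma Ck_on_const: "open S \<Longrightarrow> Ck_on k S (\<lambda>x. c)"
proof (induction k arbitrary: c)
  case (Suc k)
  then show ?case by (intro Ck_on_SucI[where f' = "\<lambda>x v. 0"]) auto
qed auto

lemma Ck_on_add:
  "open S \<Longrightarrow> Ck_on k S f \<Longrightarrow> Ck_on k S g \<Longrightarrow> Ck_on k S (\<lambda>x. f x + g x)"
proof (induction k arbitrary: f g)
  case (Suc k)
  show ?case
    by (rule Ck_on_SucI[OF Suc.prems(1) has_derivative_add[OF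
          Ck_on_has_derivative[OF Suc.prems(2)] Ck_on_has_derivative[OF Suc.prems(3)]]])
      (use Suc in auto)
qed (auto intro: continuous_intros)

lemma Ck_on_mult:
  fixes f g :: "'e::euclidean_space \<Rightarrow> 'b::real_normed_algebra"
  shows "open S \<Longrightarrow> Ck_on k S f \<Longrightarrow> Ck_on k S g \<Longrightarrow> Ck_on k S (\<lambda>x. f x * g x)"
proof (induction k arbitrary: f g)
  case (Suc k)
  show ?case
    by (rule Ck_on_SucI[OF Suc.prems(1) has_derivative_mult[OF
          Ck_on_has_derivative[OF Suc.prems(2)] Ck_on_has_derivative[OF Suc.prems(3)]]])
      (use Suc in \<open>auto intro!: Ck_on_add Suc.IH Ck_on_lower[of k S f] Ck_on_lower[of k S g]\<close>)
qed (auto intro: continuous_intros)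

lemma Ck_on_subset: "Ck_on k S f \<Longrightarrow> T \<subseteq> S \<Longrightarrow> Ck_on k T f"
  by (induction k arbitrary: f) (auto intro: continuous_on_subset)

text \<open>The order \<open>k + 1\<close> of \<open>g \<circ> f\<close> is reduced to the order \<open>k\<close> of \<open>g' \<circ> f\<close>. For the inverse, the
  square root, the sine and the cosine, \<open>g'\<close> is an expression in \<open>g\<close> itself (or in its partner), so
  that an induction on \<open>k\<close> closes.\<close>

lemma Ck_on_chain:
  fixes f :: "'e::euclidean_space \<Rightarrow> real"
  assumes "open S" "Ck_on (Suc k) S f"
    and "\<And>x. x \<in> S \<Longrightarrow> (g has_real_derivative g' (f x)) (at (f x))"
    and "Ck_on k S (\<lambda>x. g' (f x))"
  shows "Ck_on (Suc k) S (\<lambda>x. g (f x))"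
proof (rule Ck_on_SucI[OF assms(1)])
  fix x assume x: "x \<in> S"
  show "((\<lambda>x. g (f x)) has_derivative (\<lambda>v. g' (f x) * frechet_derivative f (at x) v)) (at x)"
    using has_derivative_compose[OF Ck_on_has_derivative[OF assms(2) x], of g "(*) (g' (f x))"]
      assms(3)[OF x] by (simp add: has_field_derivative_def)
next
  fix v show "Ck_on k S (\<lambda>x. g' (f x) * frechet_derivative f (at x) v)"
    using assms by (intro Ck_on_mult) auto
qed

lemma Ck_on_inverse:
  fixes f :: "'e::euclidean_space \<Rightarrow> real"
  shows "open S \<Longrightarrow> Ck_on k S f \<Longrightarrow> (\<And>x. x \<in> S \<Longrightarrow> f x \<noteq> 0) \<Longrightarrow> Ck_on k S (\<lambda>x. inverse (f x))"
proof (induction k)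
  case (Suc k)
  show ?case
  proof (rule Ck_on_chain[where g = inverse and g' = "\<lambda>y. - 1 * (inverse y * inverse y)"])
    have "Ck_on k S (\<lambda>x. inverse (f x))" using Suc Ck_on_lower by blast
    then show "Ck_on k S (\<lambda>x. - 1 * (inverse (f x) * inverse (f x)))"
      using Suc.prems by (intro Ck_on_mult Ck_on_const)
    show "(inverse has_real_derivative - 1 * (inverse (f x) * inverse (f x))) (at (f x))"
      if "x \<in> S" for x
      using DERIV_inverse[of "f x"] Suc.prems(3)[OF that] by (simp add: power2_eq_square)
  qed (use Suc in auto)
qed (auto intro: continuous_intros)

lemma Ck_on_sqrt:
  fixes f :: "'e::euclidean_space \<Rightarrow> real"
  shows "open S \<Longrightarrow> Ck_on k S f \<Longrightarrow> (\<And>x. x \<in> S \<Longrightarrow> f x > 0) \<Longrightarrow> Ck_on k S (\<lambda>x. sqrt (f x))"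
proof (induction k)
  case (Suc k)
  show ?case
  proof (rule Ck_on_chain[where g = sqrt and g' = "\<lambda>y. inverse (sqrt y) * (1 / 2)"])
    have "Ck_on k S (\<lambda>x. sqrt (f x))" using Suc Ck_on_lower by blast
    then show "Ck_on k S (\<lambda>x. inverse (sqrt (f x)) * (1 / 2))"
      using Suc.prems by (intro Ck_on_mult Ck_on_inverse Ck_on_const) force+
    show "(sqrt has_real_derivative inverse (sqrt (f x)) * (1 / 2)) (at (f x))" if "x \<in> S" for x
      using DERIV_real_sqrt[of "f x"] Suc.prems(3)[OF that] by simp
  qed (use Suc in auto)
qed (auto intro: continuous_intros)

lemma Ck_on_sin_cos:
  fixes f :: "'e::euclidean_space \<Rightarrow> real"
  shows "open S \<Longrightarrow> Ck_on k S f \<Longrightarrow> Ck_on k S (\<lambda>x. sin (f x)) \<and> Ck_on k S (\<lambda>x. cos (f x))"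
proof (induction k)
  case (Suc k)
  then have IH: "Ck_on k S (\<lambda>x. sin (f x))" "Ck_on k S (\<lambda>x. cos (f x))"
    using Ck_on_lower by blast+
  have "Ck_on k S (\<lambda>x. - 1 * sin (f x))"
    using IH Suc.prems by (intro Ck_on_mult Ck_on_const)
  then show ?case
    using Ck_on_chain[OF Suc.prems, of sin cos] Ck_on_chain[OF Suc.prems, of cos "\<lambda>y. - sin y"] IH
    by (auto intro: DERIV_sin DERIV_cos)
qed (auto intro: continuous_intros)

text \<open>Precomposition with a linear projection; the derivative of \<open>f \<circ> L\<close> in the direction \<open>v\<close> is
  again of the form \<open>g \<circ> L\<close>, which is what the induction needs.\<close>

lemma Ck_on_compose_linear:
  fixes f :: "'e::euclidean_space \<Rightarrow> 'b::real_normed_vector" and L :: "'d::euclidean_space \<Rightarrow> 'e"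
  assumes "open T" "bounded_linear L" "L ` T \<subseteq> S"
  shows "Ck_on k S f \<Longrightarrow> Ck_on k T (\<lambda>y. f (L y))"
proof (induction k arbitrary: f)
  case 0
  then show ?case
    using continuous_on_compose2[OF _ linear_continuous_on[OF assms(2)] assms(3)] by simp
next
  case (Suc k)
  show ?case
  proof (rule Ck_on_SucI[OF assms(1)])
    fix y assume "y \<in> T"
    then have "L y \<in> S" using assms(3) by auto
    then show "((\<lambda>y. f (L y)) has_derivative (\<lambda>v. frechet_derivative f (at (L y)) (L v))) (at y)"
      by (rule has_derivative_compose[OF bounded_linear_imp_has_derivative[OF assms(2)]
          Ck_on_has_derivative[OF Suc.prems]])
  next
    fix v show "Ck_on k T (\<lambda>y. frechet_derivative f (at (L y)) (L v))"
      using Suc by auto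
  qed
qed

named_theorems smooth_intros

lemma smooth_on_const [smooth_intros]: "open S \<Longrightarrow> smooth_on S (\<lambda>x. c)"
  by (simp add: smooth_on_def Ck_on_const)

lemma smooth_on_add [smooth_intros]:
  "open S \<Longrightarrow> smooth_on S f \<Longrightarrow> smooth_on S g \<Longrightarrow> smooth_on S (\<lambda>x. f x + g x)"
  by (simp add: smooth_on_def Ck_on_add)

lemma smooth_on_mult [smooth_intros]:
  fixes f g :: "'e::euclidean_space \<Rightarrow> 'b::real_normed_algebra"
  shows "open S \<Longrightarrow> smooth_on S f \<Longrightarrow> smooth_on S g \<Longrightarrow> smooth_on S (\<lambda>x. f x * g x)"
  by (simp add: smooth_on_def Ck_on_mult)

lemma smooth_on_minus [smooth_intros]:
  fixes f :: "'e::euclidean_space \<Rightarrow> real"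
  shows "open S \<Longrightarrow> smooth_on S f \<Longrightarrow> smooth_on S (\<lambda>x. - f x)"
  using smooth_on_mult[of S "\<lambda>x. - 1" f] by (simp add: smooth_on_const)

lemma smooth_on_diff [smooth_intros]:
  fixes f :: "'e::euclidean_space \<Rightarrow> real"
  shows "open S \<Longrightarrow> smooth_on S f \<Longrightarrow> smooth_on S g \<Longrightarrow> smooth_on S (\<lambda>x. f x - g x)"
  using smooth_on_add[of S f "\<lambda>x. - g x"] by (simp add: smooth_on_minus)

lemma smooth_on_inverse [smooth_intros]:
  fixes f :: "'e::euclidean_space \<Rightarrow> real"
  shows "open S \<Longrightarrow> smooth_on S f \<Longrightarrow> (\<And>x. x \<in> S \<Longrightarrow> f x \<noteq> 0) \<Longrightarrow> smooth_on S (\<lambda>x. inverse (f x))"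
  by (simp add: smooth_on_def Ck_on_inverse)

lemma smooth_on_divide [smooth_intros]:
  fixes f :: "'e::euclidean_space \<Rightarrow> real"
  shows "open S \<Longrightarrow> smooth_on S f \<Longrightarrow> smooth_on S g \<Longrightarrow> (\<And>x. x \<in> S \<Longrightarrow> g x \<noteq> 0)
    \<Longrightarrow> smooth_on S (\<lambda>x. f x / g x)"
  unfolding divide_inverse by (intro smooth_on_mult smooth_on_inverse)

lemma smooth_on_sqrt [smooth_intros]:
  fixes f :: "'e::euclidean_space \<Rightarrow> real"
  shows "open S \<Longrightarrow> smooth_on S f \<Longrightarrow> (\<And>x. x \<in> S \<Longrightarrow> f x > 0) \<Longrightarrow> smooth_on S (\<lambda>x. sqrt (f x))"
  by (simp add: smooth_on_def Ck_on_sqrt)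

lemma smooth_on_sin [smooth_intros]:
  fixes f :: "'e::euclidean_space \<Rightarrow> real"
  shows "open S \<Longrightarrow> smooth_on S f \<Longrightarrow> smooth_on S (\<lambda>x. sin (f x))"
  by (simp add: smooth_on_def Ck_on_sin_cos)

lemma smooth_on_cos [smooth_intros]:
  fixes f :: "'e::euclidean_space \<Rightarrow> real"
  shows "open S \<Longrightarrow> smooth_on S f \<Longrightarrow> smooth_on S (\<lambda>x. cos (f x))"
  by (simp add: smooth_on_def Ck_on_sin_cos)

lemma smooth_on_power [smooth_intros]:
  fixes f :: "'e::euclidean_space \<Rightarrow> real"
  shows "open S \<Longrightarrow> smooth_on S f \<Longrightarrow> smooth_on S (\<lambda>x. f x ^ n)"
  by (induction n) (auto intro: smooth_on_const smooth_on_mult)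

lemma smooth_on_sum [smooth_intros]:
  assumes "open S" "\<And>a. a \<in> I \<Longrightarrow> smooth_on S (f a)"
  shows "smooth_on S (\<lambda>x. \<Sum>a\<in>I. f a x)"
  using assms(2)
  by (induction I rule: infinite_finite_induct) (auto intro: smooth_on_const smooth_on_add assms(1))

lemma smooth_on_subset: "smooth_on S f \<Longrightarrow> T \<subseteq> S \<Longrightarrow> smooth_on T f"
  unfolding smooth_on_def using Ck_on_subset by blast

lemma smooth_on_compose_fst:
  fixes f :: "'e::euclidean_space \<Rightarrow> 'b::real_normed_vector"
  assumes "open T" "smooth_on S f" "fst ` T \<subseteq> S"
  shows "smooth_on (T :: ('e \<times> 'd::euclidean_space) set) (\<lambda>y. f (fst y))"
  using assms(2) Ck_on_compose_linear[OF assms(1) bounded_linear_fst assms(3), of _ f]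
  by (simp add: smooth_on_def)

lemma smooth_on_snd:
  fixes T :: "('e::euclidean_space \<times> real) set"
  shows "open T \<Longrightarrow> smooth_on T snd"
proof -
  assume "open T"
  have "Ck_on k T snd" for k
  proof (cases k)
    case (Suc n)
    show ?thesis unfolding Suc
      by (rule Ck_on_SucI[OF \<open>open T\<close>, where f' = "\<lambda>x. snd"])
        (auto intro!: Ck_on_const \<open>open T\<close> bounded_linear_imp_has_derivative bounded_linear_snd)
  qed (auto intro: continuous_intros)
  then show ?thesis by (simp add: smooth_on_def)
qed

lemma smooth_on_has_derivative:
  "smooth_on S f \<Longrightarrow> x \<in> S \<Longrightarrow> (f has_derivative frechet_derivative f (at x)) (at x)"
  using Ck_on_has_derivative[of 0] unfolding smooth_on_def by blast

lemma smooth_on_frechet_derivative: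
  "smooth_on S f \<Longrightarrow> smooth_on S (\<lambda>x. frechet_derivative f (at x) v)"
  unfolding smooth_on_def by (metis Ck_on.simps(2))

lemma smooth_on_imp_continuous_on: "smooth_on S f \<Longrightarrow> continuous_on S f"
  unfolding smooth_on_def by (metis Ck_on.simps(1))

text \<open>Schwarz: the second difference of \<open>f\<close> along a small parallelogram with sides \<open>h a\<close>, \<open>h b\<close>
  equals, by two applications of the mean value theorem, \<open>h\<^sup>2\<close> times a mixed second derivative at a
  nearby point, in either order of differentiation.\<close>

lemma second_difference_mean_value:
  fixes f :: "'e::euclidean_space \<Rightarrow> real"
  assumes f: "smooth_on S f" and h: "0 < h"
    and S: "\<And>s t. 0 \<le> s \<Longrightarrow> s \<le> h \<Longrightarrow> 0 \<le> t \<Longrightarrow> t \<le> h \<Longrightarrow> x + s *\<^sub>R a + t *\<^sub>R b \<in> S"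
  obtains s t where "0 \<le> s" "s \<le> h" "0 \<le> t" "t \<le> h"
    "f (x + h *\<^sub>R a + h *\<^sub>R b) - f (x + h *\<^sub>R a) - f (x + h *\<^sub>R b) + f x =
     h * h * frechet_derivative (\<lambda>y. frechet_derivative f (at y) a) (at (x + s *\<^sub>R a + t *\<^sub>R b)) b"
proof -
  define D where "D v y = frechet_derivative f (at y) v" for v y
  have D: "smooth_on S (D v)" for v
    unfolding D_def by (rule smooth_on_frechet_derivative[OF f])
  have line: "((\<lambda>s. g (z + s *\<^sub>R v)) has_real_derivative frechet_derivative g (at (z + s *\<^sub>R v)) v) (at s)"
    if "smooth_on S g" "z + s *\<^sub>R v \<in> S" for g :: "'e \<Rightarrow> real" and z v s
  proof -
    note g = smooth_on_has_derivative[OF that]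
    have "((\<lambda>s. z + s *\<^sub>R v) has_derivative (\<lambda>r. r *\<^sub>R v)) (at s)"
      by (auto intro!: derivative_eq_intros)
    from has_derivative_compose[OF this g] show ?thesis
      using linear_cmul[OF has_derivative_linear[OF g]]
      by (simp add: has_field_derivative_def mult.commute[of _ "frechet_derivative g _ v"])
  qed
  let ?G = "\<lambda>s. f ((x + h *\<^sub>R b) + s *\<^sub>R a) - f (x + s *\<^sub>R a)"
  have "(?G has_real_derivative D a ((x + h *\<^sub>R b) + s *\<^sub>R a) - D a (x + s *\<^sub>R a)) (at s)"
    if "0 \<le> s" "s \<le> h" for s
    unfolding D_def using S[of s h] S[of s 0] that h
    by (intro DERIV_diff line f) (auto simp: algebra_simps)
  then obtain s where s: "0 < s" "s < h"
    "?G h - ?G 0 = h * (D a ((x + h *\<^sub>R b) + s *\<^sub>R a) - D a (x + s *\<^sub>R a))"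
    using MVT2[OF h, of ?G "\<lambda>s. D a ((x + h *\<^sub>R b) + s *\<^sub>R a) - D a (x + s *\<^sub>R a)"]
    by (metis (no_types, lifting) diff_zero)
  let ?H = "\<lambda>t. D a ((x + s *\<^sub>R a) + t *\<^sub>R b)"
  have "(?H has_real_derivative frechet_derivative (D a) (at ((x + s *\<^sub>R a) + t *\<^sub>R b)) b) (at t)"
    if "0 \<le> t" "t \<le> h" for t
    using S[of s t] that s by (intro line D) auto
  then obtain t where t: "0 < t" "t < h"
    "?H h - ?H 0 = h * frechet_derivative (D a) (at ((x + s *\<^sub>R a) + t *\<^sub>R b)) b"
    using MVT2[OF h, of ?H "\<lambda>t. frechet_derivative (D a) (at ((x + s *\<^sub>R a) + t *\<^sub>R b)) b"]
    by (metis (no_types, lifting) diff_zero)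
  show ?thesis
    by (rule that[of s t]) (use s t in \<open>simp_all add: D_def[abs_def] algebra_simps\<close>)
qed

text \<open>Both mixed derivatives take a common value at points that tend to \<open>x\<close> as the
  parallelogram shrinks; continuity then gives equality at \<open>x\<close>.\<close>

lemma symmetric_second_derivative:
  fixes f :: "'e::euclidean_space \<Rightarrow> real"
  assumes S: "open S" and f: "smooth_on S f" and x: "x \<in> S"
  shows "frechet_derivative (\<lambda>y. frechet_derivative f (at y) a) (at x) b =
         frechet_derivative (\<lambda>y. frechet_derivative f (at y) b) (at x) a"
proof -
  define P where "P y = frechet_derivative (\<lambda>y. frechet_derivative f (at y) a) (at y) b" for y
  define Q where "Q y = frechet_derivative (\<lambda>y. frechet_derivative f (at y) b) (at y) a" for y
  have "continuous_on S P" "continuous_on S Q"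
    unfolding P_def Q_def using f
    by (auto intro!: smooth_on_imp_continuous_on smooth_on_frechet_derivative)
  then have cont: "isCont P x" "isCont Q x"
    using S x by (auto simp: continuous_on_eq_continuous_at)
  obtain e where e: "e > 0" "ball x e \<subseteq> S" using S x by (meson open_contains_ball)
  define C where "C = norm a + norm b + 1"
  have C: "C > 0" unfolding C_def by (smt (verit) norm_ge_zero)
  have near: "norm (s *\<^sub>R a + t *\<^sub>R b) \<le> h * C" if "0 \<le> s" "s \<le> h" "0 \<le> t" "t \<le> h" for s t h
  proof -
    have "norm (s *\<^sub>R a + t *\<^sub>R b) \<le> s * norm a + t * norm b"
      using norm_triangle_ineq[of "s *\<^sub>R a" "t *\<^sub>R b"] that by simp
    also have "\<dots> \<le> h * norm a + h * norm b"
      using that by (intro add_mono mult_right_mono) auto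
    also have "\<dots> \<le> h * C" using that by (simp add: C_def distrib_left)
    finally show ?thesis .
  qed
  have pts: "\<exists>y z. dist y x \<le> h * C \<and> dist z x \<le> h * C \<and> P y = Q z" if h: "0 < h" "h * C < e" for h
  proof -
    have "x + s *\<^sub>R a + t *\<^sub>R b \<in> S" if "0 \<le> s" "s \<le> h" "0 \<le> t" "t \<le> h" for s t
    proof -
      have "dist (x + s *\<^sub>R a + t *\<^sub>R b) x < e"
        using near[OF that] h by (simp add: dist_norm add.assoc)
      then show ?thesis using e(2) by (auto simp: dist_commute)
    qed
    note S1 = this
    have S2: "x + s *\<^sub>R b + t *\<^sub>R a \<in> S" if "0 \<le> s" "s \<le> h" "0 \<le> t" "t \<le> h" for s t
      using S1[of t s] that by (simp add: add_ac)
    obtain s t where st: "0 \<le> s" "s \<le> h" "0 \<le> t" "t \<le> h"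
      "f (x + h *\<^sub>R a + h *\<^sub>R b) - f (x + h *\<^sub>R a) - f (x + h *\<^sub>R b) + f x =
        h * h * P (x + s *\<^sub>R a + t *\<^sub>R b)"
      unfolding P_def by (rule second_difference_mean_value[OF f h(1) S1])
    obtain s' t' where st': "0 \<le> s'" "s' \<le> h" "0 \<le> t'" "t' \<le> h"
      "f (x + h *\<^sub>R b + h *\<^sub>R a) - f (x + h *\<^sub>R b) - f (x + h *\<^sub>R a) + f x =
        h * h * Q (x + s' *\<^sub>R b + t' *\<^sub>R a)"
      unfolding Q_def by (rule second_difference_mean_value[OF f h(1) S2])
    have "h * h * P (x + s *\<^sub>R a + t *\<^sub>R b) = h * h * Q (x + s' *\<^sub>R b + t' *\<^sub>R a)"
      using st(5) st'(5) by (simp add: algebra_simps)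
    then have "P (x + s *\<^sub>R a + t *\<^sub>R b) = Q (x + s' *\<^sub>R b + t' *\<^sub>R a)" using h by simp
    moreover have "dist (x + s *\<^sub>R a + t *\<^sub>R b) x \<le> h * C" "dist (x + s' *\<^sub>R b + t' *\<^sub>R a) x \<le> h * C"
      using near[OF st(1-4)] near[of t' h s'] st' by (auto simp: dist_norm add_ac)
    ultimately show ?thesis by blast
  qed
  have "P x = Q x"
  proof (rule ccontr)
    assume "P x \<noteq> Q x"
    define r where "r = dist (P x) (Q x) / 2"
    have r: "r > 0" using \<open>P x \<noteq> Q x\<close> by (simp add: r_def)
    obtain d1 where d1: "d1 > 0" "\<And>y. dist y x < d1 \<Longrightarrow> dist (P y) (P x) < r"
      using cont(1) r by (auto simp: continuous_at_eps_delta)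
    obtain d2 where d2: "d2 > 0" "\<And>y. dist y x < d2 \<Longrightarrow> dist (Q y) (Q x) < r"
      using cont(2) r by (auto simp: continuous_at_eps_delta)
    define h where "h = min e (min d1 d2) / (2 * C)"
    have h: "0 < h" "h * C < e" "h * C < d1" "h * C < d2"
      using e d1 d2 C by (auto simp: h_def)
    obtain y z where yz: "dist y x \<le> h * C" "dist z x \<le> h * C" "P y = Q z"
      using pts[OF h(1,2)] by auto
    have "dist (P y) (P x) < r" using d1(2)[of y] yz h by simp
    moreover have "dist (Q z) (Q x) < r" using d2(2)[of z] yz h by simp
    ultimately show False
      using yz(3) dist_triangle2[of "P x" "Q x" "P y"] by (simp add: r_def dist_commute)
  qed
  then show ?thesis by (simp add: P_def Q_def)
qed

section \<open>The wedge product in low degrees\<close>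

text \<open>The part of being a \<open>k\<close>-covector that makes the terms of other degrees drop out of a wedge
  product. It is kept separate because it also applies to complex-valued functions.\<close>

definition homogeneous :: "nat \<Rightarrow> ('e list \<Rightarrow> 'b::zero) \<Rightarrow> bool" where
  "homogeneous k \<alpha> \<longleftrightarrow> (\<forall>vs. length vs \<noteq> k \<longrightarrow> \<alpha> vs = 0)"

lemma homogeneousD: "homogeneous k \<alpha> \<Longrightarrow> length vs \<noteq> k \<Longrightarrow> \<alpha> vs = 0"
  by (simp add: homogeneous_def)

lemma wedge_Nil: "wedge \<alpha> \<beta> [] = \<alpha> [] * \<beta> []"
  by (simp add: wedge_def)

text \<open>Contraction with the first argument is an antiderivation. The shuffles of \<open>v # vs\<close> are
  split according to the factor that receives \<open>v\<close>; if it is the second one, \<open>v\<close> is overtaken by all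
  arguments of the first factor, whence the sign.\<close>

lemma wedge_Cons:
  fixes \<alpha> \<beta> :: "'e list \<Rightarrow> 'b::real_normed_field"
  shows "wedge \<alpha> \<beta> (v # vs) = wedge (\<lambda>l. \<alpha> (v # l)) \<beta> vs
    + wedge (\<lambda>l. (- 1) ^ length l * \<alpha> l) (\<lambda>l. \<beta> (v # l)) vs"
proof -
  define n where "n = length vs"
  define invs where "invs m S = {(a, b). a \<in> S \<and> b \<in> {..<m} - S \<and> b < (a::nat)}" for m S
  define g where "g S = (- 1) ^ card (invs (Suc n) S) * \<alpha> (nths (v # vs) S) * \<beta> (nths (v # vs) (- S))"
    for S
  have fin: "finite (invs m S)" if "S \<subseteq> {..<k}" for m S k
    by (rule finite_subset[of _ "{..<k} \<times> {..<m}"]) (use that in \<open>auto simp: invs_def\<close>)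
  have first: "g (insert 0 (Suc ` S)) =
      (- 1) ^ card (invs n S) * \<alpha> (v # nths vs S) * \<beta> (nths vs (- S))" for S
  proof -
    have "invs (Suc n) (insert 0 (Suc ` S)) = map_prod Suc Suc ` invs n S"
    proof (intro set_eqI iffI; clarify)
      fix a b assume "(a, b) \<in> invs (Suc n) (insert 0 (Suc ` S))"
      then show "(a, b) \<in> map_prod Suc Suc ` invs n S"
        by (cases b; cases a) (auto simp: invs_def image_iff)
    qed (auto simp: invs_def)
    moreover have "card (map_prod Suc Suc ` invs n S) = card (invs n S)"
      by (intro card_image inj_onI) auto
    moreover have "{j. j \<in> S} = S" "{j. j \<notin> S} = - S" by auto
    ultimately show ?thesis by (simp add: g_def nths_Cons image_iff)
  qed
  have second: "g (Suc ` S) =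
      (- 1) ^ card (invs n S) * ((- 1) ^ length (nths vs S) * \<alpha> (nths vs S)) * \<beta> (v # nths vs (- S))"
    if S: "S \<subseteq> {..<n}" for S
  proof -
    have "invs (Suc n) (Suc ` S) = map_prod Suc Suc ` invs n S \<union> (\<lambda>a. (Suc a, 0)) ` S"
    proof (intro set_eqI iffI; clarify)
      fix a b assume "(a, b) \<in> invs (Suc n) (Suc ` S)"
        "(a, b) \<notin> (\<lambda>a. (Suc a, 0)) ` S"
      then show "(a, b) \<in> map_prod Suc Suc ` invs n S"
        by (cases b; cases a) (auto simp: invs_def image_iff)
    qed (auto simp: invs_def)
    moreover have "card (map_prod Suc Suc ` invs n S \<union> (\<lambda>a. (Suc a, 0)) ` S)
        = card (map_prod Suc Suc ` invs n S) + card ((\<lambda>a. (Suc a, 0::nat)) ` S)"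
      using fin[OF S] finite_subset[OF S] by (intro card_Un_disjoint) auto
    moreover have "card (map_prod Suc Suc ` invs n S) = card (invs n S)"
      by (intro card_image inj_onI) auto
    ultimately have "card (invs (Suc n) (Suc ` S)) = card (invs n S) + card S"
      by (simp add: card_image inj_on_def)
    moreover have "length (nths vs S) = card S"
      using S by (auto simp: length_nths n_def intro!: arg_cong[of _ _ card])
    moreover have "{j. j \<in> S} = S" "{j. j \<notin> S} = - S" by auto
    ultimately show ?thesis by (simp add: g_def nths_Cons image_iff power_add)
  qed
  have "wedge \<alpha> \<beta> (v # vs) = sum g (Pow {..<Suc n})"
    by (simp add: wedge_def g_def invs_def n_def)
  also have "Pow {..<Suc n} = image Suc ` Pow {..<n} \<union> (\<lambda>S. insert 0 (Suc ` S)) ` Pow {..<n}"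
    by (simp only: lessThan_Suc_eq_insert_0 Pow_insert image_Pow_surj[of Suc "{..<n}", OF refl, symmetric]
        image_image)
  also have "sum g \<dots> = sum g (image Suc ` Pow {..<n}) + sum g ((\<lambda>S. insert 0 (Suc ` S)) ` Pow {..<n})"
    by (intro sum.union_disjoint) auto
  also have "sum g (image Suc ` Pow {..<n}) = (\<Sum>S\<in>Pow {..<n}. g (Suc ` S))"
    by (subst sum.reindex) (auto simp: inj_on_def inj_image_eq_iff)
  also have "sum g ((\<lambda>S. insert 0 (Suc ` S)) ` Pow {..<n}) = (\<Sum>S\<in>Pow {..<n}. g (insert 0 (Suc ` S)))"
  proof (subst sum.reindex)
    show "inj_on (\<lambda>S. insert 0 (Suc ` S)) (Pow {..<n})"
    proof (rule inj_onI)
      fix S T :: "nat set" assume "insert 0 (Suc ` S) = insert 0 (Suc ` T)"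
      then have "Suc ` S = Suc ` T" by (metis Diff_insert_absorb Suc_not_Zero image_iff nat.distinct(1))
      then show "S = T" by (simp add: inj_image_eq_iff)
    qed
  qed auto
  finally have split: "wedge \<alpha> \<beta> (v # vs) =
    (\<Sum>S\<in>Pow {..<n}. g (Suc ` S)) + (\<Sum>S\<in>Pow {..<n}. g (insert 0 (Suc ` S)))" .
  have W: "wedge \<gamma> \<delta> vs = (\<Sum>S\<in>Pow {..<n}. (- 1) ^ card (invs n S) * \<gamma> (nths vs S) * \<delta> (nths vs (- S)))"
    for \<gamma> \<delta> :: "'e list \<Rightarrow> 'b"
    by (simp add: wedge_def invs_def n_def)
  show ?thesis
    unfolding split by (simp add: first second W)
qed

lemma homogeneous_wedge:
  assumes "homogeneous p \<alpha>" "homogeneous q \<beta>" "p + q = n"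
  shows "homogeneous n (wedge \<alpha> \<beta>)"
  unfolding homogeneous_def wedge_def
proof (intro allI impI sum.neutral ballI)
  fix vs :: "'a list" and S assume vs: "length vs \<noteq> n" and S: "S \<in> Pow {..<length vs}"
  have "length (nths vs S) + length (nths vs (- S)) =
      card ({i. i < length vs \<and> i \<in> S} \<union> {i. i < length vs \<and> i \<in> - S})"
    unfolding length_nths by (intro card_Un_disjoint[symmetric]) auto
  also have "\<dots> = card {..<length vs}" by (intro arg_cong[of _ _ card]) auto
  finally have "length (nths vs S) \<noteq> p \<or> length (nths vs (- S)) \<noteq> q" using vs assms(3) by auto
  then show "(- 1) ^ card {(a, b). a \<in> S \<and> b \<in> {..<length vs} - S \<and> b < a}
      * \<alpha> (nths vs S) * \<beta> (nths vs (- S)) = 0"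
    using assms homogeneousD by fastforce
qed

lemma homogeneous_eqI:
  assumes "homogeneous k \<alpha>" "homogeneous k \<beta>" "\<And>vs. length vs = k \<Longrightarrow> \<alpha> vs = \<beta> vs"
  shows "\<alpha> = \<beta>"
  using assms by (metis ext homogeneousD)

lemma wedge_map: "wedge \<alpha> \<beta> (map f vs) = wedge (\<lambda>l. \<alpha> (map f l)) (\<lambda>l. \<beta> (map f l)) vs"
  by (simp add: wedge_def nths_map)

context
  fixes \<alpha> \<beta> :: "'e list \<Rightarrow> 'b::real_normed_field"
begin

lemma wedge_1_1:
  assumes "homogeneous 1 \<alpha>" "homogeneous 1 \<beta>"
  shows "wedge \<alpha> \<beta> [a, b] = \<alpha> [a] * \<beta> [b] - \<alpha> [b] * \<beta> [a]"
  using assms by (simp add: wedge_Cons wedge_Nil homogeneousD)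

lemma wedge_1_2:
  assumes "homogeneous 1 \<alpha>" "homogeneous 2 \<beta>"
  shows "wedge \<alpha> \<beta> [a, b, c] = \<alpha> [a] * \<beta> [b, c] - \<alpha> [b] * \<beta> [a, c] + \<alpha> [c] * \<beta> [a, b]"
  using assms by (simp add: wedge_Cons wedge_Nil homogeneousD)

lemma wedge_2_1:
  assumes "homogeneous 2 \<alpha>" "homogeneous 1 \<beta>"
  shows "wedge \<alpha> \<beta> [a, b, c] = \<alpha> [a, b] * \<beta> [c] - \<alpha> [a, c] * \<beta> [b] + \<alpha> [b, c] * \<beta> [a]"
  using assms by (simp add: wedge_Cons wedge_Nil homogeneousD)

lemma wedge_1_3:
  assumes "homogeneous 1 \<alpha>" "homogeneous 3 \<beta>"
  shows "wedge \<alpha> \<beta> [a, b, c, d] =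
    \<alpha> [a] * \<beta> [b, c, d] - \<alpha> [b] * \<beta> [a, c, d] + \<alpha> [c] * \<beta> [a, b, d] - \<alpha> [d] * \<beta> [a, b, c]"
  using assms by (simp add: wedge_Cons wedge_Nil homogeneousD)

lemma wedge_3_1:
  assumes "homogeneous 3 \<alpha>" "homogeneous 1 \<beta>"
  shows "wedge \<alpha> \<beta> [a, b, c, d] =
    \<alpha> [a, b, c] * \<beta> [d] - \<alpha> [a, b, d] * \<beta> [c] + \<alpha> [a, c, d] * \<beta> [b] - \<alpha> [b, c, d] * \<beta> [a]"
  using assms by (simp add: wedge_Cons wedge_Nil homogeneousD)

lemma wedge_2_2:
  assumes "homogeneous 2 \<alpha>" "homogeneous 2 \<beta>"
  shows "wedge \<alpha> \<beta> [a, b, c, d] =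
    \<alpha> [a, b] * \<beta> [c, d] - \<alpha> [a, c] * \<beta> [b, d] + \<alpha> [a, d] * \<beta> [b, c]
    + \<alpha> [b, c] * \<beta> [a, d] - \<alpha> [b, d] * \<beta> [a, c] + \<alpha> [c, d] * \<beta> [a, b]"
  using assms by (simp add: wedge_Cons wedge_Nil homogeneousD)

lemma wedge_4_1:
  assumes "homogeneous 4 \<alpha>" "homogeneous 1 \<beta>"
  shows "wedge \<alpha> \<beta> [a, b, c, d, e] =
    \<alpha> [a, b, c, d] * \<beta> [e] - \<alpha> [a, b, c, e] * \<beta> [d] + \<alpha> [a, b, d, e] * \<beta> [c]
    - \<alpha> [a, c, d, e] * \<beta> [b] + \<alpha> [b, c, d, e] * \<beta> [a]"
  using assms by (simp add: wedge_Cons wedge_Nil homogeneousD)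

lemma wedge_1_4:
  assumes "homogeneous 1 \<alpha>" "homogeneous 4 \<beta>"
  shows "wedge \<alpha> \<beta> [a, b, c, d, e] =
    \<alpha> [a] * \<beta> [b, c, d, e] - \<alpha> [b] * \<beta> [a, c, d, e] + \<alpha> [c] * \<beta> [a, b, d, e]
    - \<alpha> [d] * \<beta> [a, b, c, e] + \<alpha> [e] * \<beta> [a, b, c, d]"
  using assms by (simp add: wedge_Cons wedge_Nil homogeneousD)

lemma wedge_3_2:
  assumes "homogeneous 3 \<alpha>" "homogeneous 2 \<beta>"
  shows "wedge \<alpha> \<beta> [a, b, c, d, e] =
    \<alpha> [a, b, c] * \<beta> [d, e] - \<alpha> [a, b, d] * \<beta> [c, e] + \<alpha> [a, b, e] * \<beta> [c, d]
    + \<alpha> [a, c, d] * \<beta> [b, e] - \<alpha> [a, c, e] * \<beta> [b, d] + \<alpha> [a, d, e] * \<beta> [b, c]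
    - \<alpha> [b, c, d] * \<beta> [a, e] + \<alpha> [b, c, e] * \<beta> [a, d] - \<alpha> [b, d, e] * \<beta> [a, c]
    + \<alpha> [c, d, e] * \<beta> [a, b]"
  using assms by (simp add: wedge_Cons wedge_Nil homogeneousD)

end

section \<open>Covectors\<close>

lemma covector_homogeneous: "covector k \<alpha> \<Longrightarrow> homogeneous k \<alpha>"
  by (simp add: covector_def homogeneous_def)

lemma covector_linear:
  assumes "covector k \<alpha>" "length vs = k" "i < k"
  shows "linear (\<lambda>u. \<alpha> (vs[i := u]))"
  using assms by (auto simp: covector_def)

lemma covector_1_linear: "covector 1 \<alpha> \<Longrightarrow> linear (\<lambda>u. \<alpha> [u])"
  using covector_linear[of 1 \<alpha> "[0]" 0] by simp

lemma covector_2_linear: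
  assumes "covector 2 \<alpha>"
  shows "linear (\<lambda>u. \<alpha> [u, b])" "linear (\<lambda>u. \<alpha> [a, u])"
  using covector_linear[OF assms, of "[a, b]" 0] covector_linear[OF assms, of "[a, b]" 1] by auto

lemma covector_2_diag: "covector 2 \<alpha> \<Longrightarrow> \<alpha> [a, a] = 0"
  by (simp add: covector_def)

lemma covector_2_swap:
  assumes "covector 2 \<alpha>"
  shows "\<alpha> [b, a] = - \<alpha> [a, b]"
proof -
  have "\<alpha> [a + b, a + b] = \<alpha> [a, a] + \<alpha> [a, b] + \<alpha> [b, a] + \<alpha> [b, b]"
    by (simp add: covector_2_linear[OF assms, THEN linear_add])
  then show ?thesis by (simp add: covector_2_diag[OF assms])
qed

lemma length_Suc_0_conv: "length vs = Suc 0 \<longleftrightarrow> (\<exists>a. vs = [a])"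
  by (auto simp: length_Suc_conv)

lemma length_2_conv: "length vs = 2 \<longleftrightarrow> (\<exists>a b. vs = [a, b])"
  by (auto simp: length_Suc_conv numeral_eq_Suc)

lemma length_3_conv: "length vs = 3 \<longleftrightarrow> (\<exists>a b c. vs = [a, b, c])"
  by (auto simp: length_Suc_conv numeral_eq_Suc)

lemma length_4_conv: "length vs = 4 \<longleftrightarrow> (\<exists>a b c d. vs = [a, b, c, d])"
  by (auto simp: length_Suc_conv numeral_eq_Suc)

lemma length_5_conv: "length vs = 5 \<longleftrightarrow> (\<exists>a b c d e. vs = [a, b, c, d, e])"
  by (auto simp: length_Suc_conv numeral_eq_Suc)

lemma covector_1I:
  assumes "homogeneous 1 \<alpha>" "linear (\<lambda>u. \<alpha> [u])"
  shows "covector 1 \<alpha>"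
  using assms by (auto simp: covector_def homogeneous_def length_Suc_0_conv)

lemma covector_2I:
  assumes "homogeneous 2 \<alpha>" "\<And>b. linear (\<lambda>u. \<alpha> [u, b])" "\<And>a. linear (\<lambda>u. \<alpha> [a, u])"
    and "\<And>a. \<alpha> [a, a] = 0"
  shows "covector 2 \<alpha>"
  using assms by (auto simp: covector_def homogeneous_def length_2_conv dest!: less_2_cases)

lemma covector_3I:
  assumes "homogeneous 3 \<alpha>"
    and "\<And>b c. linear (\<lambda>u. \<alpha> [u, b, c])" "\<And>a c. linear (\<lambda>u. \<alpha> [a, u, c])"
      "\<And>a b. linear (\<lambda>u. \<alpha> [a, b, u])"
    and "\<And>a c. \<alpha> [a, a, c] = 0" "\<And>a b. \<alpha> [a, b, a] = 0" "\<And>a b. \<alpha> [a, b, b] = 0"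
  shows "covector 3 \<alpha>"
proof -
  have "i = 0 \<or> i = 1 \<or> i = 2" if "i < 3" for i :: nat using that by linarith
  then show ?thesis using assms
    by (fastforce simp: covector_def homogeneous_def length_3_conv numeral_2_eq_2)
qed

lemma covector_wedge_1_1:
  assumes "covector 1 \<alpha>" "covector 1 \<beta>"
  shows "covector 2 (wedge \<alpha> \<beta>)"
proof (rule covector_2I)
  note [simp] = wedge_1_1[OF assms[THEN covector_homogeneous]]
  note lin = assms[THEN covector_1_linear]
  show "homogeneous 2 (wedge \<alpha> \<beta>)"
    by (rule homogeneous_wedge[OF assms[THEN covector_homogeneous]]) simp
  show "linear (\<lambda>u. wedge \<alpha> \<beta> [u, b])" "linear (\<lambda>u. wedge \<alpha> \<beta> [b, u])" for b
    by (auto intro!: linearI simp: linear_add[OF lin(1)] linear_add[OF lin(2)]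
        linear_cmul[OF lin(1)] linear_cmul[OF lin(2)] algebra_simps)
qed (simp add: wedge_1_1[OF assms[THEN covector_homogeneous]])

lemma covector_wedge_1_2:
  assumes "covector 1 \<alpha>" "covector 2 \<beta>"
  shows "covector 3 (wedge \<alpha> \<beta>)"
proof (rule covector_3I)
  note [simp] = wedge_1_2[OF assms[THEN covector_homogeneous]]
  note lin = covector_1_linear[OF assms(1)] covector_2_linear[OF assms(2)]
  show "homogeneous 3 (wedge \<alpha> \<beta>)"
    by (rule homogeneous_wedge[OF assms[THEN covector_homogeneous]]) simp
  show "linear (\<lambda>u. wedge \<alpha> \<beta> [u, b, c])" "linear (\<lambda>u. wedge \<alpha> \<beta> [b, u, c])"
    "linear (\<lambda>u. wedge \<alpha> \<beta> [b, c, u])" for b c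
    by (auto intro!: linearI simp: lin[THEN linear_add] lin[THEN linear_cmul] algebra_simps)
  show "wedge \<alpha> \<beta> [a, b, a] = 0" for a b
    using covector_2_swap[OF assms(2), of b a] by (simp add: covector_2_diag[OF assms(2)])
qed (simp_all add: wedge_1_2[OF assms[THEN covector_homogeneous]] covector_2_diag[OF assms(2)])

lemma wedge_2_1_commute:
  assumes "covector 2 \<alpha>" "covector 1 \<beta>"
  shows "wedge \<alpha> \<beta> = wedge \<beta> \<alpha>"
proof (rule homogeneous_eqI[of 3])
  note hom = assms[THEN covector_homogeneous]
  show "homogeneous 3 (wedge \<alpha> \<beta>)" by (rule homogeneous_wedge[OF hom]) simp
  show "homogeneous 3 (wedge \<beta> \<alpha>)" by (rule homogeneous_wedge[OF hom(2,1)]) simp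
  show "wedge \<alpha> \<beta> vs = wedge \<beta> \<alpha> vs" if "length vs = 3" for vs
    using that by (auto simp: length_3_conv wedge_1_2[OF hom(2,1)] wedge_2_1[OF hom])
qed

lemma covector_wedge_2_1:
  assumes "covector 2 \<alpha>" "covector 1 \<beta>"
  shows "covector 3 (wedge \<alpha> \<beta>)"
  using covector_wedge_1_2[OF assms(2,1)] by (simp add: wedge_2_1_commute[OF assms])

lemma covector_add:
  assumes "covector k \<alpha>" "covector k \<beta>"
  shows "covector k (\<lambda>vs. \<alpha> vs + \<beta> vs)"
  using assms by (auto simp: covector_def intro!: linear_compose_add)

lemma covector_scale:
  assumes "covector k \<alpha>"
  shows "covector k (\<lambda>vs. c * \<alpha> vs)"
  using assms linear_compose_scale_right[of "\<lambda>u. \<alpha> (vs[i := u])" c for vs i]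
  unfolding covector_def by auto

lemma covector_diff:
  assumes "covector k \<alpha>" "covector k \<beta>"
  shows "covector k (\<lambda>vs. \<alpha> vs - \<beta> vs)"
  using covector_add[OF assms(1) covector_scale[OF assms(2), of "- 1"]] by simp

lemma covector_pull:
  assumes "covector k \<alpha>" "linear L"
  shows "covector k (\<lambda>vs. \<alpha> (map L vs))"
  unfolding covector_def
proof (intro conjI allI impI)
  fix vs :: "'b list" and i assume *: "length vs = k \<and> i < k"
  have "linear ((\<lambda>u. \<alpha> ((map L vs)[i := u])) \<circ> L)"
    using * assms by (intro linear_compose covector_linear[of k]) auto
  then show "linear (\<lambda>u. \<alpha> (map L (vs[i := u])))"
    by (simp add: comp_def map_update)
next
  fix vs :: "'b list" assume *: "length vs = k \<and> \<not> distinct vs"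
  then have "\<not> distinct (map L vs)" by (simp add: distinct_map)
  then show "\<alpha> (map L vs) = 0" using * assms by (simp add: covector_def)
qed (use assms in \<open>simp add: covector_def\<close>)

lemma smooth_covector_fieldD:
  "smooth_covector_field k S \<alpha> \<Longrightarrow> x \<in> S \<Longrightarrow> covector k (\<alpha> x)"
  "smooth_covector_field k S \<alpha> \<Longrightarrow> smooth_on S (\<lambda>x. \<alpha> x vs)"
  by (auto simp: smooth_covector_field_def)

lemma smooth_on_wedge [smooth_intros]:
  fixes \<alpha> \<beta> :: "'d::euclidean_space \<Rightarrow> 'e list \<Rightarrow> real"
  assumes "open S" "\<And>vs. smooth_on S (\<lambda>x. \<alpha> x vs)" "\<And>vs. smooth_on S (\<lambda>x. \<beta> x vs)"
  shows "smooth_on S (\<lambda>x. wedge (\<alpha> x) (\<beta> x) vs)"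
  unfolding wedge_def by (intro smooth_intros assms)

lemma smooth_covector_field_wedge:
  assumes "open S"
  shows "smooth_covector_field 1 S \<alpha> \<Longrightarrow> smooth_covector_field 1 S \<beta> \<Longrightarrow>
      smooth_covector_field 2 S (\<lambda>x. wedge (\<alpha> x) (\<beta> x))"
    and "smooth_covector_field 1 S \<alpha> \<Longrightarrow> smooth_covector_field 2 S \<beta> \<Longrightarrow>
      smooth_covector_field 3 S (\<lambda>x. wedge (\<alpha> x) (\<beta> x))"
    and "smooth_covector_field 2 S \<alpha> \<Longrightarrow> smooth_covector_field 1 S \<beta> \<Longrightarrow>
      smooth_covector_field 3 S (\<lambda>x. wedge (\<alpha> x) (\<beta> x))"
  unfolding smooth_covector_field_def
  by (simp_all add: covector_wedge_1_1[unfolded One_nat_def] covector_wedge_1_2[unfolded One_nat_def]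
      covector_wedge_2_1[unfolded One_nat_def] smooth_on_wedge assms)

lemma smooth_covector_field_add:
  assumes "open S"
  shows "smooth_covector_field k S \<alpha> \<Longrightarrow> smooth_covector_field k S \<beta> \<Longrightarrow>
      smooth_covector_field k S (\<lambda>x vs. \<alpha> x vs + \<beta> x vs)"
    and "smooth_covector_field k S \<alpha> \<Longrightarrow> smooth_covector_field k S \<beta> \<Longrightarrow>
      smooth_covector_field k S (\<lambda>x vs. \<alpha> x vs - \<beta> x vs)"
    and "smooth_on S f \<Longrightarrow> smooth_covector_field k S \<alpha> \<Longrightarrow>
      smooth_covector_field k S (\<lambda>x vs. f x * \<alpha> x vs)"
  unfolding smooth_covector_field_def
  by (auto intro!: covector_add covector_diff covector_scale smooth_intros assms)

section \<open>The exterior derivative in low degrees\<close>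

lemma frechet_derivative_cong_open:
  assumes "open S" "x \<in> S" "\<And>y. y \<in> S \<Longrightarrow> f y = g y"
  shows "frechet_derivative f (at x) = frechet_derivative g (at x)"
proof -
  have "(f has_derivative F) (at x) \<longleftrightarrow> (g has_derivative F) (at x)" for F
  proof
    assume "(f has_derivative F) (at x)"
    then show "(g has_derivative F) (at x)"
      by (rule has_derivative_transform_within_open[OF _ assms])
  next
    assume "(g has_derivative F) (at x)"
    then show "(f has_derivative F) (at x)"
      by (rule has_derivative_transform_within_open[OF _ assms(1,2)]) (simp add: assms(3))
  qed
  then show ?thesis by (simp add: frechet_derivative_def)
qed

lemma ext_d_cong:
  assumes "open S" "x \<in> S" "\<And>y. y \<in> S \<Longrightarrow> \<alpha> i y = \<beta> i y"
  shows "ext_d \<alpha> i x = ext_d \<beta> i x"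
proof -
  have "frechet_derivative (\<lambda>y. \<alpha> i y l) (at x) = frechet_derivative (\<lambda>y. \<beta> i y l) (at x)" for l
    by (intro frechet_derivative_cong_open[OF assms(1,2)]) (simp add: assms(3))
  then show ?thesis by (simp add: ext_d_def)
qed

lemma homogeneous_ext_d:
  assumes "open S" "x \<in> S" "\<And>y. y \<in> S \<Longrightarrow> homogeneous k (\<alpha> i y)"
  shows "homogeneous (Suc k) (ext_d \<alpha> i x)"
  unfolding homogeneous_def ext_d_def
proof (intro allI impI sum.neutral ballI)
  fix vs :: "'a list" and m assume vs: "length vs \<noteq> Suc k" "m \<in> {..<length vs}"
  then have "length (take m vs @ drop (Suc m) vs) \<noteq> k" by auto
  then have "frechet_derivative (\<lambda>y. \<alpha> i y (take m vs @ drop (Suc m) vs)) (at x)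
      = frechet_derivative (\<lambda>y. 0) (at x)"
    by (intro frechet_derivative_cong_open[OF assms(1,2)]) (simp add: homogeneousD[OF assms(3)])
  then show "(- 1) ^ m * frechet_derivative (\<lambda>y. \<alpha> i y (take m vs @ drop (Suc m) vs)) (at x) (vs ! m) = 0"
    by simp
qed

lemma ext_d_2: "ext_d \<alpha> i x [a, b] =
  frechet_derivative (\<lambda>y. \<alpha> i y [b]) (at x) a - frechet_derivative (\<lambda>y. \<alpha> i y [a]) (at x) b"
  by (simp add: ext_d_def)

lemma ext_d_3: "ext_d \<alpha> i x [a, b, c] =
  frechet_derivative (\<lambda>y. \<alpha> i y [b, c]) (at x) a - frechet_derivative (\<lambda>y. \<alpha> i y [a, c]) (at x) b
  + frechet_derivative (\<lambda>y. \<alpha> i y [a, b]) (at x) c"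
  by (simp add: ext_d_def)

lemma ext_d_4: "ext_d \<alpha> i x [a, b, c, d] =
  frechet_derivative (\<lambda>y. \<alpha> i y [b, c, d]) (at x) a - frechet_derivative (\<lambda>y. \<alpha> i y [a, c, d]) (at x) b
  + frechet_derivative (\<lambda>y. \<alpha> i y [a, b, d]) (at x) c - frechet_derivative (\<lambda>y. \<alpha> i y [a, b, c]) (at x) d"
  by (simp add: ext_d_def)

text \<open>Leibniz's rule, by comparing the product rule for the coefficients of \<open>\<alpha> \<and> \<beta>\<close> with the
  expansions of the two wedge products.\<close>

lemma ext_d_wedge_1_2:
  assumes S: "open S" "x \<in> S"
    and \<alpha>: "smooth_covector_field 1 S (\<alpha> i)" and \<beta>: "smooth_covector_field 2 S (\<beta> i)"
  shows "ext_d (\<alpha> \<and>\<^sub>f \<beta>) i x =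
    (\<lambda>vs. wedge (ext_d \<alpha> i x) (\<beta> i x) vs - wedge (\<alpha> i x) (ext_d \<beta> i x) vs)"
proof (rule homogeneous_eqI[of 4])
  note hom = smooth_covector_fieldD(1)[OF \<alpha>, THEN covector_homogeneous]
    smooth_covector_fieldD(1)[OF \<beta>, THEN covector_homogeneous]
  note homd = homogeneous_ext_d[OF S, of 1 \<alpha> i, OF hom(1)]
    homogeneous_ext_d[OF S, of 2 \<beta> i, OF hom(2)]
  have homd: "homogeneous 2 (ext_d \<alpha> i x)" "homogeneous 3 (ext_d \<beta> i x)"
    using homd by (simp_all add: numeral_eq_Suc)
  show "homogeneous 4 (ext_d (\<alpha> \<and>\<^sub>f \<beta>) i x)"
    using homogeneous_ext_d[OF S, of 3 "\<alpha> \<and>\<^sub>f \<beta>" i] homogeneous_wedge[OF hom, of _ _ 3]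
    by (simp add: form_wedge_def)
  show "homogeneous 4 (\<lambda>vs. wedge (ext_d \<alpha> i x) (\<beta> i x) vs - wedge (\<alpha> i x) (ext_d \<beta> i x) vs)"
    using homogeneous_wedge[OF homd(1) hom(2)[OF S(2)], of 4]
      homogeneous_wedge[OF hom(1)[OF S(2)] homd(2), of 4]
    by (simp add: homogeneous_def)
  note d\<alpha> = smooth_on_has_derivative[OF smooth_covector_fieldD(2)[OF \<alpha>] S(2)]
  note d\<beta> = smooth_on_has_derivative[OF smooth_covector_fieldD(2)[OF \<beta>] S(2)]
  have D: "frechet_derivative (\<lambda>y. (\<alpha> \<and>\<^sub>f \<beta>) i y [a, b, c]) (at x) =
    (\<lambda>v. \<alpha> i x [a] * frechet_derivative (\<lambda>y. \<beta> i y [b, c]) (at x) v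
        + frechet_derivative (\<lambda>y. \<alpha> i y [a]) (at x) v * \<beta> i x [b, c]
      - (\<alpha> i x [b] * frechet_derivative (\<lambda>y. \<beta> i y [a, c]) (at x) v
        + frechet_derivative (\<lambda>y. \<alpha> i y [b]) (at x) v * \<beta> i x [a, c])
      + (\<alpha> i x [c] * frechet_derivative (\<lambda>y. \<beta> i y [a, b]) (at x) v
        + frechet_derivative (\<lambda>y. \<alpha> i y [c]) (at x) v * \<beta> i x [a, b]))" for a b c
  proof -
    have eq: "frechet_derivative (\<lambda>y. (\<alpha> \<and>\<^sub>f \<beta>) i y [a, b, c]) (at x) = frechet_derivative
        (\<lambda>y. \<alpha> i y [a] * \<beta> i y [b, c] - \<alpha> i y [b] * \<beta> i y [a, c] + \<alpha> i y [c] * \<beta> i y [a, b]) (at x)"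
      by (rule frechet_derivative_cong_open[OF S]) (simp add: form_wedge_def wedge_1_2[OF hom])
    show ?thesis
      unfolding eq
      by (rule frechet_derivative_at[symmetric], intro has_derivative_add has_derivative_diff
          has_derivative_mult d\<alpha> d\<beta>)
  qed
  fix vs :: "'a list" assume "length vs = 4"
  then obtain a b c d where "vs = [a, b, c, d]" by (auto simp: length_4_conv)
  then show "ext_d (\<alpha> \<and>\<^sub>f \<beta>) i x vs = wedge (ext_d \<alpha> i x) (\<beta> i x) vs - wedge (\<alpha> i x) (ext_d \<beta> i x) vs"
    by (simp add: ext_d_4 D wedge_2_2[OF homd(1) hom(2)[OF S(2)]] wedge_1_3[OF hom(1)[OF S(2)] homd(2)]
        ext_d_2 ext_d_3 algebra_simps)
qed

text \<open>The twelve second derivatives cancel in six pairs by Schwarz's theorem.\<close>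

lemma ext_d_ext_d_2:
  assumes S: "open S" "x \<in> S" and \<alpha>: "smooth_covector_field 2 S (\<alpha> i)"
  shows "ext_d (ext_d \<alpha>) i x = (\<lambda>vs. 0)"
proof (rule homogeneous_eqI[of 4])
  note hom = smooth_covector_fieldD(1)[OF \<alpha>, THEN covector_homogeneous]
  have "homogeneous 3 (ext_d \<alpha> i y)" if "y \<in> S" for y
    using homogeneous_ext_d[OF S(1) that, of 2 \<alpha> i, OF hom] by (simp add: numeral_eq_Suc)
  from homogeneous_ext_d[OF S, of 3 "ext_d \<alpha>" i, OF this]
  show "homogeneous 4 (ext_d (ext_d \<alpha>) i x)" by (simp add: numeral_eq_Suc)
  have d\<alpha>: "((\<lambda>y. frechet_derivative (\<lambda>y. \<alpha> i y l) (at y) v) has_derivative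
      frechet_derivative (\<lambda>y. frechet_derivative (\<lambda>y. \<alpha> i y l) (at y) v) (at x)) (at x)" for l v
    by (rule smooth_on_has_derivative[OF smooth_on_frechet_derivative[OF
          smooth_covector_fieldD(2)[OF \<alpha>]] S(2)])
  have D: "frechet_derivative (\<lambda>y. ext_d \<alpha> i y [a, b, c]) (at x) = (\<lambda>v.
      frechet_derivative (\<lambda>y. frechet_derivative (\<lambda>y. \<alpha> i y [b, c]) (at y) a) (at x) v
    - frechet_derivative (\<lambda>y. frechet_derivative (\<lambda>y. \<alpha> i y [a, c]) (at y) b) (at x) v
    + frechet_derivative (\<lambda>y. frechet_derivative (\<lambda>y. \<alpha> i y [a, b]) (at y) c) (at x) v)" for a b c
    unfolding ext_d_3
    by (rule frechet_derivative_at[symmetric], intro has_derivative_add has_derivative_diff d\<alpha>)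
  fix vs :: "'a list" assume "length vs = 4"
  then obtain a b c d where "vs = [a, b, c, d]" by (auto simp: length_4_conv)
  moreover note sym = symmetric_second_derivative[OF S(1) smooth_covector_fieldD(2)[OF \<alpha>] S(2)]
  ultimately show "ext_d (ext_d \<alpha>) i x vs = 0"
    using sym[of "[c, d]" a b] sym[of "[b, d]" a c] sym[of "[b, c]" a d]
      sym[of "[a, d]" b c] sym[of "[a, c]" b d] sym[of "[a, b]" c d]
    by (simp add: ext_d_4 D)
qed (simp add: homogeneous_def)

lemma ext_d_scale:
  assumes "x \<in> S" "\<And>vs. smooth_on S (\<lambda>y. \<alpha> i y vs)"
  shows "ext_d (c *\<^sub>f \<alpha>) i x vs = c * ext_d \<alpha> i x vs"
proof -
  have "frechet_derivative (\<lambda>y. (c *\<^sub>f \<alpha>) i y l) (at x) v = c * frechet_derivative (\<lambda>y. \<alpha> i y l) (at x) v"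
    for l v
    using frechet_derivative_at[OF has_derivative_mult_right[OF
          smooth_on_has_derivative[OF assms(2,1)], of c l]]
    by (simp add: form_scale_def) metis
  then show ?thesis by (simp add: ext_d_def sum_distrib_left mult_ac)
qed

section \<open>Adapted coframes of an SU(2)-structure\<close>

text \<open>Half of the six shuffles of \<open>p \<and> q\<close>: those that give \<open>a\<close> to the first factor. If the six
  numbers that describe \<open>p\<close> on \<open>a, b, c, d\<close> are grouped into the vector \<open>(p(a,b), p(a,c), p(a,d))\<close> and
  the complementary vector \<open>(p(c,d), - p(b,d), p(b,c))\<close>, this is the scalar product of the first
  vector of \<open>p\<close> with the complementary vector of \<open>q\<close>; on the diagonal it is the Pfaffian.\<close>

definition half_wedge :: "('e list \<Rightarrow> real) \<Rightarrow> ('e list \<Rightarrow> real) \<Rightarrow> 'e \<Rightarrow> 'e \<Rightarrow> 'e \<Rightarrow> 'e \<Rightarrow> real" where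
  "half_wedge p q a b c d = p [a, b] * q [c, d] - p [a, c] * q [b, d] + p [a, d] * q [b, c]"

abbreviation pfaffian :: "('e list \<Rightarrow> real) \<Rightarrow> 'e \<Rightarrow> 'e \<Rightarrow> 'e \<Rightarrow> 'e \<Rightarrow> real" where
  "pfaffian p \<equiv> half_wedge p p"

text \<open>The determinant of the values on \<open>b, c, d\<close> of the contractions of \<open>p, q, r\<close> with \<open>a\<close>.\<close>

definition contraction_det ::
  "('e list \<Rightarrow> real) \<Rightarrow> ('e list \<Rightarrow> real) \<Rightarrow> ('e list \<Rightarrow> real) \<Rightarrow> 'e \<Rightarrow> 'e \<Rightarrow> 'e \<Rightarrow> 'e \<Rightarrow> real" where
  "contraction_det p q r a b c d =
     p [a, b] * (q [a, c] * r [a, d] - q [a, d] * r [a, c])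
   + p [a, c] * (q [a, d] * r [a, b] - q [a, b] * r [a, d])
   + p [a, d] * (q [a, b] * r [a, c] - q [a, c] * r [a, b])"

text \<open>A rational expression in \<open>p, q, r\<close> which, up to a scalar factor, is the 1-form dual to \<open>a\<close> (more
  precisely, to its component transversal to the kernel) in the metric that the triple determines.
  Its coefficients are those that make \<open>structure_equation\<close> true; the last summand is a multiple of the
  first element of the basis dual to \<open>a, b, c, d\<close>, written by Cramer's rule.\<close>

definition metric_dual ::
  "('e list \<Rightarrow> real) \<Rightarrow> ('e list \<Rightarrow> real) \<Rightarrow> ('e list \<Rightarrow> real) \<Rightarrow> 'e \<Rightarrow> 'e \<Rightarrow> 'e \<Rightarrow> 'e \<Rightarrow> 'e \<Rightarrow> real" where
  "metric_dual p q r a b c d u =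
     half_wedge r q a b c d * p [a, u] + half_wedge p r a b c d * q [a, u]
   + half_wedge q p a b c d * r [a, u]
   + contraction_det p q r a b c d * pfaffian p u b c d / pfaffian p a b c d"

lemma wedge_2_2_half:
  assumes "homogeneous 2 p" "homogeneous 2 q"
  shows "wedge p q [a, b, c, d] = half_wedge p q a b c d + half_wedge q p a b c d"
  by (simp add: wedge_2_2[OF assms] half_wedge_def)

lemma wedge_2_2_commute:
  assumes "homogeneous 2 p" "homogeneous 2 (q :: 'e list \<Rightarrow> real)"
  shows "wedge p q = wedge q p"
proof (rule homogeneous_eqI[of 4])
  show "homogeneous 4 (wedge p q)" by (rule homogeneous_wedge[OF assms]) simp
  show "homogeneous 4 (wedge q p)" by (rule homogeneous_wedge[OF assms(2,1)]) simp
  show "wedge p q vs = wedge q p vs" if "length vs = 4" for vs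
    using that by (auto simp: length_4_conv wedge_2_2_half assms)
qed

text \<open>The expansion of a vector of \<open>\<real>\<^sup>3\<close> in the basis dual to \<open>a, b, c\<close>.\<close>

lemma cramer_expansion:
  fixes a1 :: real
  assumes D: "D = a1 * (b2 * c3 - b3 * c2) + a2 * (b3 * c1 - b1 * c3) + a3 * (b1 * c2 - b2 * c1)"
  shows "D * x1 = (a1*x1 + a2*x2 + a3*x3) * (b2 * c3 - b3 * c2)
      + (b1*x1 + b2*x2 + b3*x3) * (c2 * a3 - c3 * a2) + (c1*x1 + c2*x2 + c3*x3) * (a2 * b3 - a3 * b2)"
    and "D * x2 = (a1*x1 + a2*x2 + a3*x3) * (b3 * c1 - b1 * c3)
      + (b1*x1 + b2*x2 + b3*x3) * (c3 * a1 - c1 * a3) + (c1*x1 + c2*x2 + c3*x3) * (a3 * b1 - a1 * b3)"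
    and "D * x3 = (a1*x1 + a2*x2 + a3*x3) * (b1 * c2 - b2 * c1)
      + (b1*x1 + b2*x2 + b3*x3) * (c1 * a2 - c2 * a1) + (c1*x1 + c2*x2 + c3*x3) * (a1 * b2 - a2 * b1)"
  unfolding D by algebra+

text \<open>Multiplicativity of the determinant for the matrix of scalar products of \<open>a, b, c\<close> with
  \<open>x, y, z\<close>.\<close>

lemma det_transpose_mult_3:
  fixes a1 :: real
  shows "(a1 * (b2 * c3 - b3 * c2) + a2 * (b3 * c1 - b1 * c3) + a3 * (b1 * c2 - b2 * c1))
    * (x1 * (y2 * z3 - y3 * z2) + x2 * (y3 * z1 - y1 * z3) + x3 * (y1 * z2 - y2 * z1))
    = (a1*x1 + a2*x2 + a3*x3) * ((b1*y1 + b2*y2 + b3*y3) * (c1*z1 + c2*z2 + c3*z3)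
          - (b1*z1 + b2*z2 + b3*z3) * (c1*y1 + c2*y2 + c3*y3))
    + (a1*y1 + a2*y2 + a3*y3) * ((b1*z1 + b2*z2 + b3*z3) * (c1*x1 + c2*x2 + c3*x3)
          - (b1*x1 + b2*x2 + b3*x3) * (c1*z1 + c2*z2 + c3*z3))
    + (a1*z1 + a2*z2 + a3*z3) * ((b1*x1 + b2*x2 + b3*x3) * (c1*y1 + c2*y2 + c3*y3)
          - (b1*y1 + b2*y2 + b3*y3) * (c1*x1 + c2*x2 + c3*x3))"
  by algebra

lemma six_vectors_dependent:
  fixes w1 w2 w3 w4 w5 w6 :: "'e::euclidean_space"
  assumes "DIM('e) = 5"
  obtains c1 c2 c3 c4 c5 c6 where "(c1, c2, c3, c4, c5, c6) \<noteq> (0, 0, 0, 0, 0, 0 :: real)"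
    "c1 *\<^sub>R w1 + c2 *\<^sub>R w2 + c3 *\<^sub>R w3 + c4 *\<^sub>R w4 + c5 *\<^sub>R w5 + c6 *\<^sub>R w6 = 0"
proof -
  define L :: "real \<times> real \<times> real \<times> real \<times> real \<times> real \<Rightarrow> 'e" where
    "L = (\<lambda>(c1, c2, c3, c4, c5, c6).
      c1 *\<^sub>R w1 + c2 *\<^sub>R w2 + c3 *\<^sub>R w3 + c4 *\<^sub>R w4 + c5 *\<^sub>R w5 + c6 *\<^sub>R w6)"
  have lin: "linear L"
    by (rule linearI) (auto simp: L_def algebra_simps)
  have "\<not> inj L"
  proof
    assume "inj L"
    then have "dim (L ` UNIV) = DIM(real \<times> real \<times> real \<times> real \<times> real \<times> real)"
      using dim_image_eq[OF lin, of UNIV] by simp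
    then show False using dim_subset_UNIV[of "range L"] assms by simp
  qed
  then obtain z where "z \<noteq> 0" "L z = 0"
    using linear_injective_0[OF lin] by blast
  moreover obtain c1 c2 c3 c4 c5 c6 where "z = (c1, c2, c3, c4, c5, c6)"
    by (metis prod_cases6)
  ultimately show thesis using that[of c1 c2 c3 c4 c5 c6] by (simp add: L_def zero_prod_def)
qed

text \<open>The algebra of the three 2-forms at one point. By nondegeneracy \<open>b1, \<dots>, b4\<close> span a complement
  of the kernel of \<open>p\<close>. The scalar products of the vectors of \<open>p, q, r\<close> on these
  four arguments with the complementary vectors (see \<open>half_wedge\<close>) form a 3 by 3 matrix; the wedge relations
  say that it is \<open>lam\<close> times the identity plus a skew matrix.\<close>

locale definite_triple =
  fixes p q r :: "'e::euclidean_space list \<Rightarrow> real" and b1 b2 b3 b4 :: 'e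
  assumes dim: "DIM('e) = 5"
    and cov: "covector 2 p" "covector 2 q" "covector 2 r"
    and squares: "wedge q q = wedge p p" "wedge r r = wedge p p"
    and orth: "wedge p q = (\<lambda>vs. 0)" "wedge p r = (\<lambda>vs. 0)" "wedge q r = (\<lambda>vs. 0)"
    and nondeg: "pfaffian p b1 b2 b3 b4 \<noteq> 0"
begin

abbreviation "lam \<equiv> pfaffian p b1 b2 b3 b4"
abbreviation "\<Delta> \<equiv> contraction_det p q r b1 b2 b3 b4"
abbreviation "\<sigma> \<equiv> metric_dual p q r b1 b2 b3 b4"
abbreviation "\<kappa> f g \<equiv> half_wedge f g b1 b2 b3 b4"

lemma hom: "homogeneous 2 p" "homogeneous 2 q" "homogeneous 2 r"
  using cov covector_homogeneous by auto

lemma pfaffian_eq: "pfaffian q a b c d = pfaffian p a b c d" "pfaffian r a b c d = pfaffian p a b c d"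
  using fun_cong[OF squares(1), of "[a, b, c, d]"] fun_cong[OF squares(2), of "[a, b, c, d]"]
  by (simp_all add: wedge_2_2_half hom)

lemma half_wedge_antisym:
  "half_wedge q p a b c d = - half_wedge p q a b c d"
  "half_wedge r p a b c d = - half_wedge p r a b c d"
  "half_wedge r q a b c d = - half_wedge q r a b c d"
  using fun_cong[OF orth(1), of "[a, b, c, d]"] fun_cong[OF orth(2), of "[a, b, c, d]"]
    fun_cong[OF orth(3), of "[a, b, c, d]"]
  by (simp_all add: wedge_2_2_half hom)

text \<open>The hypotheses are invariant under the cyclic rotation of \<open>p, q, r\<close>, and so are \<open>lam\<close>,
  \<open>\<Delta>\<close> and \<open>\<sigma>\<close>. Statements about \<open>p\<close> therefore carry over to \<open>q\<close> and \<open>r\<close>.\<close>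

lemma rotate: "definite_triple q r p b1 b2 b3 b4"
  using dim cov squares orth nondeg wedge_2_2_commute[OF hom(2,1)] wedge_2_2_commute[OF hom(3,1)]
  by unfold_locales (auto simp: pfaffian_eq)

lemma metric_dual_rotate: "metric_dual q r p b1 b2 b3 b4 = \<sigma>"
  by (auto simp: fun_eq_iff metric_dual_def pfaffian_eq contraction_det_def algebra_simps)

lemma contraction_det_rotate: "contraction_det q r p b1 b2 b3 b4 = \<Delta>"
  by (simp add: contraction_det_def algebra_simps)

text \<open>The three contractions with \<open>b1\<close> are independent on \<open>b2, b3, b4\<close>: the Gram matrix of their
  values there with the remaining components of \<open>p, q, r\<close> is a nonzero multiple of the identity
  plus a skew matrix, hence has nonzero determinant.\<close>

lemma Delta_nonzero: "\<Delta> \<noteq> 0"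
proof -
  have prod: "\<Delta> * (p [b3, b4] * (- q [b2, b4] * r [b2, b3] - q [b2, b3] * - r [b2, b4])
      + - p [b2, b4] * (q [b2, b3] * r [b3, b4] - q [b3, b4] * r [b2, b3])
      + p [b2, b3] * (q [b3, b4] * - r [b2, b4] - - q [b2, b4] * r [b3, b4]))
    = \<kappa> p p * (\<kappa> q q * \<kappa> r r - \<kappa> q r * \<kappa> r q) + \<kappa> p q * (\<kappa> q r * \<kappa> r p - \<kappa> q p * \<kappa> r r)
      + \<kappa> p r * (\<kappa> q p * \<kappa> r q - \<kappa> q q * \<kappa> r p)"
    using det_transpose_mult_3[where ?a1.0 = "p [b1, b2]" and ?a2.0 = "p [b1, b3]" and ?a3.0 = "p [b1, b4]"
        and ?b1.0 = "q [b1, b2]" and ?b2.0 = "q [b1, b3]" and ?b3.0 = "q [b1, b4]"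
        and ?c1.0 = "r [b1, b2]" and ?c2.0 = "r [b1, b3]" and ?c3.0 = "r [b1, b4]"
        and ?x1.0 = "p [b3, b4]" and ?x2.0 = "- p [b2, b4]" and ?x3.0 = "p [b2, b3]"
        and ?y1.0 = "q [b3, b4]" and ?y2.0 = "- q [b2, b4]" and ?y3.0 = "q [b2, b3]"
        and ?z1.0 = "r [b3, b4]" and ?z2.0 = "- r [b2, b4]" and ?z3.0 = "r [b2, b3]"]
    by (simp add: contraction_det_def half_wedge_def)
  have gram: "\<kappa> p p * (\<kappa> q q * \<kappa> r r - \<kappa> q r * \<kappa> r q) + \<kappa> p q * (\<kappa> q r * \<kappa> r p - \<kappa> q p * \<kappa> r r)
      + \<kappa> p r * (\<kappa> q p * \<kappa> r q - \<kappa> q q * \<kappa> r p) = lam * (lam\<^sup>2 + (\<kappa> q r)\<^sup>2 + (\<kappa> p q)\<^sup>2 + (\<kappa> p r)\<^sup>2)"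
    by (simp add: half_wedge_antisym[of b1 b2 b3 b4] pfaffian_eq[of b1 b2 b3 b4] algebra_simps
        power2_eq_square)
  have "lam\<^sup>2 > 0" using nondeg by simp
  then have "lam\<^sup>2 + (\<kappa> q r)\<^sup>2 + (\<kappa> p q)\<^sup>2 + (\<kappa> p r)\<^sup>2 > 0"
    by (intro add_pos_nonneg) auto
  then have "lam * (lam\<^sup>2 + (\<kappa> q r)\<^sup>2 + (\<kappa> p q)\<^sup>2 + (\<kappa> p r)\<^sup>2) \<noteq> 0"
    using nondeg by simp
  then show ?thesis using prod unfolding gram by (metis mult_zero_left)
qed

lemma lin: "linear (\<lambda>u. p [u, w])" "linear (\<lambda>u. p [w, u])" "linear (\<lambda>u. q [u, w])"
  "linear (\<lambda>u. q [w, u])" "linear (\<lambda>u. r [u, w])" "linear (\<lambda>u. r [w, u])"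
  using cov covector_2_linear by blast+

lemmas lin_simps = lin[THEN linear_add] lin[THEN linear_diff] lin[THEN linear_cmul]
  lin[THEN linear_0] lin[THEN linear_neg]

lemma swap: "p [b, a] = - p [a, b]" "q [b, a] = - q [a, b]" "r [b, a] = - r [a, b]"
  using cov covector_2_swap by blast+

lemma diag: "p [a, a] = 0" "q [a, a] = 0" "r [a, a] = 0"
  using cov covector_2_diag by blast+

text \<open>\<open>lam\<close> times the component of \<open>u\<close> along the common kernel of \<open>p, q, r\<close>, in the splitting of the tangent space
  into this kernel and the span of \<open>b1, \<dots>, b4\<close>; the coefficients are those of Cramer's rule, with
  Pfaffians in place of determinants.\<close>

definition reeb_part :: "'e \<Rightarrow> 'e" where
  "reeb_part u = lam *\<^sub>R u - pfaffian p u b2 b3 b4 *\<^sub>R b1 - pfaffian p b1 u b3 b4 *\<^sub>R b2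
    - pfaffian p b1 b2 u b4 *\<^sub>R b3 - pfaffian p b1 b2 b3 u *\<^sub>R b4"

lemma lam_expand: "lam *\<^sub>R u = pfaffian p u b2 b3 b4 *\<^sub>R b1 + pfaffian p b1 u b3 b4 *\<^sub>R b2
    + pfaffian p b1 b2 u b4 *\<^sub>R b3 + pfaffian p b1 b2 b3 u *\<^sub>R b4 + reeb_part u"
  by (simp add: reeb_part_def)

lemma reeb_part_basis:
  "p [reeb_part u, b1] = 0" "p [reeb_part u, b2] = 0" "p [reeb_part u, b3] = 0" "p [reeb_part u, b4] = 0"
  using swap(1)[of b1 b2] swap(1)[of b1 b3] swap(1)[of b1 b4] swap(1)[of b2 b3] swap(1)[of b2 b4]
    swap(1)[of b3 b4] swap(1)[of u b1] swap(1)[of u b2] swap(1)[of u b3] swap(1)[of u b4]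
  by (simp_all add: reeb_part_def lin_simps diag half_wedge_def algebra_simps)

text \<open>Here the dimension enters: two vectors annihilated by the contractions with \<open>b1, \<dots>, b4\<close> are
  proportional, because together with \<open>b1, \<dots>, b4\<close> they are six vectors in dimension five.\<close>

lemma reeb_part_kernel: "p [reeb_part u, w] = 0"
proof -
  let ?y = "reeb_part u" and ?z = "reeb_part w"
  have pyz: "p [?y, ?z] = 0"
  proof -
    obtain c1 c2 c3 c4 c5 c6 where c: "(c1, c2, c3, c4, c5, c6) \<noteq> (0, 0, 0, 0, 0, 0 :: real)"
      and dep: "c1 *\<^sub>R b1 + c2 *\<^sub>R b2 + c3 *\<^sub>R b3 + c4 *\<^sub>R b4 + c5 *\<^sub>R ?y + c6 *\<^sub>R ?z = 0"
      using six_vectors_dependent[OF dim] by metis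
    have *: "c1 * p [b1, v] + c2 * p [b2, v] + c3 * p [b3, v] + c4 * p [b4, v]
        + c5 * p [?y, v] + c6 * p [?z, v] = 0" for v
      using arg_cong[OF dep, of "\<lambda>x. p [x, v]"] by (simp add: lin_simps)
    note eqs = *[of b1] *[of b2] *[of b3] *[of b4]
    have "lam * c1 = 0 \<and> lam * c2 = 0 \<and> lam * c3 = 0 \<and> lam * c4 = 0"
      \<comment> \<open>the skew 4 by 4 matrix of \<open>p\<close> on the basis is inverted by its Pfaffian adjugate\<close>
      using eqs swap(1)[of b1 b2] swap(1)[of b1 b3] swap(1)[of b1 b4] swap(1)[of b2 b3] swap(1)[of b2 b4]
        swap(1)[of b3 b4]
      by (simp add: reeb_part_basis diag half_wedge_def) algebra
    then have 0: "c1 = 0" "c2 = 0" "c3 = 0" "c4 = 0" using nondeg by auto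
    have "c6 * p [?z, ?y] = 0" "c5 * p [?y, ?z] = 0"
      using *[of ?y] *[of ?z] by (simp_all add: 0 diag)
    then show ?thesis using c swap(1)[of ?y ?z] by (auto simp: 0)
  qed
  have "lam * p [?y, w] = p [?y, lam *\<^sub>R w]" by (simp add: lin_simps)
  also have "\<dots> = 0" by (subst lam_expand) (simp add: lin_simps reeb_part_basis pyz)
  finally show ?thesis using nondeg by simp
qed

end

context definite_triple
begin

interpretation rot: definite_triple q r p b1 b2 b3 b4 by (rule rotate)
interpretation rot2: definite_triple r p q b1 b2 b3 b4 by (rule rot.rotate)

lemma reeb_part_rotate: "rot.reeb_part = reeb_part" "rot2.reeb_part = reeb_part"
  by (simp_all add: fun_eq_iff rot.reeb_part_def rot2.reeb_part_def reeb_part_def pfaffian_eq)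

lemma reeb_part_kernels:
  "p [reeb_part u, w] = 0" "q [reeb_part u, w] = 0" "r [reeb_part u, w] = 0"
  "p [w, reeb_part u] = 0" "q [w, reeb_part u] = 0" "r [w, reeb_part u] = 0"
  using reeb_part_kernel[of u w] rot.reeb_part_kernel[of u w] rot2.reeb_part_kernel[of u w]
    swap[of w "reeb_part u"] by (simp_all add: reeb_part_rotate)

lemma contraction_expand:
  "lam * p [b1, u] = pfaffian p b1 u b3 b4 * p [b1, b2] + pfaffian p b1 b2 u b4 * p [b1, b3]
     + pfaffian p b1 b2 b3 u * p [b1, b4]"
  "lam * q [b1, u] = pfaffian p b1 u b3 b4 * q [b1, b2] + pfaffian p b1 b2 u b4 * q [b1, b3]
     + pfaffian p b1 b2 b3 u * q [b1, b4]"
  "lam * r [b1, u] = pfaffian p b1 u b3 b4 * r [b1, b2] + pfaffian p b1 b2 u b4 * r [b1, b3]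
     + pfaffian p b1 b2 b3 u * r [b1, b4]"
  using arg_cong[OF lam_expand[of u], of "\<lambda>x. p [b1, x]"]
    arg_cong[OF lam_expand[of u], of "\<lambda>x. q [b1, x]"]
    arg_cong[OF lam_expand[of u], of "\<lambda>x. r [b1, x]"]
  by (simp_all add: lin_simps diag reeb_part_kernels)


text \<open>The complementary vector of \<open>p\<close> is determined by the contractions with \<open>b1\<close>: it is expanded in
  the basis dual to them, and its scalar products with them are known up to the skew part. These
  are the components on \<open>b2, b3, b4\<close> of the structure equation for \<open>p\<close>.\<close>

lemma complementary_components:
  "\<Delta> * p [b3, b4] = lam * (q [b1, b3] * r [b1, b4] - q [b1, b4] * r [b1, b3])
     + (\<kappa> p r * q [b1, b3] + \<kappa> q p * r [b1, b3]) * p [b1, b4]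
     - (\<kappa> p r * q [b1, b4] + \<kappa> q p * r [b1, b4]) * p [b1, b3]"
  "\<Delta> * p [b2, b4] = lam * (q [b1, b2] * r [b1, b4] - q [b1, b4] * r [b1, b2])
     + (\<kappa> p r * q [b1, b2] + \<kappa> q p * r [b1, b2]) * p [b1, b4]
     - (\<kappa> p r * q [b1, b4] + \<kappa> q p * r [b1, b4]) * p [b1, b2]"
  "\<Delta> * p [b2, b3] = lam * (q [b1, b2] * r [b1, b3] - q [b1, b3] * r [b1, b2])
     + (\<kappa> p r * q [b1, b2] + \<kappa> q p * r [b1, b2]) * p [b1, b3]
     - (\<kappa> p r * q [b1, b3] + \<kappa> q p * r [b1, b3]) * p [b1, b2]"
proof -
  have k: "p [b1, b2] * p [b3, b4] - p [b1, b3] * p [b2, b4] + p [b1, b4] * p [b2, b3] = lam"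
    "q [b1, b2] * p [b3, b4] - q [b1, b3] * p [b2, b4] + q [b1, b4] * p [b2, b3] = \<kappa> q p"
    "r [b1, b2] * p [b3, b4] - r [b1, b3] * p [b2, b4] + r [b1, b4] * p [b2, b3] = - \<kappa> p r"
    using half_wedge_antisym(2)[of b1 b2 b3 b4] by (simp_all add: half_wedge_def)
  note c = cramer_expansion[where D = \<Delta> and ?a1.0 = "p [b1, b2]" and ?a2.0 = "p [b1, b3]"
      and ?a3.0 = "p [b1, b4]" and ?b1.0 = "q [b1, b2]" and ?b2.0 = "q [b1, b3]"
      and ?b3.0 = "q [b1, b4]" and ?c1.0 = "r [b1, b2]" and ?c2.0 = "r [b1, b3]"
      and ?c3.0 = "r [b1, b4]" and ?x1.0 = "p [b3, b4]" and ?x2.0 = "- p [b2, b4]"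
      and ?x3.0 = "p [b2, b3]", OF contraction_det_def, unfolded mult_minus_right add_uminus_conv_diff k]
  show "\<Delta> * p [b3, b4] = lam * (q [b1, b3] * r [b1, b4] - q [b1, b4] * r [b1, b3])
     + (\<kappa> p r * q [b1, b3] + \<kappa> q p * r [b1, b3]) * p [b1, b4]
     - (\<kappa> p r * q [b1, b4] + \<kappa> q p * r [b1, b4]) * p [b1, b3]"
    unfolding c(1) by algebra
  show "\<Delta> * p [b2, b4] = lam * (q [b1, b2] * r [b1, b4] - q [b1, b4] * r [b1, b2])
     + (\<kappa> p r * q [b1, b2] + \<kappa> q p * r [b1, b2]) * p [b1, b4]
     - (\<kappa> p r * q [b1, b4] + \<kappa> q p * r [b1, b4]) * p [b1, b2]"
    using c(2) by algebra
  show "\<Delta> * p [b2, b3] = lam * (q [b1, b2] * r [b1, b3] - q [b1, b3] * r [b1, b2])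
     + (\<kappa> p r * q [b1, b2] + \<kappa> q p * r [b1, b2]) * p [b1, b3]
     - (\<kappa> p r * q [b1, b3] + \<kappa> q p * r [b1, b3]) * p [b1, b2]"
    unfolding c(3) by algebra
qed

text \<open>Up to normalization this is \<open>p = e\<^sup>1 \<and> e\<^sup>2 + e\<^sup>3 \<and> e\<^sup>4\<close>, with \<open>e\<^sup>1\<close> proportional to \<open>\<sigma>\<close> and
  \<open>e\<^sup>2, e\<^sup>3, e\<^sup>4\<close> proportional to the contractions of \<open>p, q, r\<close> with \<open>b1\<close>. Since both sides vanish on
  the common kernel, it suffices to compare the components on \<open>b1, \<dots>, b4\<close>; those that involve \<open>b1\<close>
  agree trivially.\<close>

lemma structure_equation:
  "\<Delta> * p [u, w] = \<sigma> u * p [b1, w] - \<sigma> w * p [b1, u]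
     + lam * (q [b1, u] * r [b1, w] - q [b1, w] * r [b1, u])"
proof -
  define U1 U2 U3 U4 where U: "U1 = pfaffian p u b2 b3 b4" "U2 = pfaffian p b1 u b3 b4"
    "U3 = pfaffian p b1 b2 u b4" "U4 = pfaffian p b1 b2 b3 u"
  define W1 W2 W3 W4 where W: "W1 = pfaffian p w b2 b3 b4" "W2 = pfaffian p b1 w b3 b4"
    "W3 = pfaffian p b1 b2 w b4" "W4 = pfaffian p b1 b2 b3 w"
  define k1 k2 k3 where k: "k1 = \<kappa> r q" "k2 = \<kappa> p r" "k3 = \<kappa> q p"
  note cu = contraction_expand[of u, folded U] and cw = contraction_expand[of w, folded W]
  have su: "lam * \<sigma> u = \<Delta> * U1 + (k1 * (lam * p [b1, u]) + k2 * (lam * q [b1, u]) + k3 * (lam * r [b1, u]))"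
    using nondeg by (simp add: metric_dual_def U k field_simps)
  have sw: "lam * \<sigma> w = \<Delta> * W1 + (k1 * (lam * p [b1, w]) + k2 * (lam * q [b1, w]) + k3 * (lam * r [b1, w]))"
    using nondeg by (simp add: metric_dual_def W k field_simps)
  have bw: "lam * p [b, w] = W1 * p [b, b1] + W2 * p [b, b2] + W3 * p [b, b3] + W4 * p [b, b4]" for b
    using arg_cong[OF lam_expand[of w], of "\<lambda>x. p [b, x]"] by (simp add: lin_simps reeb_part_kernels W)
  have "lam * p [u, w] = U1 * p [b1, w] + U2 * p [b2, w] + U3 * p [b3, w] + U4 * p [b4, w]"
    using arg_cong[OF lam_expand[of u], of "\<lambda>x. p [x, w]"] by (simp add: lin_simps reeb_part_kernels U)
  then have "lam * (lam * p [u, w]) = U1 * (lam * p [b1, w]) + U2 * (lam * p [b2, w])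
      + U3 * (lam * p [b3, w]) + U4 * (lam * p [b4, w])" by algebra
  also have "\<dots> = (U1 * W2 - U2 * W1) * p [b1, b2] + (U1 * W3 - U3 * W1) * p [b1, b3]
      + (U1 * W4 - U4 * W1) * p [b1, b4] + (U2 * W3 - U3 * W2) * p [b2, b3]
      + (U2 * W4 - U4 * W2) * p [b2, b4] + (U3 * W4 - U4 * W3) * p [b3, b4]"
    unfolding bw swap(1)[of b2 b1] swap(1)[of b3 b1] swap(1)[of b4 b1] swap(1)[of b3 b2]
      swap(1)[of b4 b2] swap(1)[of b4 b3] diag by algebra
  finally have puw: "lam * (lam * p [u, w]) = \<dots>" .
  have "lam * (lam * (\<Delta> * p [u, w])) = \<Delta> * (lam * (lam * p [u, w]))" by simp
  also have "\<dots> = (U1 * W2 - U2 * W1) * (\<Delta> * p [b1, b2]) + (U1 * W3 - U3 * W1) * (\<Delta> * p [b1, b3])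
      + (U1 * W4 - U4 * W1) * (\<Delta> * p [b1, b4]) + (U2 * W3 - U3 * W2) * (\<Delta> * p [b2, b3])
      + (U2 * W4 - U4 * W2) * (\<Delta> * p [b2, b4]) + (U3 * W4 - U4 * W3) * (\<Delta> * p [b3, b4])"
    unfolding puw by (simp add: algebra_simps)
  also have "\<dots> = (lam * \<sigma> u) * (lam * p [b1, w]) - (lam * \<sigma> w) * (lam * p [b1, u])
     + lam * ((lam * q [b1, u]) * (lam * r [b1, w]) - (lam * q [b1, w]) * (lam * r [b1, u]))"
    unfolding su sw cu cw complementary_components k[symmetric]
    by (simp add: algebra_simps)
  also have "\<dots> = lam * (lam * (\<sigma> u * p [b1, w] - \<sigma> w * p [b1, u]
     + lam * (q [b1, u] * r [b1, w] - q [b1, w] * r [b1, u])))" by (simp add: algebra_simps)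
  finally show ?thesis using nondeg by simp
qed

lemma metric_dual_linear: "linear \<sigma>"
proof -
  have pf: "linear (\<lambda>u. pfaffian p u b2 b3 b4)"
    by (rule linearI) (simp_all add: half_wedge_def lin_simps algebra_simps)
  show ?thesis
    by (rule linearI) (simp_all add: metric_dual_def lin_simps pf[THEN linear_add] pf[THEN linear_cmul]
        distrib_left add_divide_distrib)
qed

lemma metric_dual_b1: "\<sigma> b1 = \<Delta>"
  using nondeg by (simp add: metric_dual_def diag)

end

context definite_triple
begin

interpretation rot: definite_triple q r p b1 b2 b3 b4 by (rule rotate)
interpretation rot2: definite_triple r p q b1 b2 b3 b4 by (rule rot.rotate)

lemma structure_equations:
  "\<Delta> * p [u, w] = \<sigma> u * p [b1, w] - \<sigma> w * p [b1, u]
     + lam * (q [b1, u] * r [b1, w] - q [b1, w] * r [b1, u])"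
  "\<Delta> * q [u, w] = \<sigma> u * q [b1, w] - \<sigma> w * q [b1, u]
     + lam * (r [b1, u] * p [b1, w] - r [b1, w] * p [b1, u])"
  "\<Delta> * r [u, w] = \<sigma> u * r [b1, w] - \<sigma> w * r [b1, u]
     + lam * (p [b1, u] * q [b1, w] - p [b1, w] * q [b1, u])"
  using structure_equation[of u w] rot.structure_equation[of u w] rot2.structure_equation[of u w]
  by (simp_all add: metric_dual_rotate contraction_det_rotate pfaffian_eq
      rot.metric_dual_rotate rot.contraction_det_rotate)

text \<open>The compatibility condition on \<open>r\<close> is tested on \<open>X = b1\<close> and the vector \<open>Y\<close> on which \<open>\<sigma>\<close>
  and the contractions of \<open>p, q\<close> with \<open>b1\<close> vanish.\<close>

lemma normalization_pos:
  assumes orient: "\<And>X Y. interior_product X p = interior_product Y q \<Longrightarrow> r [X, Y] \<ge> 0"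
  shows "lam / \<Delta> > 0"
proof -
  define z where "z = ((p [b1, b3] * q [b1, b4] - p [b1, b4] * q [b1, b3]) / lam) *\<^sub>R b2
    + ((p [b1, b4] * q [b1, b2] - p [b1, b2] * q [b1, b4]) / lam) *\<^sub>R b3
    + ((p [b1, b2] * q [b1, b3] - p [b1, b3] * q [b1, b2]) / lam) *\<^sub>R b4"
  \<comment> \<open>\<open>z\<close> is a multiple of the cross product of the contractions of \<open>p\<close> and \<open>q\<close>; adding a multiple
    of \<open>b1\<close> makes \<open>\<sigma>\<close> vanish and does not change the contractions with \<open>b1\<close>\<close>
  define Y where "Y = z - (\<sigma> z / \<Delta>) *\<^sub>R b1"
  have pz: "p [b1, z] = 0" "q [b1, z] = 0"
    using nondeg unfolding z_def by (simp_all add: lin_simps add_divide_distrib[symmetric] algebra_simps)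
  have rz: "lam * r [b1, z] = \<Delta>"
    using nondeg unfolding z_def
    by (simp add: lin_simps contraction_det_def distrib_left) (simp add: algebra_simps)
  have Y: "\<sigma> Y = 0" "p [b1, Y] = 0" "q [b1, Y] = 0" "lam * r [b1, Y] = \<Delta>"
    using pz rz Delta_nonzero
    by (simp_all add: Y_def linear_diff[OF metric_dual_linear] linear_cmul[OF metric_dual_linear]
        metric_dual_b1 lin_simps diag)
  have "q [Y, w] = p [b1, w]" for w
  proof -
    have "\<Delta> * q [Y, w] = (lam * r [b1, Y]) * p [b1, w]"
      using structure_equations(2)[of Y w] by (simp add: Y)
    then show ?thesis using Delta_nonzero by (simp add: Y)
  qed
  then have "interior_product b1 p [w] = interior_product Y q [w]" for w
    by (simp add: interior_product_def)
  moreover have "homogeneous 1 (interior_product b1 p)" "homogeneous 1 (interior_product Y q)"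
    using hom by (auto simp: homogeneous_def interior_product_def)
  ultimately have "interior_product b1 p = interior_product Y q"
    by (intro homogeneous_eqI[of 1]) (auto simp: length_Suc_0_conv)
  then have "r [b1, Y] \<ge> 0" by (rule orient)
  moreover have "r [b1, Y] = \<Delta> / lam" using Y(4) nondeg by (simp add: field_simps)
  ultimately have "\<Delta> / lam > 0" using Delta_nonzero nondeg by (simp add: less_le)
  then show ?thesis by (auto simp: zero_less_divide_iff)
qed

lemma reeb_part_annihilates: "\<sigma> (reeb_part u) = 0"
  by (simp add: metric_dual_def half_wedge_def reeb_part_kernels)

text \<open>The vanishing combination is evaluated on a vector of the common kernel, on which only \<open>h\<close>
  is nonzero, then on \<open>b1\<close>, where all contractions vanish, and finally on \<open>b2, b3, b4\<close>, where \<open>\<Delta> \<noteq> 0\<close>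
  settles the contractions.\<close>

lemma coframe_independent:
  assumes h: "h (reeb_part v) \<noteq> 0"
    and eq: "\<And>u. c1 * \<sigma> u + c2 * p [b1, u] + c3 * q [b1, u] + c4 * r [b1, u] + c5 * h u = 0"
  shows "c1 = 0 \<and> c2 = 0 \<and> c3 = 0 \<and> c4 = 0 \<and> c5 = (0::real)"
proof -
  have c5: "c5 = 0" using eq[of "reeb_part v"] h by (simp add: reeb_part_annihilates reeb_part_kernels)
  have c1: "c1 = 0" using eq[of b1] Delta_nonzero by (simp add: metric_dual_b1 diag c5)
  have "\<Delta> * c2 = 0 \<and> \<Delta> * c3 = 0 \<and> \<Delta> * c4 = 0"
    using eq[of b2] eq[of b3] eq[of b4] unfolding contraction_det_def c1 c5 by simp algebra
  then show ?thesis using c1 c5 Delta_nonzero by simp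
qed

end


text \<open>The normal form of an SU(2)-structure in one cotangent space, with \<open>h\<close> in the role of \<open>\<eta>\<close> and as
  fifth element of the coframe.\<close>

definition adapted_coframe ::
  "('e::real_vector list \<Rightarrow> real) \<Rightarrow> ('e list \<Rightarrow> real) \<Rightarrow> ('e list \<Rightarrow> real) \<Rightarrow> ('e list \<Rightarrow> real) \<Rightarrow>
   (nat \<Rightarrow> 'e list \<Rightarrow> real) \<Rightarrow> bool" where
  "adapted_coframe h p q r e \<longleftrightarrow>
     (\<forall>j\<in>{1, 2, 3, 4}. covector 1 (e j)) \<and>
     p = (\<lambda>vs. wedge (e 1) (e 2) vs + wedge (e 3) (e 4) vs) \<and>
     q = (\<lambda>vs. wedge (e 1) (e 3) vs - wedge (e 2) (e 4) vs) \<and>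
     r = (\<lambda>vs. wedge (e 1) (e 4) vs + wedge (e 2) (e 3) vs) \<and>
     (\<forall>c1 c2 c3 c4 c5. (\<forall>u. c1 * e 1 [u] + c2 * e 2 [u] + c3 * e 3 [u] + c4 * e 4 [u] + c5 * h [u] = 0)
        \<longrightarrow> c1 = 0 \<and> c2 = 0 \<and> c3 = 0 \<and> c4 = 0 \<and> c5 = 0)"

text \<open>The structure equation leaves only the scaling free: with \<open>m\<^sup>2 = lam / D\<close>, the forms
  \<open>e\<^sup>1 = \<sigma> / (D m)\<close> and \<open>e\<^sup>2, e\<^sup>3, e\<^sup>4 = m\<close> times the contractions turn its coefficients into ones.\<close>

definition contraction_coframe ::
  "('e list \<Rightarrow> real) \<Rightarrow> ('e list \<Rightarrow> real) \<Rightarrow> ('e list \<Rightarrow> real) \<Rightarrow> 'e \<Rightarrow> 'e \<Rightarrow> 'e \<Rightarrow> 'e \<Rightarrow>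
   nat \<Rightarrow> 'e list \<Rightarrow> real" where
  "contraction_coframe p q r a b c d j vs =
     (let D = contraction_det p q r a b c d; m = sqrt (pfaffian p a b c d / D) in
      if length vs \<noteq> 1 then 0
      else if j = 1 then metric_dual p q r a b c d (hd vs) / (D * m)
      else m * (if j = 2 then p else if j = 3 then q else r) [a, hd vs])"

context definite_triple
begin

lemma adapted_contraction_coframe:
  assumes orient: "\<And>X Y. interior_product X p = interior_product Y q \<Longrightarrow> r [X, Y] \<ge> 0"
    and h: "h [reeb_part v] \<noteq> 0"
  shows "adapted_coframe h p q r (contraction_coframe p q r b1 b2 b3 b4)"
proof -
  define m where "m = sqrt (lam / \<Delta>)"
  define e where "e = contraction_coframe p q r b1 b2 b3 b4"
  note pos = normalization_pos[OF orient]
  have m: "m > 0" "m * m = lam / \<Delta>"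
    using pos unfolding m_def real_sqrt_mult_self by (simp_all only: real_sqrt_gt_0_iff abs_of_pos)
  have e: "e 1 [u] = \<sigma> u / (\<Delta> * m)" "e 2 [u] = m * p [b1, u]" "e 3 [u] = m * q [b1, u]"
    "e 4 [u] = m * r [b1, u]" for u
    by (simp_all add: e_def contraction_coframe_def m_def Let_def)
  have home: "homogeneous 1 (e j)" for j
    by (simp add: e_def contraction_coframe_def homogeneous_def Let_def)
  have cove: "covector 1 (e j)" if "j \<in> {1, 2, 3, 4}" for j
  proof (rule covector_1I[OF home])
    have "linear (\<lambda>u. e 1 [u])" "linear (\<lambda>u. e 2 [u])" "linear (\<lambda>u. e 3 [u])" "linear (\<lambda>u. e 4 [u])"
      unfolding e by (rule linearI; simp add: lin_simps metric_dual_linear[THEN linear_add]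
          metric_dual_linear[THEN linear_cmul] add_divide_distrib distrib_left)+
    then show "linear (\<lambda>u. e j [u])" using that by auto
  qed
  have dual: "wedge (e 1) (e j) [u, w] = (\<sigma> u * f w - \<sigma> w * f u) / \<Delta>"
    if "\<And>u. e j [u] = m * f u" for j f u w
    unfolding wedge_1_1[OF home home] e(1) that using m(1) Delta_nonzero by (simp add: field_simps)
  have transverse: "wedge (e j) (e k) [u, w] = lam * (f u * g w - f w * g u) / \<Delta>"
    if "\<And>u. e j [u] = m * f u" "\<And>u. e k [u] = m * g u" for j k f g u w
  proof -
    have "wedge (e j) (e k) [u, w] = (m * m) * (f u * g w - f w * g u)"
      unfolding wedge_1_1[OF home home] that by (simp add: algebra_simps)
    then show ?thesis by (simp add: m(2))
  qed
  have w2: "homogeneous 2 (wedge (e i) (e j))" for i j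
    by (rule homogeneous_wedge[OF home home]) simp
  have div: "x = A / \<Delta> + B / \<Delta>" if "\<Delta> * x = A + B" for x A B
    using that Delta_nonzero by (simp add: field_simps)
  have "p = (\<lambda>vs. wedge (e 1) (e 2) vs + wedge (e 3) (e 4) vs)"
  proof (rule homogeneous_eqI[OF hom(1)])
    show "homogeneous 2 (\<lambda>vs. wedge (e 1) (e 2) vs + wedge (e 3) (e 4) vs)"
      using w2 by (simp add: homogeneous_def)
    show "p vs = wedge (e 1) (e 2) vs + wedge (e 3) (e 4) vs" if "length vs = 2" for vs
    proof -
      have "p [a, b] = wedge (e 1) (e 2) [a, b] + wedge (e 3) (e 4) [a, b]" for a b
        unfolding dual[OF e(2)] transverse[OF e(3) e(4)]
        by (rule div[OF structure_equations(1)])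
      then show ?thesis using that by (auto simp: length_2_conv)
    qed
  qed
  moreover have "q = (\<lambda>vs. wedge (e 1) (e 3) vs - wedge (e 2) (e 4) vs)"
  proof (rule homogeneous_eqI[OF hom(2)])
    show "homogeneous 2 (\<lambda>vs. wedge (e 1) (e 3) vs - wedge (e 2) (e 4) vs)"
      using w2 by (simp add: homogeneous_def)
    show "q vs = wedge (e 1) (e 3) vs - wedge (e 2) (e 4) vs" if "length vs = 2" for vs
    proof -
      have "q [a, b] = wedge (e 1) (e 3) [a, b] - wedge (e 2) (e 4) [a, b]" for a b
        unfolding dual[OF e(3)] transverse[OF e(2) e(4)]
        using div[OF structure_equations(2), of a b]
        by (simp add: right_diff_distrib diff_divide_distrib mult_ac)
      then show ?thesis using that by (auto simp: length_2_conv)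
    qed
  qed
  moreover have "r = (\<lambda>vs. wedge (e 1) (e 4) vs + wedge (e 2) (e 3) vs)"
  proof (rule homogeneous_eqI[OF hom(3)])
    show "homogeneous 2 (\<lambda>vs. wedge (e 1) (e 4) vs + wedge (e 2) (e 3) vs)"
      using w2 by (simp add: homogeneous_def)
    show "r vs = wedge (e 1) (e 4) vs + wedge (e 2) (e 3) vs" if "length vs = 2" for vs
    proof -
      have "r [a, b] = wedge (e 1) (e 4) [a, b] + wedge (e 2) (e 3) [a, b]" for a b
        unfolding dual[OF e(4)] transverse[OF e(2) e(3)]
        by (rule div[OF structure_equations(3)])
      then show ?thesis using that by (auto simp: length_2_conv)
    qed
  qed
  moreover have "c1 = 0 \<and> c2 = 0 \<and> c3 = 0 \<and> c4 = 0 \<and> c5 = 0"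
    if eq: "\<forall>u. c1 * e 1 [u] + c2 * e 2 [u] + c3 * e 3 [u] + c4 * e 4 [u] + c5 * h [u] = 0"
    for c1 c2 c3 c4 c5
  proof -
    have "c1 / (\<Delta> * m) * \<sigma> u + c2 * m * p [b1, u] + c3 * m * q [b1, u] + c4 * m * r [b1, u]
        + c5 * h [u] = 0" for u
      using spec[OF eq, of u] unfolding e by simp
    from coframe_independent[of "\<lambda>u. h [u]", OF h this] show ?thesis using m(1) Delta_nonzero by simp
  qed
  ultimately show ?thesis
    using cove unfolding adapted_coframe_def e_def[symmetric] by blast
qed

end

text \<open>One of the five terms of the expansion of \<open>(p \<and> p \<and> h)(v\<^sub>1, \<dots>, v\<^sub>5) \<noteq> 0\<close> has a nonzero Pfaffian;
  its four arguments are \<open>a, b, c, d\<close> and the remaining vector is \<open>u\<close>. By antisymmetry the second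
  expression is, up to sign, the whole expansion. It is also the value of \<open>h\<close> on \<open>reeb_part u\<close>.\<close>

lemma nondegenerate_vectors:
  assumes p: "covector 2 p" and h: "covector 1 h"
    and nz: "wedge (wedge p p) h \<noteq> (\<lambda>vs. 0)"
  obtains a b c d u where "pfaffian p a b c d \<noteq> 0"
    "pfaffian p a b c d * h [u] - pfaffian p u b c d * h [a] - pfaffian p a u c d * h [b]
       - pfaffian p a b u d * h [c] - pfaffian p a b c u * h [d] \<noteq> 0"
proof -
  note hp = covector_homogeneous[OF p] and hh = covector_homogeneous[OF h]
  have hpp: "homogeneous 4 (wedge p p)" by (rule homogeneous_wedge[OF hp hp]) simp
  have "homogeneous 5 (wedge (wedge p p) h)" by (rule homogeneous_wedge[OF hpp hh]) simp
  then obtain v1 v2 v3 v4 v5 where "wedge (wedge p p) h [v1, v2, v3, v4, v5] \<noteq> 0"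
    using nz homogeneousD by (metis length_5_conv)
  then have *: "pfaffian p v1 v2 v3 v4 * h [v5] - pfaffian p v1 v2 v3 v5 * h [v4]
      + pfaffian p v1 v2 v4 v5 * h [v3] - pfaffian p v1 v3 v4 v5 * h [v2]
      + pfaffian p v2 v3 v4 v5 * h [v1] \<noteq> 0"
    by (auto simp: wedge_4_1[OF hpp hh] wedge_2_2_half[OF hp hp])
  have P3: "pfaffian p a c b d = - pfaffian p a b c d" "pfaffian p b a c d = - pfaffian p a b c d"
    "pfaffian p a b d c = - pfaffian p a b c d" for a b c d
    using covector_2_swap[OF p, of a b] covector_2_swap[OF p, of b c] covector_2_swap[OF p, of c d]
    by (simp_all add: half_wedge_def)
  consider "pfaffian p v1 v2 v3 v4 \<noteq> 0" | "pfaffian p v1 v2 v3 v5 \<noteq> 0" | "pfaffian p v1 v2 v4 v5 \<noteq> 0"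
    | "pfaffian p v1 v3 v4 v5 \<noteq> 0" | "pfaffian p v2 v3 v4 v5 \<noteq> 0"
    using * by fastforce
  then show thesis
  proof cases
    case 1
    then show thesis
      using that[of v1 v2 v3 v4 v5] * P3(1)[of v1 v5 v3 v4]  P3(3)[of v1 v2 v5 v4]
        P3(2)[of v5 v2 v3 v4] P3(1)[of v2 v5 v3 v4] P3(3)[of v2 v3 v5 v4] P3(3)[of v1 v3 v5 v4]
      by (simp add: algebra_simps)
  next
    case 2
    then show thesis
      using that[of v1 v2 v3 v5 v4] * P3(1)[of v1 v4 v3 v5] P3(2)[of v4 v2 v3 v5] P3(1)[of v2 v4 v3 v5]
      by (simp add: algebra_simps)
  next
    case 3
    then show thesis
      using that[of v1 v2 v4 v5 v3] * P3(2)[of v3 v2 v4 v5] P3(3)[of v1 v2 v3 v4]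
      by (simp add: algebra_simps)
  next
    case 4
    then show thesis
      using that[of v1 v3 v4 v5 v2] * P3(1)[of v1 v2 v3 v5] P3(3)[of v1 v3 v2 v4] P3(1)[of v1 v2 v3 v4]
      by (simp add: algebra_simps)
  next
    case 5
    then show thesis
      using that[of v2 v3 v4 v5 v1] * P3(2)[of v1 v2 v4 v5] P3(1)[of v2 v1 v3 v5] P3(2)[of v1 v2 v3 v5]
        P3(3)[of v2 v3 v1 v4] P3(1)[of v2 v1 v3 v4] P3(2)[of v1 v2 v3 v4]
      by (simp add: algebra_simps)
  qed
qed


text \<open>The vectors chosen at \<open>x\<close> are kept constant. On the open set where the two expressions of
  \<open>nondegenerate_vectors\<close> stay nonzero, the coframe is given by one formula in the coefficients of the
  2-forms, with nonvanishing denominators and a positive argument of the square root, and is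
  therefore smooth.\<close>

lemma local_adapted_coframe:
  fixes \<eta> \<omega>1 \<omega>2 \<omega>3 :: "'e::euclidean_space \<Rightarrow> 'e list \<Rightarrow> real"
  assumes dim: "DIM('e) = 5" and U: "open U" "x \<in> U"
    and sm: "smooth_covector_field 1 U \<eta>" "smooth_covector_field 2 U \<omega>1"
      "smooth_covector_field 2 U \<omega>2" "smooth_covector_field 2 U \<omega>3"
    and squares: "\<And>y. y \<in> U \<Longrightarrow> wedge (\<omega>2 y) (\<omega>2 y) = wedge (\<omega>1 y) (\<omega>1 y)"
      "\<And>y. y \<in> U \<Longrightarrow> wedge (\<omega>3 y) (\<omega>3 y) = wedge (\<omega>1 y) (\<omega>1 y)"
    and orth: "\<And>y. y \<in> U \<Longrightarrow> wedge (\<omega>1 y) (\<omega>2 y) = (\<lambda>vs. 0)"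
      "\<And>y. y \<in> U \<Longrightarrow> wedge (\<omega>1 y) (\<omega>3 y) = (\<lambda>vs. 0)"
      "\<And>y. y \<in> U \<Longrightarrow> wedge (\<omega>2 y) (\<omega>3 y) = (\<lambda>vs. 0)"
    and orient: "\<And>y X Y. y \<in> U \<Longrightarrow> interior_product X (\<omega>1 y) = interior_product Y (\<omega>2 y) \<Longrightarrow>
      \<omega>3 y [X, Y] \<ge> 0"
    and nz: "wedge (wedge (\<omega>1 x) (\<omega>1 x)) (\<eta> x) \<noteq> (\<lambda>vs. 0)"
  obtains V e where "open V" "x \<in> V" "V \<subseteq> U"
    "\<And>j. j \<in> {1, 2, 3, 4} \<Longrightarrow> smooth_covector_field 1 V (e j)"
    "\<And>y. y \<in> V \<Longrightarrow> adapted_coframe (\<eta> y) (\<omega>1 y) (\<omega>2 y) (\<omega>3 y) (\<lambda>j. e j y)"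
proof -
  note cvf = sm[THEN smooth_covector_fieldD(1)]
  note sms = sm[THEN smooth_covector_fieldD(2)]
  define G where "G y a b c d u = pfaffian (\<omega>1 y) a b c d * \<eta> y [u] - pfaffian (\<omega>1 y) u b c d * \<eta> y [a]
    - pfaffian (\<omega>1 y) a u c d * \<eta> y [b] - pfaffian (\<omega>1 y) a b u d * \<eta> y [c]
    - pfaffian (\<omega>1 y) a b c u * \<eta> y [d]" for y a b c d u
  obtain a b c d u where abcd: "pfaffian (\<omega>1 x) a b c d \<noteq> 0" "G x a b c d u \<noteq> 0"
    using nondegenerate_vectors[OF cvf(2,1)[OF U(2)] nz] unfolding G_def by metis
  \<comment> \<open>nonzero exactly where both expressions are\<close>
  define g where "g y = pfaffian (\<omega>1 y) a b c d * G y a b c d u" for y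
  define V where "V = U \<inter> g -` (- {0})"
  have smg: "smooth_on U g"
    unfolding g_def G_def half_wedge_def by (intro smooth_intros U sms)
  have V: "open V" "x \<in> V" "V \<subseteq> U"
    unfolding V_def
    using continuous_open_preimage[OF smooth_on_imp_continuous_on[OF smg] U(1), of "- {0}"] U abcd
    by (auto simp: g_def)
  define e where "e j y = contraction_coframe (\<omega>1 y) (\<omega>2 y) (\<omega>3 y) a b c d j" for j y
  have triple: "definite_triple (\<omega>1 y) (\<omega>2 y) (\<omega>3 y) a b c d" if "y \<in> V" for y
  proof -
    have y: "y \<in> U" "pfaffian (\<omega>1 y) a b c d \<noteq> 0" using that by (auto simp: V_def g_def)
    show ?thesis
      using y dim cvf[OF y(1)] squares[OF y(1)] orth[OF y(1)] by unfold_locales auto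
  qed
  have adapted: "adapted_coframe (\<eta> y) (\<omega>1 y) (\<omega>2 y) (\<omega>3 y) (\<lambda>j. e j y)" if y: "y \<in> V" for y
  proof -
    interpret definite_triple "\<omega>1 y" "\<omega>2 y" "\<omega>3 y" a b c d by (rule triple[OF y])
    have yU: "y \<in> U" using y V by auto
    note l = covector_1_linear[OF cvf(1)[OF yU]]
    have "\<eta> y [reeb_part u] = G y a b c d u"
      by (simp add: reeb_part_def G_def l[THEN linear_diff] l[THEN linear_cmul])
    then have "\<eta> y [reeb_part u] \<noteq> 0" using y by (auto simp: V_def g_def)
    from adapted_contraction_coframe[of "\<eta> y", OF orient[OF yU] this]
    show ?thesis by (simp add: e_def)
  qed
  have smV: "smooth_on V (\<lambda>y. \<omega>1 y vs)" "smooth_on V (\<lambda>y. \<omega>2 y vs)" "smooth_on V (\<lambda>y. \<omega>3 y vs)" for vs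
    using sms V(3) smooth_on_subset by blast+
  have pos: "pfaffian (\<omega>1 y) a b c d / contraction_det (\<omega>1 y) (\<omega>2 y) (\<omega>3 y) a b c d > 0"
    "contraction_det (\<omega>1 y) (\<omega>2 y) (\<omega>3 y) a b c d \<noteq> 0" "pfaffian (\<omega>1 y) a b c d \<noteq> 0" if y: "y \<in> V" for y
  proof -
    interpret definite_triple "\<omega>1 y" "\<omega>2 y" "\<omega>3 y" a b c d by (rule triple[OF y])
    have yU: "y \<in> U" using y V by auto
    show "lam / \<Delta> > 0" by (rule normalization_pos[OF orient[OF yU]])
    show "\<Delta> \<noteq> 0" "lam \<noteq> 0" by (rule Delta_nonzero) (rule nondeg)
  qed
  have sml: "smooth_on V (\<lambda>y. pfaffian (\<omega>1 y) z b c d)" for z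
    unfolding half_wedge_def by (intro smooth_intros smV V)
  have smk: "smooth_on V (\<lambda>y. half_wedge (\<omega>3 y) (\<omega>2 y) a b c d)"
    "smooth_on V (\<lambda>y. half_wedge (\<omega>1 y) (\<omega>3 y) a b c d)"
    "smooth_on V (\<lambda>y. half_wedge (\<omega>2 y) (\<omega>1 y) a b c d)"
    unfolding half_wedge_def by (intro smooth_intros smV V)+
  have smD: "smooth_on V (\<lambda>y. contraction_det (\<omega>1 y) (\<omega>2 y) (\<omega>3 y) a b c d)"
    unfolding contraction_det_def by (intro smooth_intros smV V)
  have smm: "smooth_on V (\<lambda>y. sqrt (pfaffian (\<omega>1 y) a b c d / contraction_det (\<omega>1 y) (\<omega>2 y) (\<omega>3 y) a b c d))"
    by (intro smooth_intros sml smD V pos)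
  have sms: "smooth_on V (\<lambda>y. metric_dual (\<omega>1 y) (\<omega>2 y) (\<omega>3 y) a b c d z)" for z
    unfolding metric_dual_def by (intro smooth_intros sml smD smk smV V pos)
  have "smooth_on V (\<lambda>y. e j y vs)" if "j \<in> {1, 2, 3, 4}" for j vs
  proof -
    have ne: "contraction_det (\<omega>1 y) (\<omega>2 y) (\<omega>3 y) a b c d *
        sqrt (pfaffian (\<omega>1 y) a b c d / contraction_det (\<omega>1 y) (\<omega>2 y) (\<omega>3 y) a b c d) \<noteq> 0" if "y \<in> V" for y
      using pos[OF that] by auto
    have "smooth_on V (\<lambda>y. metric_dual (\<omega>1 y) (\<omega>2 y) (\<omega>3 y) a b c d z /
       (contraction_det (\<omega>1 y) (\<omega>2 y) (\<omega>3 y) a b c d *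
        sqrt (pfaffian (\<omega>1 y) a b c d / contraction_det (\<omega>1 y) (\<omega>2 y) (\<omega>3 y) a b c d)))" for z
      by (rule smooth_on_divide[OF V(1) sms smooth_on_mult[OF V(1) smD smm] ne])
    moreover have "smooth_on V (\<lambda>y. sqrt (pfaffian (\<omega>1 y) a b c d /
        contraction_det (\<omega>1 y) (\<omega>2 y) (\<omega>3 y) a b c d) * \<omega>' y [a, z])"
      if "\<omega>' = \<omega>1 \<or> \<omega>' = \<omega>2 \<or> \<omega>' = \<omega>3" for \<omega>' z
      using that smV by (auto intro!: smooth_on_mult smm V)
    ultimately show ?thesis
      using that by (cases "length vs = 1")
        (auto simp: e_def contraction_coframe_def Let_def smooth_on_const V(1))
  qed
  moreover have "covector 1 (e j y)" if "j \<in> {1, 2, 3, 4}" "y \<in> V" for j y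
    using adapted[OF that(2)] that(1) unfolding adapted_coframe_def by blast
  ultimately show thesis
    using that[of V e] V adapted unfolding smooth_covector_field_def by blast
qed

section \<open>Charts and forms on the sin-cone\<close>

lemma smooth_manifoldD:
  assumes "smooth_manifold M" "i \<in> charts M"
  shows "open (chart_img M i)" "inj_on (chart_map M i) (chart_dom M i)"
    "j \<in> charts M \<Longrightarrow> open (overlap M i j)"
    "j \<in> charts M \<Longrightarrow> smooth_on (overlap M i j) (transition M i j)"
proof -
  show op: "open (chart_img M i)"
    and "j \<in> charts M \<Longrightarrow> smooth_on (overlap M i j) (transition M i j)"
    using assms unfolding smooth_manifold_def by blast+
  have hm: "homeomorphic_map (subtopology (mtop M) (chart_dom M i)) (top_of_set (chart_img M i))
      (chart_map M i)" and od: "openin (mtop M) (chart_dom M i)"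
    using assms unfolding smooth_manifold_def by blast+
  have ts: "topspace (subtopology (mtop M) (chart_dom M i)) = chart_dom M i"
    using openin_subset[OF od] by auto
  show "inj_on (chart_map M i) (chart_dom M i)"
    using homeomorphic_imp_injective_map[OF hm] by (simp only: ts)
  assume "j \<in> charts M"
  then have "openin (mtop M) (chart_dom M j)"
    using assms unfolding smooth_manifold_def by blast
  then have "openin (subtopology (mtop M) (chart_dom M i)) (chart_dom M i \<inter> chart_dom M j)"
    by (metis inf_commute openin_subtopology)
  then have "openin (top_of_set (chart_img M i)) (overlap M i j)"
    using homeomorphic_imp_open_map[OF hm] by (auto simp: overlap_def open_map_def)
  then show "open (overlap M i j)" using op openin_open_trans by blast
qed

lemma charts_sin_cone [simp]: "charts (sin_cone N) = charts N"
  by (simp add: sin_cone_def)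

lemma chart_img_sin_cone: "chart_img (sin_cone N) i = chart_img N i \<times> {0<..<pi}"
  by (auto simp: chart_img_def sin_cone_def image_iff)

lemma overlap_sin_cone: "overlap (sin_cone N) i j = overlap N i j \<times> {0<..<pi}"
  by (auto simp: overlap_def sin_cone_def image_iff)

lemma transition_sin_cone:
  assumes "inj_on (chart_map N i) (chart_dom N i)" "x \<in> chart_img N i" "t \<in> {0<..<pi}"
  shows "transition (sin_cone N) i j (x, t) = (transition N i j x, t)"
proof -
  obtain p where p: "p \<in> chart_dom N i" "x = chart_map N i p"
    using assms(2) by (auto simp: chart_img_def)
  have "inj_on (chart_map (sin_cone N) i) (chart_dom (sin_cone N) i)"
    using assms(1) by (auto simp: sin_cone_def inj_on_def)
  moreover have "(p, t) \<in> chart_dom (sin_cone N) i" "(x, t) = chart_map (sin_cone N) i (p, t)"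
    using p assms(3) by (auto simp: sin_cone_def)
  ultimately have "inv_into (chart_dom (sin_cone N) i) (chart_map (sin_cone N) i) (x, t) = (p, t)"
    by simp
  moreover have "inv_into (chart_dom N i) (chart_map N i) x = p"
    using p assms(1) by simp
  ultimately show ?thesis by (simp add: transition_def sin_cone_def)
qed

lemma overlap_subset_chart_img: "overlap M i j \<subseteq> chart_img M i"
  by (auto simp: overlap_def chart_img_def)

lemma frechet_derivative_transition_sin_cone:
  fixes N :: "('a, 'i, 'e::euclidean_space) manifold"
  assumes "smooth_manifold N" "i \<in> charts N" "j \<in> charts N" "x \<in> overlap N i j" "t \<in> {0<..<pi}"
  shows "frechet_derivative (transition (sin_cone N) i j) (at (x, t)) =
    (\<lambda>v. (frechet_derivative (transition N i j) (at x) (fst v), snd v))"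
proof -
  note N = smooth_manifoldD[OF assms(1,2)]
  have op: "open (overlap N i j \<times> {0<..<pi})" using N(3)[OF assms(3)] by (simp add: open_Times)
  have mem: "(x, t) \<in> overlap N i j \<times> {0<..<pi}" using assms by simp
  have "frechet_derivative (transition (sin_cone N) i j) (at (x, t)) =
      frechet_derivative (\<lambda>y. (transition N i j (fst y), snd y)) (at (x, t))"
  proof (rule frechet_derivative_cong_open[OF op mem])
    fix y assume "y \<in> overlap N i j \<times> {0<..<pi}"
    then show "transition (sin_cone N) i j y = (transition N i j (fst y), snd y)"
      using transition_sin_cone[OF N(2), of "fst y" "snd y" j] overlap_subset_chart_img[of N i j] by auto
  qed
  also have "\<dots> = (\<lambda>v. (frechet_derivative (transition N i j) (at x) (fst v), snd v))"
  proof (rule frechet_derivative_at[symmetric], rule has_derivative_Pair)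
    have "(transition N i j has_derivative frechet_derivative (transition N i j) (at x)) (at x)"
      by (rule smooth_on_has_derivative[OF N(4)[OF assms(3)] assms(4)])
    then show "((\<lambda>y. transition N i j (fst y)) has_derivative
        (\<lambda>v. frechet_derivative (transition N i j) (at x) (fst v))) (at (x, t))"
      using has_derivative_compose[OF bounded_linear_imp_has_derivative[OF bounded_linear_fst],
          of "transition N i j" _ "(x, t)"] by simp
    show "(snd has_derivative snd) (at (x, t))"
      by (intro bounded_linear_imp_has_derivative bounded_linear_snd)
  qed
  finally show ?thesis .
qed

context
  fixes M :: "('a, 'i, 'e::euclidean_space) manifold"
  assumes open_img: "\<And>i. i \<in> charts M \<Longrightarrow> open (chart_img M i)"
begin

lemma diff_form_add: "diff_form M k \<alpha> \<Longrightarrow> diff_form M k \<beta> \<Longrightarrow> diff_form M k (\<alpha> +\<^sub>f \<beta>)"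
  unfolding diff_form_def form_add_def
  using smooth_covector_field_add(1)[OF open_img] by simp

lemma diff_form_diff: "diff_form M k \<alpha> \<Longrightarrow> diff_form M k \<beta> \<Longrightarrow> diff_form M k (\<alpha> -\<^sub>f \<beta>)"
  unfolding diff_form_def form_diff_def
  using smooth_covector_field_add(2)[OF open_img] by simp

lemma wedge_transition:
  assumes "diff_form M p \<alpha>" "diff_form M q \<beta>" "i \<in> charts M" "j \<in> charts M" "x \<in> overlap M i j"
  shows "(\<alpha> \<and>\<^sub>f \<beta>) i x vs =
    (\<alpha> \<and>\<^sub>f \<beta>) j (transition M i j x) (map (frechet_derivative (transition M i j) (at x)) vs)"
proof -
  let ?L = "map (frechet_derivative (transition M i j) (at x))" and ?y = "transition M i j x"
  have "\<alpha> i x = (\<lambda>vs. \<alpha> j ?y (?L vs))" "\<beta> i x = (\<lambda>vs. \<beta> j ?y (?L vs))"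
    using assms unfolding diff_form_def by (intro ext; blast)+
  then show ?thesis by (simp add: form_wedge_def wedge_map)
qed

lemma diff_form_wedge:
  "diff_form M 1 \<alpha> \<Longrightarrow> diff_form M 1 \<beta> \<Longrightarrow> diff_form M 2 (\<alpha> \<and>\<^sub>f \<beta>)"
  "diff_form M 1 \<alpha> \<Longrightarrow> diff_form M 2 \<beta> \<Longrightarrow> diff_form M 3 (\<alpha> \<and>\<^sub>f \<beta>)"
  "diff_form M 2 \<alpha> \<Longrightarrow> diff_form M 1 \<beta> \<Longrightarrow> diff_form M 3 (\<alpha> \<and>\<^sub>f \<beta>)"
proof -
  show "diff_form M 2 (\<alpha> \<and>\<^sub>f \<beta>)" if *: "diff_form M 1 \<alpha>" "diff_form M 1 \<beta>"
    using * smooth_covector_field_wedge(1)[OF open_img] wedge_transition[OF *]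
    by (auto simp: diff_form_def form_wedge_def)
  show "diff_form M 3 (\<alpha> \<and>\<^sub>f \<beta>)" if *: "diff_form M 1 \<alpha>" "diff_form M 2 \<beta>"
    using * smooth_covector_field_wedge(2)[OF open_img] wedge_transition[OF *]
    by (auto simp: diff_form_def form_wedge_def)
  show "diff_form M 3 (\<alpha> \<and>\<^sub>f \<beta>)" if *: "diff_form M 2 \<alpha>" "diff_form M 1 \<beta>"
    using * smooth_covector_field_wedge(3)[OF open_img] wedge_transition[OF *]
    by (auto simp: diff_form_def form_wedge_def)
qed

end

lemma smooth_covector_field_pull:
  assumes "smooth_covector_field k U \<alpha>" "open V" "fst ` V \<subseteq> U"
  shows "smooth_covector_field k (V :: ('e::euclidean_space \<times> 'd::euclidean_space) set)
    (\<lambda>y vs. \<alpha> (fst y) (map fst vs))"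
  using assms unfolding smooth_covector_field_def
  by (auto intro!: covector_pull linear_fst smooth_on_compose_fst)

lemma smooth_covector_field_dt:
  "open V \<Longrightarrow> smooth_covector_field 1 V (cone_dt i)"
  unfolding smooth_covector_field_def cone_dt_def
  by (auto intro!: covector_1I[unfolded One_nat_def] smooth_on_const simp: homogeneous_def linear_snd)

context
  fixes N :: "('a, 'i, 'e::euclidean_space) manifold"
  assumes N: "smooth_manifold N"
begin

lemma open_chart_img_sin_cone: "i \<in> charts (sin_cone N) \<Longrightarrow> open (chart_img (sin_cone N) i)"
  using smooth_manifoldD(1)[OF N] by (simp add: chart_img_sin_cone open_Times)

lemma diff_form_sin_coneI:
  assumes "\<And>i. i \<in> charts N \<Longrightarrow> smooth_covector_field k (chart_img N i \<times> {0<..<pi}) (\<alpha> i)"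
    and "\<And>i j x t vs. i \<in> charts N \<Longrightarrow> j \<in> charts N \<Longrightarrow> x \<in> overlap N i j \<Longrightarrow> 0 < t \<Longrightarrow> t < pi \<Longrightarrow>
      \<alpha> i (x, t) vs = \<alpha> j (transition N i j x, t)
        (map (\<lambda>v. (frechet_derivative (transition N i j) (at x) (fst v), snd v)) vs)"
  shows "diff_form (sin_cone N) k \<alpha>"
  unfolding diff_form_def
proof (intro conjI ballI allI)
  fix i assume "i \<in> charts (sin_cone N)"
  then show "smooth_covector_field k (chart_img (sin_cone N) i) (\<alpha> i)"
    using assms(1) by (simp add: chart_img_sin_cone)
next
  fix i j y vs
  assume "i \<in> charts (sin_cone N)" "j \<in> charts (sin_cone N)" "y \<in> overlap (sin_cone N) i j"
  then obtain x t where *: "i \<in> charts N" "j \<in> charts N" "x \<in> overlap N i j" "0 < t" "t < pi"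
    "y = (x, t)" by (auto simp: overlap_sin_cone)
  then show "\<alpha> i y vs = \<alpha> j (transition (sin_cone N) i j y)
      (map (frechet_derivative (transition (sin_cone N) i j) (at y)) vs)"
    using assms(2)[OF *(1-5)] frechet_derivative_transition_sin_cone[OF N *(1-3), of t]
      transition_sin_cone[OF smooth_manifoldD(2)[OF N *(1)], of x t j]
      overlap_subset_chart_img[of N i j]
    by auto
qed

lemma diff_form_cone_pull:
  assumes "diff_form N k \<alpha>"
  shows "diff_form (sin_cone N) k (cone_pull \<alpha>)"
proof (rule diff_form_sin_coneI)
  fix i assume i: "i \<in> charts N"
  have "smooth_covector_field k (chart_img N i \<times> {0<..<pi}) (\<lambda>y vs. \<alpha> i (fst y) (map fst vs))"
    using assms i smooth_manifoldD(1)[OF N i]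
    by (intro smooth_covector_field_pull[of k "chart_img N i"]) (auto simp: diff_form_def open_Times)
  then show "smooth_covector_field k (chart_img N i \<times> {0<..<pi}) (cone_pull \<alpha> i)"
    by (simp add: cone_pull_def case_prod_unfold)
next
  fix i j x and t :: real and vs :: "('e \<times> real) list"
  assume *: "i \<in> charts N" "j \<in> charts N" "x \<in> overlap N i j"
  have "\<alpha> i x (map fst vs) = \<alpha> j (transition N i j x)
      (map (frechet_derivative (transition N i j) (at x)) (map fst vs))"
    using assms * unfolding diff_form_def by blast
  then show "cone_pull \<alpha> i (x, t) vs = cone_pull \<alpha> j (transition N i j x, t)
        (map (\<lambda>v. (frechet_derivative (transition N i j) (at x) (fst v), snd v)) vs)"
    by (simp add: cone_pull_def comp_def)
qed

lemma diff_form_cone_dt: "diff_form (sin_cone N) 1 cone_dt"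
proof (rule diff_form_sin_coneI)
  show "smooth_covector_field 1 (chart_img N i \<times> {0<..<pi}) (cone_dt i)" if "i \<in> charts N" for i
    using smooth_manifoldD(1)[OF N that] by (intro smooth_covector_field_dt) (simp add: open_Times)
qed (auto simp: cone_dt_def length_Suc_0_conv)

lemma diff_form_cone_scale:
  assumes "diff_form (sin_cone N) k \<alpha>" and f: "\<And>S :: ('e \<times> real) set. open S \<Longrightarrow> smooth_on S (\<lambda>y. f (snd y))"
  shows "diff_form (sin_cone N) k (f *\<^sub>t \<alpha>)"
proof (rule diff_form_sin_coneI)
  fix i assume i: "i \<in> charts N"
  let ?U = "chart_img N i \<times> {0<..<pi}"
  have op: "open ?U" using smooth_manifoldD(1)[OF N i] by (simp add: open_Times)
  have "smooth_covector_field k ?U (\<alpha> i)"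
    using assms(1) i by (simp add: diff_form_def chart_img_sin_cone)
  then have "smooth_covector_field k ?U (\<lambda>y vs. f (snd y) * \<alpha> i y vs)"
    by (rule smooth_covector_field_add(3)[OF op f[OF op]])
  then show "smooth_covector_field k ?U ((f *\<^sub>t \<alpha>) i)"
    by (simp add: cone_scale_def case_prod_unfold)
next
  fix i j x and t :: real and vs :: "('e \<times> real) list"
  assume *: "i \<in> charts N" "j \<in> charts N" "x \<in> overlap N i j" "0 < t" "t < pi"
  then have "\<alpha> i (x, t) vs = \<alpha> j (transition (sin_cone N) i j (x, t))
      (map (frechet_derivative (transition (sin_cone N) i j) (at (x, t))) vs)"
    using assms(1) unfolding diff_form_def by (auto simp: overlap_sin_cone)
  then show "(f *\<^sub>t \<alpha>) i (x, t) vs = (f *\<^sub>t \<alpha>) j (transition N i j x, t)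
        (map (\<lambda>v. (frechet_derivative (transition N i j) (at x) (fst v), snd v)) vs)"
    using frechet_derivative_transition_sin_cone[OF N *(1-3), of t]
      transition_sin_cone[OF smooth_manifoldD(2)[OF N *(1)], of x t j]
      overlap_subset_chart_img[of N i j] *
    by (auto simp: cone_scale_def)
qed

lemma diff_form_cone_structure:
  assumes "diff_form N 1 \<eta>" "diff_form N 2 (\<omega> 1)" "diff_form N 2 (\<omega> 2)" "diff_form N 2 (\<omega> 3)"
  shows "diff_form (sin_cone N) 2 (cone_F \<eta> \<omega>)" "diff_form (sin_cone N) 3 (cone_Psi_plus \<eta> \<omega>)"
    "diff_form (sin_cone N) 3 (cone_Psi_minus \<eta> \<omega>)"
  unfolding cone_F_def cone_Psi_plus_def cone_Psi_minus_def
  by (intro diff_form_add diff_form_diff diff_form_wedge diff_form_cone_scale diff_form_cone_pull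
      diff_form_cone_dt open_chart_img_sin_cone assms smooth_intros smooth_on_snd; assumption)+

end

section \<open>The exterior derivatives on the sin-cone\<close>

lemma cone_product_derivative:
  fixes g :: "'e::real_normed_vector \<Rightarrow> real"
  assumes "(f has_real_derivative f') (at t)" "(g has_derivative g') (at x)"
  shows "((\<lambda>y. f (snd y) * g (fst y)) has_derivative (\<lambda>v. f t * g' (fst v) + f' * snd v * g x)) (at (x, t))"
proof -
  have "((\<lambda>y. f (snd y)) has_derivative (\<lambda>v. f' * snd v)) (at (x, t))"
    using has_derivative_compose[OF bounded_linear_imp_has_derivative[OF bounded_linear_snd],
        of f "(*) f'" "(x, t)"] assms(1) by (simp add: has_field_derivative_def)
  moreover have "((\<lambda>y. g (fst y)) has_derivative (\<lambda>v. g' (fst v))) (at (x, t))"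
    using has_derivative_compose[OF bounded_linear_imp_has_derivative[OF bounded_linear_fst],
        of g g' "(x, t)"] assms(2) by simp
  ultimately show ?thesis using has_derivative_mult by fastforce
qed

lemma wedge_cone_pull:
  "wedge (cone_pull \<alpha> i (x, t)) (cone_pull \<beta> i (x, t)) vs = wedge (\<alpha> i x) (\<beta> i x) (map fst vs)"
  by (simp add: cone_pull_def wedge_map)

lemma homogeneous_cone_pull: "homogeneous k (\<alpha> i x) \<Longrightarrow> homogeneous k (cone_pull \<alpha> i (x, t))"
  by (simp add: homogeneous_def cone_pull_def)

lemma homogeneous_cone_dt: "homogeneous 1 (cone_dt i y)"
  by (simp add: homogeneous_def cone_dt_def)

context
  fixes \<eta> :: "('i, 'e::euclidean_space) form" and \<omega> :: "nat \<Rightarrow> ('i, 'e) form" and i :: 'i and x :: 'e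
  assumes hom: "homogeneous 1 (\<eta> i x)" "homogeneous 2 (\<omega> 1 i x)" "homogeneous 2 (\<omega> 2 i x)"
    "homogeneous 2 (\<omega> 3 i x)"
begin

lemma hom_pull: "homogeneous 1 (cone_pull \<eta> i (x, t))" "homogeneous 2 (cone_pull (\<omega> 1) i (x, t))"
  "homogeneous 2 (cone_pull (\<omega> 2) i (x, t))" "homogeneous 2 (cone_pull (\<omega> 3) i (x, t))"
  using hom by (simp_all add: homogeneous_cone_pull)

lemma homogeneous_rotated_form:
  "homogeneous 2 (\<lambda>vs. sin t * cone_pull (\<omega> 3) i (x, t) vs - cos t * cone_pull (\<omega> (Suc 0)) i (x, t) vs)"
  using hom by (simp add: homogeneous_def cone_pull_def)

lemma cone_F_apply:
  "cone_F \<eta> \<omega> i (x, t) [(a, \<tau>a), (b, \<tau>b)] =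
     sin t ^ 3 * \<omega> 1 i x [a, b] + (sin t)\<^sup>2 * cos t * \<omega> 3 i x [a, b]
     + sin t * (\<eta> i x [a] * \<tau>b - \<eta> i x [b] * \<tau>a)"
  unfolding cone_F_def form_add_def cone_scale_def form_wedge_def
  by (simp add: wedge_1_1[OF hom_pull(1) homogeneous_cone_dt])
    (simp add: cone_pull_def cone_dt_def power2_eq_square power3_eq_cube algebra_simps)

lemma cone_Psi_plus_apply:
  "cone_Psi_plus \<eta> \<omega> i (x, t) [(a, \<tau>a), (b, \<tau>b), (c, \<tau>c)] =
     sin t ^ 3 * wedge (\<eta> i x) (\<omega> 2 i x) [a, b, c]
     + ((sin t)\<^sup>2 * cos t * \<omega> 1 i x [a, b] - sin t ^ 3 * \<omega> 3 i x [a, b]) * \<tau>c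
     - ((sin t)\<^sup>2 * cos t * \<omega> 1 i x [a, c] - sin t ^ 3 * \<omega> 3 i x [a, c]) * \<tau>b
     + ((sin t)\<^sup>2 * cos t * \<omega> 1 i x [b, c] - sin t ^ 3 * \<omega> 3 i x [b, c]) * \<tau>a"
  unfolding cone_Psi_plus_def form_diff_def form_add_def cone_scale_def form_wedge_def
  by (simp add: wedge_2_1[OF homogeneous_rotated_form homogeneous_cone_dt] wedge_cone_pull)
    (simp add: cone_pull_def cone_dt_def power2_eq_square power3_eq_cube algebra_simps)

lemma cone_Psi_minus_apply:
  "cone_Psi_minus \<eta> \<omega> i (x, t) [(a, \<tau>a), (b, \<tau>b), (c, \<tau>c)] =
     sin t ^ 3 * ((- cos t * \<omega> 1 i x [a, b] + sin t * \<omega> 3 i x [a, b]) * \<eta> i x [c]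
       - (- cos t * \<omega> 1 i x [a, c] + sin t * \<omega> 3 i x [a, c]) * \<eta> i x [b]
       + (- cos t * \<omega> 1 i x [b, c] + sin t * \<omega> 3 i x [b, c]) * \<eta> i x [a])
     + (sin t)\<^sup>2 * (\<omega> 2 i x [a, b] * \<tau>c - \<omega> 2 i x [a, c] * \<tau>b + \<omega> 2 i x [b, c] * \<tau>a)"
  unfolding cone_Psi_minus_def form_diff_def form_add_def cone_scale_def form_wedge_def
  by (simp add: wedge_2_1[OF homogeneous_rotated_form hom_pull(1)]
      wedge_2_1[OF hom_pull(3) homogeneous_cone_dt])
    (simp add: cone_pull_def cone_dt_def)

lemma homogeneous_cone_structure:
  "homogeneous 2 (cone_F \<eta> \<omega> i (x, t))" "homogeneous 3 (cone_Psi_plus \<eta> \<omega> i (x, t))"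
  "homogeneous 3 (cone_Psi_minus \<eta> \<omega> i (x, t))"
proof -
  note p = hom_pull[of t]
  have "homogeneous 2 (wedge (cone_pull \<eta> i (x, t)) (cone_dt i (x, t)))"
    by (rule homogeneous_wedge[OF p(1) homogeneous_cone_dt]) simp
  then show "homogeneous 2 (cone_F \<eta> \<omega> i (x, t))"
    using p unfolding cone_F_def form_add_def cone_scale_def form_wedge_def
    by (simp add: homogeneous_def)
  have "homogeneous 3 (wedge (cone_pull \<eta> i (x, t)) (cone_pull (\<omega> 2) i (x, t)))"
    "homogeneous 3 (wedge (\<lambda>vs. sin t * cone_pull (\<omega> 3) i (x, t) vs
       - cos t * cone_pull (\<omega> (Suc 0)) i (x, t) vs) (cone_dt i (x, t)))"
    by (rule homogeneous_wedge[OF p(1,3)] homogeneous_wedge[OF homogeneous_rotated_form homogeneous_cone_dt]; simp)+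
  then show "homogeneous 3 (cone_Psi_plus \<eta> \<omega> i (x, t))"
    unfolding cone_Psi_plus_def form_add_def form_diff_def cone_scale_def form_wedge_def
    by (simp add: homogeneous_def)
  have "homogeneous 3 (wedge (cone_pull (\<omega> 2) i (x, t)) (cone_dt i (x, t)))"
    "homogeneous 3 (wedge (\<lambda>vs. sin t * cone_pull (\<omega> 3) i (x, t) vs
       - cos t * cone_pull (\<omega> (Suc 0)) i (x, t) vs) (cone_pull \<eta> i (x, t)))"
    by (rule homogeneous_wedge[OF p(3) homogeneous_cone_dt] homogeneous_wedge[OF homogeneous_rotated_form p(1)]; simp)+
  then show "homogeneous 3 (cone_Psi_minus \<eta> \<omega> i (x, t))"
    unfolding cone_Psi_minus_def form_add_def form_diff_def cone_scale_def form_wedge_def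
    by (simp add: homogeneous_def)
qed

end

text \<open>The hypotheses say \<open>\<Theta> = \<rho> + dt \<and> \<sigma>\<close> and \<open>\<Phi> = \<phi> + s h \<and> dt\<close>; the conclusion says that
  \<open>\<Theta> \<and> \<Phi> = \<rho> \<and> \<phi> + dt \<and> (\<sigma> \<and> \<phi> + s \<rho> \<and> h)\<close>. The sign of the last term comes from moving \<open>dt\<close>
  past \<open>h\<close> and the 3-form \<open>\<rho>\<close>.\<close>

lemma wedge_3_2_cone:
  fixes \<rho> \<sigma> \<phi> h :: "'e list \<Rightarrow> real" and \<Theta> \<Phi> :: "('e \<times> real) list \<Rightarrow> real"
  assumes hom: "homogeneous 3 \<Theta>" "homogeneous 2 \<Phi>" "homogeneous 3 \<rho>" "homogeneous 2 \<sigma>"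
      "homogeneous 2 \<phi>" "homogeneous 1 h"
    and \<Theta>: "\<And>a \<tau>a b \<tau>b c \<tau>c. \<Theta> [(a, \<tau>a), (b, \<tau>b), (c, \<tau>c)] =
      \<rho> [a, b, c] + \<tau>a * \<sigma> [b, c] - \<tau>b * \<sigma> [a, c] + \<tau>c * \<sigma> [a, b]"
    and \<Phi>: "\<And>a \<tau>a b \<tau>b. \<Phi> [(a, \<tau>a), (b, \<tau>b)] = \<phi> [a, b] + s * (h [a] * \<tau>b - h [b] * \<tau>a)"
  defines "\<nu> \<equiv> \<lambda>vs. wedge \<sigma> \<phi> vs + s * wedge \<rho> h vs"
  shows "wedge \<Theta> \<Phi> [(a, \<tau>a), (b, \<tau>b), (c, \<tau>c), (d, \<tau>d), (e, \<tau>e)] = wedge \<rho> \<phi> [a, b, c, d, e]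
    + \<tau>a * \<nu> [b, c, d, e] - \<tau>b * \<nu> [a, c, d, e] + \<tau>c * \<nu> [a, b, d, e] - \<tau>d * \<nu> [a, b, c, e]
    + \<tau>e * \<nu> [a, b, c, d]"
  unfolding \<nu>_def wedge_3_2[OF hom(1,2)] wedge_3_2[OF hom(3,5)] wedge_2_2[OF hom(4,5)]
    wedge_3_1[OF hom(3,6)] \<Theta> \<Phi>
  by (simp add: algebra_simps)

lemma wedge_assoc_1_2_2:
  fixes h p q :: "'e list \<Rightarrow> real"
  assumes "homogeneous 1 h" "homogeneous 2 p" "homogeneous 2 q"
  shows "wedge (wedge h p) q [a, b, c, d, e] = wedge h (wedge p q) [a, b, c, d, e]"
proof -
  have hp: "homogeneous 3 (wedge h p)" by (rule homogeneous_wedge[OF assms(1,2)]) simp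
  have pq: "homogeneous 4 (wedge p q)" by (rule homogeneous_wedge[OF assms(2,3)]) simp
  show ?thesis
    unfolding wedge_3_2[OF hp assms(3)] wedge_1_4[OF assms(1) pq] wedge_1_2[OF assms(1,2)]
      wedge_2_2[OF assms(2,3)]
    by (simp add: algebra_simps)
qed

lemma wedge_1_2_1_zero:
  fixes h p :: "'e list \<Rightarrow> real"
  assumes "homogeneous 1 h" "homogeneous 2 p"
  shows "wedge (wedge h p) h [a, b, c, d] = 0"
proof -
  have hp: "homogeneous 3 (wedge h p)" by (rule homogeneous_wedge[OF assms(1,2)]) simp
  show ?thesis
    unfolding wedge_3_1[OF hp assms(1)] wedge_1_2[OF assms(1,2)] by (simp add: algebra_simps)
qed

lemma wedge_1_1_2_zero:
  fixes h p :: "'e list \<Rightarrow> real"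
  assumes "homogeneous 1 h" "homogeneous 2 p"
  shows "wedge h (wedge h p) [a, b, c, d] = 0"
proof -
  have hp: "homogeneous 3 (wedge h p)" by (rule homogeneous_wedge[OF assms(1,2)]) simp
  show ?thesis
    unfolding wedge_1_3[OF assms(1) hp] wedge_1_2[OF assms(1,2)] by (simp add: algebra_simps)
qed

lemma wedge_zero_right: "wedge \<alpha> (\<lambda>vs. 0) vs = 0"
  by (simp add: wedge_def)

lemma wedge_scale_left: "wedge (\<lambda>vs. c * \<alpha> vs) \<beta> vs = c * wedge \<alpha> \<beta> vs"
  by (simp add: wedge_def sum_distrib_left mult_ac)

lemma wedge_scale_right: "wedge \<alpha> (\<lambda>vs. c * \<beta> vs) vs = c * wedge \<alpha> \<beta> vs"
  by (simp add: wedge_def sum_distrib_left mult_ac)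

lemma wedge_add_left: "wedge (\<lambda>vs. \<alpha> vs + \<alpha>' vs) \<beta> vs = wedge \<alpha> \<beta> vs + wedge \<alpha>' \<beta> vs"
  by (simp add: wedge_def sum.distrib algebra_simps)

lemma wedge_add_right: "wedge \<alpha> (\<lambda>vs. \<beta> vs + \<beta>' vs) vs = wedge \<alpha> \<beta> vs + wedge \<alpha> \<beta>' vs"
  by (simp add: wedge_def sum.distrib algebra_simps)

text \<open>The coordinate expression of an SU(2)-structure in one chart, with image \<open>U\<close>.\<close>

locale su2_chart =
  fixes \<eta> :: "('i, 'e::euclidean_space) form" and \<omega> :: "nat \<Rightarrow> ('i, 'e) form" and i :: 'i and U :: "'e set"
  assumes dim: "DIM('e) = 5" and open_U: "open U"
    and sm: "smooth_covector_field 1 U (\<eta> i)" "smooth_covector_field 2 U (\<omega> 1 i)"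
      "smooth_covector_field 2 U (\<omega> 2 i)" "smooth_covector_field 2 U (\<omega> 3 i)"
    and squares: "\<And>y. y \<in> U \<Longrightarrow> wedge (\<omega> 2 i y) (\<omega> 2 i y) = wedge (\<omega> 1 i y) (\<omega> 1 i y)"
      "\<And>y. y \<in> U \<Longrightarrow> wedge (\<omega> 3 i y) (\<omega> 3 i y) = wedge (\<omega> 1 i y) (\<omega> 1 i y)"
    and orth: "\<And>y. y \<in> U \<Longrightarrow> wedge (\<omega> 1 i y) (\<omega> 2 i y) = (\<lambda>vs. 0)"
      "\<And>y. y \<in> U \<Longrightarrow> wedge (\<omega> 1 i y) (\<omega> 3 i y) = (\<lambda>vs. 0)"
      "\<And>y. y \<in> U \<Longrightarrow> wedge (\<omega> 2 i y) (\<omega> 3 i y) = (\<lambda>vs. 0)"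
    and orient: "\<And>y X Y. y \<in> U \<Longrightarrow> interior_product X (\<omega> 1 i y) = interior_product Y (\<omega> 2 i y) \<Longrightarrow>
      \<omega> 3 i y [X, Y] \<ge> 0"
    and nz: "\<And>y. y \<in> U \<Longrightarrow> wedge (wedge (\<omega> 1 i y) (\<omega> 1 i y)) (\<eta> i y) \<noteq> (\<lambda>vs. 0)"
begin

lemma homogeneous_fields:
  assumes "y \<in> U"
  shows "homogeneous 1 (\<eta> i y)" "homogeneous 2 (\<omega> 1 i y)" "homogeneous 2 (\<omega> 2 i y)"
    "homogeneous 2 (\<omega> 3 i y)" "homogeneous 3 (wedge (\<eta> i y) (\<omega> 2 i y))"
proof -
  show h: "homogeneous 1 (\<eta> i y)" "homogeneous 2 (\<omega> 1 i y)" "homogeneous 2 (\<omega> 2 i y)"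
    "homogeneous 2 (\<omega> 3 i y)"
    using sm[THEN smooth_covector_fieldD(1), OF assms] covector_homogeneous by auto
  show "homogeneous 3 (wedge (\<eta> i y) (\<omega> 2 i y))"
    by (rule homogeneous_wedge[OF h(1,3)]) simp
qed

lemma homogeneous_ext_d_fields:
  assumes "y \<in> U"
  shows "homogeneous 2 (ext_d \<eta> i y)" "homogeneous 3 (ext_d (\<omega> 1) i y)"
    "homogeneous 3 (ext_d (\<omega> 3) i y)" "homogeneous 4 (ext_d (\<eta> \<and>\<^sub>f \<omega> 2) i y)"
  using homogeneous_ext_d[OF open_U assms, of 1 \<eta> i] homogeneous_ext_d[OF open_U assms, of 2 "\<omega> 1" i]
    homogeneous_ext_d[OF open_U assms, of 2 "\<omega> 3" i]
    homogeneous_ext_d[OF open_U assms, of 3 "\<eta> \<and>\<^sub>f \<omega> 2" i] homogeneous_fields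
  by (simp_all add: numeral_eq_Suc form_wedge_def)

lemma open_cylinder: "open (U \<times> (UNIV :: real set))"
  using open_U by (simp add: open_Times)

lemma homogeneous_ext_d_cone:
  assumes "x \<in> U"
  shows "homogeneous 3 (ext_d (cone_F \<eta> \<omega>) i (x, t))" "homogeneous 4 (ext_d (cone_Psi_plus \<eta> \<omega>) i (x, t))"
proof -
  have mem: "(x, t) \<in> U \<times> UNIV" using assms by simp
  have "homogeneous 2 (cone_F \<eta> \<omega> i y)" "homogeneous 3 (cone_Psi_plus \<eta> \<omega> i y)"
    if "y \<in> U \<times> UNIV" for y
    using homogeneous_cone_structure[of \<eta> i "fst y" \<omega> "snd y", OF homogeneous_fields(1-4)] that
    by (auto simp: mem_Times_iff)
  then show "homogeneous 3 (ext_d (cone_F \<eta> \<omega>) i (x, t))"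
    "homogeneous 4 (ext_d (cone_Psi_plus \<eta> \<omega>) i (x, t))"
    using homogeneous_ext_d[OF open_cylinder mem, of 2 "cone_F \<eta> \<omega>" i]
      homogeneous_ext_d[OF open_cylinder mem, of 3 "cone_Psi_plus \<eta> \<omega>" i]
    by (simp_all add: numeral_eq_Suc)
qed

lemma fields_have_derivative:
  assumes "x \<in> U"
  shows "((\<lambda>y. \<eta> i y vs) has_derivative frechet_derivative (\<lambda>y. \<eta> i y vs) (at x)) (at x)"
    "((\<lambda>y. \<omega> 1 i y vs) has_derivative frechet_derivative (\<lambda>y. \<omega> 1 i y vs) (at x)) (at x)"
    "((\<lambda>y. \<omega> 3 i y vs) has_derivative frechet_derivative (\<lambda>y. \<omega> 3 i y vs) (at x)) (at x)"
    "((\<lambda>y. wedge (\<eta> i y) (\<omega> 2 i y) vs) has_derivative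
       frechet_derivative (\<lambda>y. wedge (\<eta> i y) (\<omega> 2 i y) vs) (at x)) (at x)"
  using smooth_on_has_derivative[OF smooth_covector_fieldD(2)[OF sm(1)] assms]
    smooth_on_has_derivative[OF smooth_covector_fieldD(2)[OF sm(2)] assms]
    smooth_on_has_derivative[OF smooth_covector_fieldD(2)[OF sm(4)] assms]
    smooth_on_has_derivative[OF smooth_covector_fieldD(2)[OF
      smooth_covector_field_wedge(2)[OF open_U sm(1,3)]] assms]
  by auto

lemma sin_power_derivatives:
  "((\<lambda>t. sin t ^ 3) has_real_derivative 3 * (sin t)\<^sup>2 * cos t) (at t)"
  "((\<lambda>t. (sin t)\<^sup>2 * cos t) has_real_derivative 2 * sin t * (cos t)\<^sup>2 - sin t ^ 3) (at t)"
  by (auto intro!: derivative_eq_intros simp: power2_eq_square power3_eq_cube algebra_simps)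

text \<open>The coefficient of \<open>dt\<close> in \<open>dF\<close>.\<close>

definition dF_radial :: "'e \<Rightarrow> real \<Rightarrow> 'e list \<Rightarrow> real" where
  "dF_radial x t vs = 3 * (sin t)\<^sup>2 * cos t * \<omega> 1 i x vs
     + (2 * sin t * (cos t)\<^sup>2 - sin t ^ 3) * \<omega> 3 i x vs + sin t * ext_d \<eta> i x vs"

lemma ext_d_cone_F:
  assumes x: "x \<in> U"
  shows "ext_d (cone_F \<eta> \<omega>) i (x, t) [(a, \<tau>a), (b, \<tau>b), (c, \<tau>c)] =
    sin t ^ 3 * ext_d (\<omega> 1) i x [a, b, c] + (sin t)\<^sup>2 * cos t * ext_d (\<omega> 3) i x [a, b, c]
    + \<tau>a * dF_radial x t [b, c] - \<tau>b * dF_radial x t [a, c] + \<tau>c * dF_radial x t [a, b]"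
proof -
  have mem: "(x, t) \<in> U \<times> UNIV" using x by simp
  have D: "frechet_derivative (\<lambda>y. cone_F \<eta> \<omega> i y [(b, \<tau>b), (c, \<tau>c)]) (at (x, t)) = (\<lambda>v.
      (sin t ^ 3 * frechet_derivative (\<lambda>y. \<omega> 1 i y [b, c]) (at x) (fst v)
        + 3 * (sin t)\<^sup>2 * cos t * snd v * \<omega> 1 i x [b, c])
    + ((sin t)\<^sup>2 * cos t * frechet_derivative (\<lambda>y. \<omega> 3 i y [b, c]) (at x) (fst v)
        + (2 * sin t * (cos t)\<^sup>2 - sin t ^ 3) * snd v * \<omega> 3 i x [b, c])
    + (sin t * (frechet_derivative (\<lambda>y. \<eta> i y [b]) (at x) (fst v) * \<tau>c
          - frechet_derivative (\<lambda>y. \<eta> i y [c]) (at x) (fst v) * \<tau>b)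
        + cos t * snd v * (\<eta> i x [b] * \<tau>c - \<eta> i x [c] * \<tau>b)))" for b \<tau>b c \<tau>c
  proof -
    have eq: "frechet_derivative (\<lambda>y. cone_F \<eta> \<omega> i y [(b, \<tau>b), (c, \<tau>c)]) (at (x, t)) =
        frechet_derivative (\<lambda>y. sin (snd y) ^ 3 * \<omega> 1 i (fst y) [b, c]
          + (sin (snd y))\<^sup>2 * cos (snd y) * \<omega> 3 i (fst y) [b, c]
          + sin (snd y) * (\<eta> i (fst y) [b] * \<tau>c - \<eta> i (fst y) [c] * \<tau>b)) (at (x, t))"
    proof (rule frechet_derivative_cong_open[OF open_cylinder mem])
      fix y :: "'e \<times> real" assume "y \<in> U \<times> UNIV"
      then show "cone_F \<eta> \<omega> i y [(b, \<tau>b), (c, \<tau>c)] = sin (snd y) ^ 3 * \<omega> 1 i (fst y) [b, c]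
          + (sin (snd y))\<^sup>2 * cos (snd y) * \<omega> 3 i (fst y) [b, c]
          + sin (snd y) * (\<eta> i (fst y) [b] * \<tau>c - \<eta> i (fst y) [c] * \<tau>b)"
        using cone_F_apply[of \<eta> i "fst y" \<omega> "snd y", OF homogeneous_fields(1-4)]
        by (simp add: mem_Times_iff)
    qed
    show ?thesis
      unfolding eq
      by (rule frechet_derivative_at[symmetric], intro has_derivative_add cone_product_derivative
          sin_power_derivatives DERIV_sin fields_have_derivative x has_derivative_diff has_derivative_mult_left)
  qed
  show ?thesis
    unfolding ext_d_3 D dF_radial_def ext_d_2 by (simp add: algebra_simps)
qed

text \<open>The coefficient of \<open>dt\<close> in \<open>d\<Psi>\<^sub>+\<close>.\<close>

definition dPsi_radial :: "'e \<Rightarrow> real \<Rightarrow> 'e list \<Rightarrow> real" where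
  "dPsi_radial x t vs = (sin t)\<^sup>2 * cos t * (3 * wedge (\<eta> i x) (\<omega> 2 i x) vs - ext_d (\<omega> 1) i x vs)
     + sin t ^ 3 * ext_d (\<omega> 3) i x vs"

lemma ext_d_cone_Psi_plus:
  assumes x: "x \<in> U"
  shows "ext_d (cone_Psi_plus \<eta> \<omega>) i (x, t) [(a, \<tau>a), (b, \<tau>b), (c, \<tau>c), (d, \<tau>d)] =
    sin t ^ 3 * ext_d (\<eta> \<and>\<^sub>f \<omega> 2) i x [a, b, c, d]
    + \<tau>a * dPsi_radial x t [b, c, d] - \<tau>b * dPsi_radial x t [a, c, d] + \<tau>c * dPsi_radial x t [a, b, d]
    - \<tau>d * dPsi_radial x t [a, b, c]"
proof -
  have mem: "(x, t) \<in> U \<times> UNIV" using x by simp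
  let ?E = "\<lambda>y. wedge (\<eta> i y) (\<omega> 2 i y)"
  have D: "frechet_derivative (\<lambda>y. cone_Psi_plus \<eta> \<omega> i y [(a, \<tau>a), (b, \<tau>b), (c, \<tau>c)]) (at (x, t)) = (\<lambda>v.
      (sin t ^ 3 * frechet_derivative (\<lambda>y. ?E y [a, b, c]) (at x) (fst v)
        + 3 * (sin t)\<^sup>2 * cos t * snd v * ?E x [a, b, c])
    + ((sin t)\<^sup>2 * cos t * (frechet_derivative (\<lambda>y. \<omega> 1 i y [a, b]) (at x) (fst v) * \<tau>c
          - frechet_derivative (\<lambda>y. \<omega> 1 i y [a, c]) (at x) (fst v) * \<tau>b
          + frechet_derivative (\<lambda>y. \<omega> 1 i y [b, c]) (at x) (fst v) * \<tau>a)
        + (2 * sin t * (cos t)\<^sup>2 - sin t ^ 3) * snd v *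
          (\<omega> 1 i x [a, b] * \<tau>c - \<omega> 1 i x [a, c] * \<tau>b + \<omega> 1 i x [b, c] * \<tau>a))
    - (sin t ^ 3 * (frechet_derivative (\<lambda>y. \<omega> 3 i y [a, b]) (at x) (fst v) * \<tau>c
          - frechet_derivative (\<lambda>y. \<omega> 3 i y [a, c]) (at x) (fst v) * \<tau>b
          + frechet_derivative (\<lambda>y. \<omega> 3 i y [b, c]) (at x) (fst v) * \<tau>a)
        + 3 * (sin t)\<^sup>2 * cos t * snd v *
          (\<omega> 3 i x [a, b] * \<tau>c - \<omega> 3 i x [a, c] * \<tau>b + \<omega> 3 i x [b, c] * \<tau>a)))"
    for a \<tau>a b \<tau>b c \<tau>c
  proof -
    have eq: "frechet_derivative (\<lambda>y. cone_Psi_plus \<eta> \<omega> i y [(a, \<tau>a), (b, \<tau>b), (c, \<tau>c)]) (at (x, t)) =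
        frechet_derivative (\<lambda>y. sin (snd y) ^ 3 * ?E (fst y) [a, b, c]
          + (sin (snd y))\<^sup>2 * cos (snd y) * (\<omega> 1 i (fst y) [a, b] * \<tau>c - \<omega> 1 i (fst y) [a, c] * \<tau>b
              + \<omega> 1 i (fst y) [b, c] * \<tau>a)
          - sin (snd y) ^ 3 * (\<omega> 3 i (fst y) [a, b] * \<tau>c - \<omega> 3 i (fst y) [a, c] * \<tau>b
              + \<omega> 3 i (fst y) [b, c] * \<tau>a)) (at (x, t))"
    proof (rule frechet_derivative_cong_open[OF open_cylinder mem])
      fix y :: "'e \<times> real" assume "y \<in> U \<times> UNIV"
      then show "cone_Psi_plus \<eta> \<omega> i y [(a, \<tau>a), (b, \<tau>b), (c, \<tau>c)] = sin (snd y) ^ 3 * ?E (fst y) [a, b, c]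
          + (sin (snd y))\<^sup>2 * cos (snd y) * (\<omega> 1 i (fst y) [a, b] * \<tau>c - \<omega> 1 i (fst y) [a, c] * \<tau>b
              + \<omega> 1 i (fst y) [b, c] * \<tau>a)
          - sin (snd y) ^ 3 * (\<omega> 3 i (fst y) [a, b] * \<tau>c - \<omega> 3 i (fst y) [a, c] * \<tau>b
              + \<omega> 3 i (fst y) [b, c] * \<tau>a)"
        using cone_Psi_plus_apply[of \<eta> i "fst y" \<omega> "snd y", OF homogeneous_fields(1-4)]
        by (simp add: mem_Times_iff algebra_simps)
    qed
    show ?thesis
      unfolding eq
      by (rule frechet_derivative_at[symmetric], intro has_derivative_add has_derivative_diff
          cone_product_derivative sin_power_derivatives fields_have_derivative x has_derivative_mult_left)
  qed
  have dE: "ext_d (\<eta> \<and>\<^sub>f \<omega> 2) i x [a, b, c, d] =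
      frechet_derivative (\<lambda>y. ?E y [b, c, d]) (at x) a - frechet_derivative (\<lambda>y. ?E y [a, c, d]) (at x) b
    + frechet_derivative (\<lambda>y. ?E y [a, b, d]) (at x) c - frechet_derivative (\<lambda>y. ?E y [a, b, c]) (at x) d"
    unfolding ext_d_4 form_wedge_def ..
  show ?thesis
    unfolding ext_d_4[of "cone_Psi_plus \<eta> \<omega>"] D dPsi_radial_def dE ext_d_3
    by (simp add: algebra_simps)
qed

end

context su2_chart
begin

text \<open>In \<open>dF \<and> F\<close> the component without \<open>dt\<close> consists of multiples of \<open>\<eta> \<and> \<omega>\<^sub>2 \<and> \<omega>\<^sub>1\<close> and
  \<open>\<eta> \<and> \<omega>\<^sub>2 \<and> \<omega>\<^sub>3\<close>, which are zero. In the coefficient of \<open>dt\<close>, the products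
  \<open>\<omega>\<^sub>1 \<and> \<omega>\<^sub>1 = \<omega>\<^sub>3 \<and> \<omega>\<^sub>3\<close> add up to \<open>2 sin\<^sup>3 t cos t (sin\<^sup>2 t + cos\<^sup>2 t)\<close>, and the products with
  \<open>d\<eta>\<close> are exterior derivatives because \<open>\<eta> \<and> d\<omega>\<^sub>1 = 0\<close> and \<open>d\<omega>\<^sub>3 = 0\<close>.\<close>

lemma wedge_ext_d_cone_F:
  assumes x: "x \<in> U"
    and d1: "ext_d (\<omega> 1) i x = (\<lambda>vs. 3 * wedge (\<eta> i x) (\<omega> 2 i x) vs)"
    and d3: "ext_d (\<omega> 3) i x = (\<lambda>vs. 0)"
  defines "\<nu> \<equiv> \<lambda>t vs. sin t ^ 3 * cos t * (2 * wedge (\<omega> 1 i x) (\<omega> 1 i x) vs + ext_d (\<eta> \<and>\<^sub>f \<omega> 3) i x vs)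
      + sin t ^ 4 * ext_d (\<eta> \<and>\<^sub>f \<omega> 1) i x vs"
  shows "wedge (ext_d (cone_F \<eta> \<omega>) i (x, t)) (cone_F \<eta> \<omega> i (x, t))
      [(a, \<tau>a), (b, \<tau>b), (c, \<tau>c), (d, \<tau>d), (e, \<tau>e)] =
    \<tau>a * \<nu> t [b, c, d, e] - \<tau>b * \<nu> t [a, c, d, e] + \<tau>c * \<nu> t [a, b, d, e] - \<tau>d * \<nu> t [a, b, c, e]
    + \<tau>e * \<nu> t [a, b, c, d]"
proof -
  define s k where "s = sin t" and "k = cos t"
  define h w1 w2 w3 dh where "h = \<eta> i x" and "w1 = \<omega> 1 i x" and "w2 = \<omega> 2 i x" and "w3 = \<omega> 3 i x"
    and "dh = ext_d \<eta> i x"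
  note abbr = s_def[symmetric] k_def[symmetric] h_def[symmetric] w1_def[symmetric] w2_def[symmetric]
    w3_def[symmetric] dh_def[symmetric]
  note hom = homogeneous_fields[OF x, unfolded abbr] homogeneous_ext_d_fields(1)[OF x, unfolded abbr]
  define \<rho> where "\<rho> = (\<lambda>vs. (3 * s ^ 3) * wedge h w2 vs)"
  define \<phi> where "\<phi> = (\<lambda>vs. s ^ 3 * w1 vs + s\<^sup>2 * k * w3 vs)"
  define \<sigma> where "\<sigma> = (\<lambda>vs. 3 * s\<^sup>2 * k * w1 vs + (2 * s * k\<^sup>2 - s ^ 3) * w3 vs + s * dh vs)"
  have \<sigma>: "dF_radial x t = \<sigma>" by (rule ext) (simp add: dF_radial_def \<sigma>_def s_def k_def w1_def w3_def dh_def)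
  have sk: "k\<^sup>2 = 1 - s\<^sup>2" by (simp add: s_def k_def cos_squared_eq)
  have w31: "wedge w3 w1 = (\<lambda>vs. 0)" "wedge w2 w1 = (\<lambda>vs. 0)"
    using orth[OF x, unfolded abbr] wedge_2_2_commute[OF hom(4,2)] wedge_2_2_commute[OF hom(3,2)] by simp_all
  note prods = orth[OF x, unfolded abbr] w31 squares[OF x, unfolded abbr]
  \<comment> \<open>the component without \<open>dt\<close>: associativity reduces it to \<open>\<omega>\<^sub>2 \<and> \<phi> = 0\<close>\<close>
  have "wedge w2 \<phi> = (\<lambda>vs. 0)"
    by (rule ext) (simp add: \<phi>_def wedge_add_right wedge_scale_right prods)
  moreover have h\<phi>: "homogeneous 2 \<phi>" using hom by (simp add: \<phi>_def homogeneous_def)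
  ultimately have \<rho>\<phi>: "wedge \<rho> \<phi> [a, b, c, d, e] = 0" for a b c d e
    by (simp add: \<rho>_def wedge_scale_left wedge_assoc_1_2_2[OF hom(1,3)] wedge_zero_right)
  have dE3: "ext_d (\<eta> \<and>\<^sub>f \<omega> 3) i x = (\<lambda>vs. wedge dh w3 vs)"
    using ext_d_wedge_1_2[of U x \<eta> i "\<omega> 3", OF open_U x sm(1,4)]
    by (simp add: d3 abbr wedge_zero_right)
  have dE1: "ext_d (\<eta> \<and>\<^sub>f \<omega> 1) i x [a, b, c, d] = wedge dh w1 [a, b, c, d]" for a b c d
    using ext_d_wedge_1_2[of U x \<eta> i "\<omega> 1", OF open_U x sm(1,2)]
    by (simp add: d1[unfolded One_nat_def] abbr[unfolded One_nat_def] wedge_scale_right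
        wedge_1_1_2_zero[OF hom(1,3)])
  have \<nu>: "wedge \<sigma> \<phi> [a, b, c, d] + s * wedge \<rho> h [a, b, c, d] = \<nu> t [a, b, c, d]" for a b c d
  proof -
    let ?v = "wedge w1 w1 [a, b, c, d]" and ?d1 = "wedge dh w1 [a, b, c, d]" and ?d3 = "wedge dh w3 [a, b, c, d]"
    have "wedge \<sigma> \<phi> [a, b, c, d] + s * wedge \<rho> h [a, b, c, d] =
      (3 * s\<^sup>2 * k * s ^ 3 + (2 * s * k\<^sup>2 - s ^ 3) * (s\<^sup>2 * k)) * ?v + s * (s ^ 3) * ?d1 + s * (s\<^sup>2 * k) * ?d3"
      unfolding \<sigma>_def \<phi>_def \<rho>_def wedge_add_left wedge_add_right wedge_scale_left wedge_scale_right prods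
        wedge_1_2_1_zero[OF hom(1,3)]
      by (simp add: algebra_simps)
    also have "3 * s\<^sup>2 * k * s ^ 3 + (2 * s * k\<^sup>2 - s ^ 3) * (s\<^sup>2 * k) = 2 * s ^ 3 * k"
      unfolding sk by algebra
    finally show ?thesis
      unfolding \<nu>_def dE3 dE1 by (simp add: abbr[unfolded One_nat_def] power2_eq_square power3_eq_cube
          power4_eq_xxxx algebra_simps)
  qed
  have "wedge (ext_d (cone_F \<eta> \<omega>) i (x, t)) (cone_F \<eta> \<omega> i (x, t))
      [(a, \<tau>a), (b, \<tau>b), (c, \<tau>c), (d, \<tau>d), (e, \<tau>e)] = wedge \<rho> \<phi> [a, b, c, d, e]
    + \<tau>a * (wedge \<sigma> \<phi> [b, c, d, e] + s * wedge \<rho> h [b, c, d, e])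
    - \<tau>b * (wedge \<sigma> \<phi> [a, c, d, e] + s * wedge \<rho> h [a, c, d, e])
    + \<tau>c * (wedge \<sigma> \<phi> [a, b, d, e] + s * wedge \<rho> h [a, b, d, e])
    - \<tau>d * (wedge \<sigma> \<phi> [a, b, c, e] + s * wedge \<rho> h [a, b, c, e])
    + \<tau>e * (wedge \<sigma> \<phi> [a, b, c, d] + s * wedge \<rho> h [a, b, c, d])"
  proof (rule wedge_3_2_cone)
    show "homogeneous 3 (ext_d (cone_F \<eta> \<omega>) i (x, t))" by (rule homogeneous_ext_d_cone(1)[OF x])
    show "homogeneous 2 (cone_F \<eta> \<omega> i (x, t))"
      by (rule homogeneous_cone_structure(1)[of \<eta> i x \<omega> t, OF homogeneous_fields(1-4)[OF x]])
    show "homogeneous 3 \<rho>" "homogeneous 2 \<sigma>" using hom by (simp_all add: \<rho>_def \<sigma>_def homogeneous_def)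
    show "homogeneous 2 \<phi>" by fact
    show "homogeneous 1 h" by (rule hom(1))
    show "ext_d (cone_F \<eta> \<omega>) i (x, t) [(a, \<tau>a), (b, \<tau>b), (c, \<tau>c)] =
      \<rho> [a, b, c] + \<tau>a * \<sigma> [b, c] - \<tau>b * \<sigma> [a, c] + \<tau>c * \<sigma> [a, b]" for a \<tau>a b \<tau>b c \<tau>c
      unfolding ext_d_cone_F[OF x] \<sigma> d1 d3 by (simp add: \<rho>_def abbr)
    show "cone_F \<eta> \<omega> i (x, t) [(a, \<tau>a), (b, \<tau>b)] = \<phi> [a, b] + s * (h [a] * \<tau>b - h [b] * \<tau>a)"
      for a \<tau>a b \<tau>b
      using cone_F_apply[of \<eta> i x \<omega> t, OF homogeneous_fields(1-4)[OF x]]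
      by (simp add: \<phi>_def abbr[unfolded One_nat_def])
  qed
  then show ?thesis unfolding \<rho>\<phi> \<nu> by simp
qed

text \<open>The equations on the sin-cone are polynomial in \<open>sin t\<close> and \<open>cos t\<close> and are separated by two values of \<open>t\<close>:
  at \<open>\<pi>/2\<close> the terms with \<open>cos t\<close> drop out, and at \<open>\<pi>/4\<close> both functions are nonzero.\<close>

lemma half_flat_equations_iff:
  assumes x: "x \<in> U"
  shows "(\<forall>t\<in>{0<..<pi}. wedge (ext_d (cone_F \<eta> \<omega>) i (x, t)) (cone_F \<eta> \<omega> i (x, t)) = (\<lambda>vs. 0) \<and>
      ext_d (cone_Psi_plus \<eta> \<omega>) i (x, t) = (\<lambda>vs. 0)) \<longleftrightarrow>
    ext_d (\<omega> 1) i x = (\<lambda>vs. 3 * wedge (\<eta> i x) (\<omega> 2 i x) vs) \<and>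
    ext_d (\<eta> \<and>\<^sub>f \<omega> 3) i x = (\<lambda>vs. - 2 * wedge (\<omega> 1 i x) (\<omega> 1 i x) vs) \<and>
    ext_d (\<omega> 3) i x = (\<lambda>vs. 0) \<and> ext_d (\<eta> \<and>\<^sub>f \<omega> 1) i x = (\<lambda>vs. 0) \<and>
    ext_d (\<eta> \<and>\<^sub>f \<omega> 2) i x = (\<lambda>vs. 0)" (is "?flat \<longleftrightarrow> ?dh")
proof
  have h4: "homogeneous 4 (ext_d (\<eta> \<and>\<^sub>f \<omega> p) i x)" if "p = 1 \<or> p = 2 \<or> p = 3" for p
  proof -
    have "homogeneous 3 ((\<eta> \<and>\<^sub>f \<omega> p) i y)" if "y \<in> U" for y
      unfolding form_wedge_def using homogeneous_fields(1-4)[OF that] \<open>p = 1 \<or> p = 2 \<or> p = 3\<close>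
      by (intro homogeneous_wedge[of 1 _ 2]) auto
    then show ?thesis
      using homogeneous_ext_d[OF open_U x, of 3 "\<eta> \<and>\<^sub>f \<omega> p" i] by (simp add: numeral_eq_Suc)
  qed
  {
    assume ?flat
    then have F: "wedge (ext_d (cone_F \<eta> \<omega>) i (x, t)) (cone_F \<eta> \<omega> i (x, t)) vs = 0"
      and P: "ext_d (cone_Psi_plus \<eta> \<omega>) i (x, t) vs = 0" if "0 < t" "t < pi" for t vs
      using that by auto
    have quarter: "0 < pi / 4" "pi / 4 < pi" "sin (pi / 4) \<noteq> 0" "cos (pi / 4) \<noteq> 0"
      by (simp_all add: sin_45 cos_45)
    have half: "0 < pi / 2" "pi / 2 < pi" by simp_all
    have dE: "ext_d (\<eta> \<and>\<^sub>f \<omega> 2) i x [a, b, c, d] = 0" for a b c d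
      using P[OF half, of "[(a, 0), (b, 0), (c, 0), (d, 0)]"] unfolding ext_d_cone_Psi_plus[OF x] by simp
    \<comment> \<open>the list \<open>[\<partial>\<^sub>t, a, b, c]\<close> picks out the coefficient of \<open>dt\<close>\<close>
    have kap: "dPsi_radial x t [a, b, c] = 0" if "0 < t" "t < pi" for t a b c
      using P[OF that, of "[(0, 1), (a, 0), (b, 0), (c, 0)]"] unfolding ext_d_cone_Psi_plus[OF x] dE by simp
    have d3: "ext_d (\<omega> 3) i x = (\<lambda>vs. 0)"
    proof (rule homogeneous_eqI[OF homogeneous_ext_d_fields(3)[OF x]])
      show "ext_d (\<omega> 3) i x vs = 0" if "length vs = 3" for vs
        using that kap[OF half] by (auto simp: length_3_conv dPsi_radial_def)
    qed (simp add: homogeneous_def)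
    have d1: "ext_d (\<omega> 1) i x = (\<lambda>vs. 3 * wedge (\<eta> i x) (\<omega> 2 i x) vs)"
    proof (rule homogeneous_eqI[OF homogeneous_ext_d_fields(2)[OF x]])
      show "ext_d (\<omega> 1) i x vs = 3 * wedge (\<eta> i x) (\<omega> 2 i x) vs" if "length vs = 3" for vs
        using that kap[OF quarter(1,2)] quarter(3,4) by (auto simp: length_3_conv dPsi_radial_def d3)
      show "homogeneous 3 (\<lambda>vs. 3 * wedge (\<eta> i x) (\<omega> 2 i x) vs)"
        using homogeneous_fields(5)[OF x] by (simp add: homogeneous_def)
    qed
    note nu = wedge_ext_d_cone_F[OF x d1 d3]
    have n1: "ext_d (\<eta> \<and>\<^sub>f \<omega> 1) i x [a, b, c, d] = 0" for a b c d
      using F[OF half, of "[(0, 1), (a, 0), (b, 0), (c, 0), (d, 0)]"] unfolding nu by simp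
    have n3: "2 * wedge (\<omega> 1 i x) (\<omega> 1 i x) [a, b, c, d] + ext_d (\<eta> \<and>\<^sub>f \<omega> 3) i x [a, b, c, d] = 0" for a b c d
      using F[OF quarter(1,2), of "[(0, 1), (a, 0), (b, 0), (c, 0), (d, 0)]"] quarter(3,4)
      unfolding nu n1 by simp
    have "ext_d (\<eta> \<and>\<^sub>f \<omega> 1) i x = (\<lambda>vs. 0)"
      by (rule homogeneous_eqI[OF h4]) (auto simp: n1[unfolded One_nat_def] length_4_conv homogeneous_def)
    moreover have "ext_d (\<eta> \<and>\<^sub>f \<omega> 2) i x = (\<lambda>vs. 0)"
      by (rule homogeneous_eqI[OF h4]) (auto simp: dE length_4_conv homogeneous_def)
    moreover have "ext_d (\<eta> \<and>\<^sub>f \<omega> 3) i x = (\<lambda>vs. - 2 * wedge (\<omega> 1 i x) (\<omega> 1 i x) vs)"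
    proof (rule homogeneous_eqI[OF h4])
      have "homogeneous 4 (wedge (\<omega> 1 i x) (\<omega> 1 i x))"
        by (rule homogeneous_wedge[OF homogeneous_fields(2)[OF x] homogeneous_fields(2)[OF x]]) simp
      then show "homogeneous 4 (\<lambda>vs. - 2 * wedge (\<omega> 1 i x) (\<omega> 1 i x) vs)" by (simp add: homogeneous_def)
      show "ext_d (\<eta> \<and>\<^sub>f \<omega> 3) i x vs = - 2 * wedge (\<omega> 1 i x) (\<omega> 1 i x) vs" if "length vs = 4" for vs
      proof -
        obtain a b c d where "vs = [a, b, c, d]" using \<open>length vs = 4\<close> by (auto simp: length_4_conv)
        then show ?thesis using n3[of a b c d] by simp
      qed
    qed simp
    ultimately show ?dh using d1 d3 by blast
  next
    assume dh: ?dh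
    then have d1: "ext_d (\<omega> 1) i x = (\<lambda>vs. 3 * wedge (\<eta> i x) (\<omega> 2 i x) vs)"
      and d3: "ext_d (\<omega> 3) i x = (\<lambda>vs. 0)" by blast+
    show ?flat
    proof (intro ballI conjI)
      fix t
      show "wedge (ext_d (cone_F \<eta> \<omega>) i (x, t)) (cone_F \<eta> \<omega> i (x, t)) = (\<lambda>vs. 0)"
      proof (rule homogeneous_eqI[of 5])
        show "homogeneous 5 (wedge (ext_d (cone_F \<eta> \<omega>) i (x, t)) (cone_F \<eta> \<omega> i (x, t)))"
          by (rule homogeneous_wedge[OF homogeneous_ext_d_cone(1)[OF x]
                homogeneous_cone_structure(1)[of \<eta> i x \<omega> t, OF homogeneous_fields(1-4)[OF x]]]) simp
        show "wedge (ext_d (cone_F \<eta> \<omega>) i (x, t)) (cone_F \<eta> \<omega> i (x, t)) vs = 0" if "length vs = 5" for vs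
        proof -
          obtain a \<tau>a b \<tau>b c \<tau>c d \<tau>d e \<tau>e where "vs = [(a, \<tau>a), (b, \<tau>b), (c, \<tau>c), (d, \<tau>d), (e, \<tau>e)]"
            using \<open>length vs = 5\<close> by (auto simp: length_5_conv)
          then show ?thesis using dh by (simp only: wedge_ext_d_cone_F[OF x d1 d3]) simp
        qed
      qed (simp add: homogeneous_def)
      show "ext_d (cone_Psi_plus \<eta> \<omega>) i (x, t) = (\<lambda>vs. 0)"
      proof (rule homogeneous_eqI[OF homogeneous_ext_d_cone(2)[OF x]])
        show "ext_d (cone_Psi_plus \<eta> \<omega>) i (x, t) vs = 0" if "length vs = 4" for vs
        proof -
          obtain a \<tau>a b \<tau>b c \<tau>c d \<tau>d where "vs = [(a, \<tau>a), (b, \<tau>b), (c, \<tau>c), (d, \<tau>d)]"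
            using \<open>length vs = 4\<close> by (auto simp: length_4_conv)
          then show ?thesis using dh by (simp only: ext_d_cone_Psi_plus[OF x] dPsi_radial_def) simp
        qed
      qed (simp add: homogeneous_def)
    qed
  }
qed

text \<open>The equation \<open>d(\<eta> \<and> \<omega>\<^sub>2) = 0\<close> is the integrability condition of \<open>d\<omega>\<^sub>1 = 3 \<eta> \<and> \<omega>\<^sub>2\<close>.\<close>

lemma ext_d_wedge_2_zero:
  assumes x: "x \<in> U" and d1: "\<And>y. y \<in> U \<Longrightarrow> ext_d (\<omega> 1) i y = (3 *\<^sub>f (\<eta> \<and>\<^sub>f \<omega> 2)) i y"
  shows "ext_d (\<eta> \<and>\<^sub>f \<omega> 2) i x = (\<lambda>vs. 0)"
proof
  fix vs
  have "smooth_on U (\<lambda>y. (\<eta> \<and>\<^sub>f \<omega> 2) i y vs)" for vs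
    unfolding form_wedge_def
    by (rule smooth_covector_fieldD(2)[OF smooth_covector_field_wedge(2)[OF open_U sm(1,3)]])
  then have "3 * ext_d (\<eta> \<and>\<^sub>f \<omega> 2) i x vs = ext_d (3 *\<^sub>f (\<eta> \<and>\<^sub>f \<omega> 2)) i x vs"
    using ext_d_scale[of x U "\<eta> \<and>\<^sub>f \<omega> 2" i 3 vs] x by simp
  also have "\<dots> = ext_d (ext_d (\<omega> 1)) i x vs"
    using ext_d_cong[OF open_U x, of "ext_d (\<omega> 1)" i "3 *\<^sub>f (\<eta> \<and>\<^sub>f \<omega> 2)"] d1 by simp
  also have "\<dots> = 0" by (simp only: ext_d_ext_d_2[of U x "\<omega> 1" i, OF open_U x sm(2)])
  finally show "ext_d (\<eta> \<and>\<^sub>f \<omega> 2) i x vs = 0" by simp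
qed

end

section \<open>The SU(3)-structure of the sin-cone\<close>

text \<open>The 2-forms \<open>sin t \<omega>\<^sub>1 + cos t \<omega>\<^sub>3\<close>, \<open>\<omega>\<^sub>2\<close>, \<open>- cos t \<omega>\<^sub>1 + sin t \<omega>\<^sub>3\<close> arise from \<open>\<omega>\<^sub>1, \<omega>\<^sub>2, \<omega>\<^sub>3\<close> by a
  rotation, and a coframe adapted to them arises by the same rotation of \<open>e\<^sup>2\<close> and \<open>e\<^sup>4\<close>. The
  factor \<open>sin t\<close> is the radius of the cone.\<close>

definition cone_coframe ::
  "('i, 'e) form \<Rightarrow> 'i \<Rightarrow> (nat \<Rightarrow> 'e \<Rightarrow> 'e list \<Rightarrow> real) \<Rightarrow> nat \<Rightarrow> 'e \<times> real \<Rightarrow> ('e \<times> real) list \<Rightarrow> real" where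
  "cone_coframe \<eta> i f j y vs =
     (let s = sin (snd y); c = cos (snd y); g = (\<lambda>j. f j (fst y) (map fst vs)) in
      if j = 1 then s * g 1
      else if j = 2 then s * (s * g 2 + c * g 4)
      else if j = 3 then s * g 3
      else if j = 4 then s * (s * g 4 - c * g 2)
      else if j = 5 then s * \<eta> i (fst y) (map fst vs)
      else cone_dt i y vs)"

lemma interval_1_6: "{1..6} = {1, 2, 3, 4, 5, 6::nat}"
  by auto

text \<open>A vanishing linear combination is tested on \<open>\<partial>\<^sub>t\<close> and on vectors tangent to \<open>N\<close>; this leaves a
  relation of the adapted coframe, from which the rotation is removed at the end.\<close>

lemma coframe_on_cone_coframe:
  fixes \<eta> :: "('i, 'e::euclidean_space) form"
  assumes dim: "DIM('e) = 5" and V: "open V"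
    and \<eta>: "smooth_covector_field 1 V (\<eta> i)"
    and f: "\<And>j. j \<in> {1, 2, 3, 4} \<Longrightarrow> smooth_covector_field 1 V (f j)"
    and ad: "\<And>y. y \<in> V \<Longrightarrow> adapted_coframe (\<eta> i y) (p y) (q y) (r y) (\<lambda>j. f j y)"
  shows "coframe_on (V \<times> {0<..<pi}) (cone_coframe \<eta> i f)"
proof -
  let ?V = "V \<times> {0<..<pi}"
  have oV: "open ?V" using V by (simp add: open_Times)
  have pull: "smooth_covector_field 1 ?V (\<lambda>y vs. \<alpha> (fst y) (map fst vs))"
    if "smooth_covector_field 1 V \<alpha>" for \<alpha>
    by (rule smooth_covector_field_pull[OF that oV]) auto
  have trig: "smooth_on ?V (\<lambda>y. sin (snd y))" "smooth_on ?V (\<lambda>y. cos (snd y))"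
    by (intro smooth_intros smooth_on_snd oV)+
  note fs = f[of 1] f[of 2] f[of 3] f[of 4]
  note intros = smooth_covector_field_add[OF oV] pull trig
  have E: "cone_coframe \<eta> i f 1 = (\<lambda>y vs. sin (snd y) * f 1 (fst y) (map fst vs))"
    "cone_coframe \<eta> i f 2 = (\<lambda>y vs. sin (snd y) * (sin (snd y) * f 2 (fst y) (map fst vs)
        + cos (snd y) * f 4 (fst y) (map fst vs)))"
    "cone_coframe \<eta> i f 3 = (\<lambda>y vs. sin (snd y) * f 3 (fst y) (map fst vs))"
    "cone_coframe \<eta> i f 4 = (\<lambda>y vs. sin (snd y) * (sin (snd y) * f 4 (fst y) (map fst vs)
        - cos (snd y) * f 2 (fst y) (map fst vs)))"
    "cone_coframe \<eta> i f 5 = (\<lambda>y vs. sin (snd y) * \<eta> i (fst y) (map fst vs))"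
    "cone_coframe \<eta> i f 6 = cone_dt i"
    by (auto simp: cone_coframe_def Let_def fun_eq_iff)
  have "smooth_covector_field 1 ?V (cone_coframe \<eta> i f j)" if "j \<in> {1..6}" for j
  proof -
    have "smooth_covector_field 1 ?V (cone_coframe \<eta> i f 1)" "smooth_covector_field 1 ?V (cone_coframe \<eta> i f 2)"
      "smooth_covector_field 1 ?V (cone_coframe \<eta> i f 3)" "smooth_covector_field 1 ?V (cone_coframe \<eta> i f 4)"
      "smooth_covector_field 1 ?V (cone_coframe \<eta> i f 5)" "smooth_covector_field 1 ?V (cone_coframe \<eta> i f 6)"
      unfolding E by (intro intros fs \<eta> smooth_covector_field_dt oV; simp)+
    then show ?thesis using that unfolding interval_1_6 by blast
  qed
  moreover have "c j = 0" if y: "y \<in> ?V" and j: "j \<in> {1..6}"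
    and eq: "\<And>vs. (\<Sum>j=1..6. c j * cone_coframe \<eta> i f j y vs) = 0" for y j and c :: "nat \<Rightarrow> real"
  proof -
    obtain x t where xt: "y = (x, t)" "x \<in> V" "0 < t" "t < pi" using y by auto
    define s k where "s = sin t" and "k = cos t"
    have s: "s \<noteq> 0" using xt sin_gt_zero by (force simp: s_def)
    have sk: "s * s + k * k = 1"
      using sin_cos_squared_add[of t] by (simp add: s_def k_def power2_eq_square)
    have eqs: "c 1 * (s * f 1 x (map fst vs)) + c 2 * (s * (s * f 2 x (map fst vs) + k * f 4 x (map fst vs)))
      + c 3 * (s * f 3 x (map fst vs)) + c 4 * (s * (s * f 4 x (map fst vs) - k * f 2 x (map fst vs)))
      + c 5 * (s * \<eta> i x (map fst vs)) + c 6 * cone_dt i (x, t) vs = 0" for vs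
      using eq[of vs] unfolding interval_1_6 xt(1) by (simp add: cone_coframe_def Let_def s_def k_def)
    have zero: "f j x [0] = 0" if "j \<in> {1, 2, 3, 4}" for j
      using linear_0[OF covector_1_linear[OF smooth_covector_fieldD(1)[OF f[OF that] xt(2)]]] .
    have z\<eta>: "\<eta> i x [0] = 0"
      using linear_0[OF covector_1_linear[OF smooth_covector_fieldD(1)[OF \<eta> xt(2)]]] .
    have c6: "c 6 = 0"
      using eqs[of "[(0, 1)]"] zero[of 1] zero[of 2] zero[of 3] zero[of 4] z\<eta> by (simp add: cone_dt_def)
    have "s * c 1 * f 1 x [u] + s * (s * c 2 - k * c 4) * f 2 x [u] + s * c 3 * f 3 x [u]
      + s * (k * c 2 + s * c 4) * f 4 x [u] + s * c 5 * \<eta> i x [u] = 0" for u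
      using eqs[of "[(u, 0)]"] unfolding c6 by (simp add: algebra_simps)
    then have "s * c 1 = 0 \<and> s * (s * c 2 - k * c 4) = 0 \<and> s * c 3 = 0 \<and> s * (k * c 2 + s * c 4) = 0
      \<and> s * c 5 = 0"
      using ad[OF xt(2)] unfolding adapted_coframe_def by blast
    then have cs: "c 1 = 0" "s * c 2 - k * c 4 = 0" "c 3 = 0" "k * c 2 + s * c 4 = 0" "c 5 = 0"
      using s by auto
    \<comment> \<open>undoing the rotation\<close>
    have "c 2 = s * (s * c 2 - k * c 4) + k * (k * c 2 + s * c 4)"
      "c 4 = s * (k * c 2 + s * c 4) - k * (s * c 2 - k * c 4)"
      using sk by algebra+
    then have "c 2 = 0" "c 4 = 0" unfolding cs(2,4) by simp_all
    then show ?thesis using cs c6 j unfolding interval_1_6 by auto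
  qed
  ultimately show ?thesis
    using dim by (auto simp: coframe_on_def)
qed

context su2_chart
begin

text \<open>For the complex volume form, \<open>(e\<^sup>1 + i e\<^sup>2) \<and> (e\<^sup>3 + i e\<^sup>4)\<close> equals
  \<open>sin\<^sup>2 t (\<omega>\<^sub>2 + i (- cos t \<omega>\<^sub>1 + sin t \<omega>\<^sub>3))\<close>; its product with \<open>sin t \<eta> + i dt\<close> has real part
  \<open>\<Psi>\<^sub>+\<close> and imaginary part \<open>\<Psi>\<^sub>-\<close>.\<close>

lemma local_su3_coframe:
  assumes x: "x \<in> U" and t: "t \<in> {0<..<pi}"
  shows "\<exists>V e. open V \<and> (x, t) \<in> V \<and> V \<subseteq> U \<times> {0<..<pi} \<and> coframe_on V e \<and>
    (\<forall>y\<in>V. cone_F \<eta> \<omega> i y = (\<lambda>vs. wedge (e 1 y) (e 2 y) vs + wedge (e 3 y) (e 4 y) vs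
                           + wedge (e 5 y) (e 6 y) vs) \<and>
       cplx_covector (cone_Psi_plus \<eta> \<omega> i y) (cone_Psi_minus \<eta> \<omega> i y) =
         wedge (wedge (cplx_covector (e 1 y) (e 2 y)) (cplx_covector (e 3 y) (e 4 y)))
               (cplx_covector (e 5 y) (e 6 y)))"
proof -
  obtain W f where W: "open W" "x \<in> W" "W \<subseteq> U"
    and f: "\<And>j. j \<in> {1, 2, 3, 4} \<Longrightarrow> smooth_covector_field 1 W (f j)"
    and ad: "\<And>y. y \<in> W \<Longrightarrow> adapted_coframe (\<eta> i y) (\<omega> 1 i y) (\<omega> 2 i y) (\<omega> 3 i y) (\<lambda>j. f j y)"
    using local_adapted_coframe[OF dim open_U x sm squares orth orient nz[OF x]] by metis
  define E where "E = cone_coframe \<eta> i f"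
  have sm\<eta>: "smooth_covector_field 1 W (\<eta> i)"
    using sm(1) W(3) smooth_on_subset unfolding smooth_covector_field_def by blast
  have cof: "coframe_on (W \<times> {0<..<pi}) E"
    unfolding E_def by (rule coframe_on_cone_coframe[where p = "\<omega> 1 i" and q = "\<omega> 2 i" and r = "\<omega> 3 i"])
      (use dim W f ad sm\<eta> in auto)
  have eqs: "cone_F \<eta> \<omega> i (z, \<tau>) = (\<lambda>vs. wedge (E 1 (z, \<tau>)) (E 2 (z, \<tau>)) vs
        + wedge (E 3 (z, \<tau>)) (E 4 (z, \<tau>)) vs + wedge (E 5 (z, \<tau>)) (E 6 (z, \<tau>)) vs) \<and>
      cplx_covector (cone_Psi_plus \<eta> \<omega> i (z, \<tau>)) (cone_Psi_minus \<eta> \<omega> i (z, \<tau>)) =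
        wedge (wedge (cplx_covector (E 1 (z, \<tau>)) (E 2 (z, \<tau>))) (cplx_covector (E 3 (z, \<tau>)) (E 4 (z, \<tau>))))
          (cplx_covector (E 5 (z, \<tau>)) (E 6 (z, \<tau>)))"
    if z: "z \<in> W" "0 < \<tau>" "\<tau> < pi" for z \<tau>
  proof -
    have zU: "z \<in> U" using z W by auto
    define s k where "s = sin \<tau>" and "k = cos \<tau>"
    have sk: "s * s + k * k = 1"
      using sin_cos_squared_add[of \<tau>] by (simp add: s_def k_def power2_eq_square)
    define F1 F2 F3 F4 where "F1 = f 1 z" and "F2 = f 2 z" and "F3 = f 3 z" and "F4 = f 4 z"
    define h where "h = \<eta> i z"
    note homz = homogeneous_fields[OF zU]
    have cs: "homogeneous 2 (cone_F \<eta> \<omega> i (z, \<tau>))" "homogeneous 3 (cone_Psi_plus \<eta> \<omega> i (z, \<tau>))"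
      "homogeneous 3 (cone_Psi_minus \<eta> \<omega> i (z, \<tau>))"
      using homogeneous_cone_structure[of \<eta> i z \<omega> \<tau>, OF homz(1-4)] .
    have homf: "homogeneous 1 (f j z)" if "j \<in> {1, 2, 3, 4}" for j
      by (rule covector_homogeneous[OF smooth_covector_fieldD(1)[OF f[OF that] z(1)]])
    have hF: "homogeneous 1 F1" "homogeneous 1 F2" "homogeneous 1 F3" "homogeneous 1 F4"
      unfolding F1_def F2_def F3_def F4_def by (rule homf; simp)+
    have "\<omega> 1 i z = (\<lambda>vs. wedge F1 F2 vs + wedge F3 F4 vs)"
      "\<omega> 2 i z = (\<lambda>vs. wedge F1 F3 vs - wedge F2 F4 vs)"
      "\<omega> 3 i z = (\<lambda>vs. wedge F1 F4 vs + wedge F2 F3 vs)"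
      using ad[OF z(1)] unfolding adapted_coframe_def F1_def F2_def F3_def F4_def by blast+
    then have w: "\<omega> 1 i z [a, b] = F1 [a] * F2 [b] - F1 [b] * F2 [a] + (F3 [a] * F4 [b] - F3 [b] * F4 [a])"
      "\<omega> 2 i z [a, b] = F1 [a] * F3 [b] - F1 [b] * F3 [a] - (F2 [a] * F4 [b] - F2 [b] * F4 [a])"
      "\<omega> 3 i z [a, b] = F1 [a] * F4 [b] - F1 [b] * F4 [a] + (F2 [a] * F3 [b] - F2 [b] * F3 [a])" for a b
      by (simp_all only: wedge_1_1[OF hF(1,2)] wedge_1_1[OF hF(3,4)] wedge_1_1[OF hF(1,3)]
          wedge_1_1[OF hF(2,4)] wedge_1_1[OF hF(1,4)] wedge_1_1[OF hF(2,3)])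
    have e: "E 1 (z, \<tau>) [(a, \<sigma>)] = s * F1 [a]" "E 2 (z, \<tau>) [(a, \<sigma>)] = s * (s * F2 [a] + k * F4 [a])"
      "E 3 (z, \<tau>) [(a, \<sigma>)] = s * F3 [a]" "E 4 (z, \<tau>) [(a, \<sigma>)] = s * (s * F4 [a] - k * F2 [a])"
      "E 5 (z, \<tau>) [(a, \<sigma>)] = s * h [a]" "E 6 (z, \<tau>) [(a, \<sigma>)] = \<sigma>" for a \<sigma>
      by (simp_all add: E_def cone_coframe_def F1_def F2_def F3_def F4_def h_def s_def k_def cone_dt_def Let_def)
    have homE: "homogeneous 1 (E j (z, \<tau>))" for j
      using hF homz(1) unfolding E_def cone_coframe_def F1_def F2_def F3_def F4_def
      by (auto simp: homogeneous_def cone_dt_def Let_def)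
    have homC: "homogeneous 1 (cplx_covector (E i (z, \<tau>)) (E j (z, \<tau>)))" for i j
      using homE by (simp add: homogeneous_def cplx_covector_def zero_complex.code)
    let ?Z = "wedge (cplx_covector (E 1 (z, \<tau>)) (E 2 (z, \<tau>))) (cplx_covector (E 3 (z, \<tau>)) (E 4 (z, \<tau>)))"
    have homZ: "homogeneous 2 ?Z" by (rule homogeneous_wedge[OF homC homC]) simp
    have w2: "homogeneous 2 (wedge (E j (z, \<tau>)) (E l (z, \<tau>)))" for j l
      by (rule homogeneous_wedge[OF homE homE]) simp
    have F: "cone_F \<eta> \<omega> i (z, \<tau>) = (\<lambda>vs. wedge (E 1 (z, \<tau>)) (E 2 (z, \<tau>)) vs
        + wedge (E 3 (z, \<tau>)) (E 4 (z, \<tau>)) vs + wedge (E 5 (z, \<tau>)) (E 6 (z, \<tau>)) vs)" (is "_ = ?R")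
    proof (rule homogeneous_eqI[OF cs(1)])
      show "homogeneous 2 ?R" using w2 by (simp add: homogeneous_def)
      have "cone_F \<eta> \<omega> i (z, \<tau>) [(a, \<alpha>), (b, \<beta>)] = ?R [(a, \<alpha>), (b, \<beta>)]" for a \<alpha> b \<beta>
        unfolding cone_F_apply[of \<eta> i z \<omega>, OF homz(1-4)] wedge_1_1[OF homE homE] e w
          s_def[symmetric] k_def[symmetric] h_def[symmetric]
        by (simp add: power2_eq_square power3_eq_cube algebra_simps)
      then show "cone_F \<eta> \<omega> i (z, \<tau>) vs = ?R vs" if "length vs = 2" for vs
        using that by (auto simp: length_2_conv)
    qed
    have Z: "?Z [(a, \<alpha>), (b, \<beta>)] =
        Complex (s\<^sup>2 * \<omega> 2 i z [a, b]) (s\<^sup>2 * (- k * \<omega> 1 i z [a, b] + s * \<omega> 3 i z [a, b]))" for a \<alpha> b \<beta>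
    proof -
      have "?Z [(a, \<alpha>), (b, \<beta>)] = Complex (s\<^sup>2 * (F1 [a] * F3 [b] - F1 [b] * F3 [a]
            - (s * s + k * k) * (F2 [a] * F4 [b] - F2 [b] * F4 [a])))
          (s\<^sup>2 * (- k * \<omega> 1 i z [a, b] + s * \<omega> 3 i z [a, b]))"
        unfolding wedge_1_1[OF homC homC] unfolding cplx_covector_def e w
        by (simp add: complex_eq_iff power2_eq_square algebra_simps)
      then show ?thesis by (simp only: sk w) simp
    qed
    have "cplx_covector (cone_Psi_plus \<eta> \<omega> i (z, \<tau>)) (cone_Psi_minus \<eta> \<omega> i (z, \<tau>)) =
        wedge ?Z (cplx_covector (E 5 (z, \<tau>)) (E 6 (z, \<tau>)))" (is "?L = ?R")
    proof (rule homogeneous_eqI[of 3])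
      show "homogeneous 3 ?L"
        using cs(2,3) by (simp add: homogeneous_def cplx_covector_def zero_complex.code)
      show "homogeneous 3 ?R" by (rule homogeneous_wedge[OF homZ homC]) simp
      have "?L [(a, \<alpha>), (b, \<beta>), (c, \<gamma>)] = ?R [(a, \<alpha>), (b, \<beta>), (c, \<gamma>)]" for a \<alpha> b \<beta> c \<gamma>
        unfolding wedge_2_1[OF homZ homC] Z
        unfolding cplx_covector_def e
          cone_Psi_plus_apply[of \<eta> i z \<omega>, OF homz(1-4)] cone_Psi_minus_apply[of \<eta> i z \<omega>, OF homz(1-4)]
          wedge_1_2[OF homz(1,3)]
        unfolding s_def[symmetric] k_def[symmetric] h_def[symmetric]
        by (simp add: complex_eq_iff power2_eq_square power3_eq_cube algebra_simps)
      then show "?L vs = ?R vs" if "length vs = 3" for vs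
        using that by (auto simp: length_3_conv)
    qed
    with F show ?thesis by blast
  qed
  show ?thesis
  proof (intro exI conjI)
    show "open (W \<times> {0<..<pi})" using W by (simp add: open_Times)
    show "(x, t) \<in> W \<times> {0<..<pi}" "W \<times> {0<..<pi} \<subseteq> U \<times> {0<..<pi}" using W t by auto
    show "coframe_on (W \<times> {0<..<pi}) E" by (rule cof)
    show "\<forall>y\<in>W \<times> {0<..<pi}. cone_F \<eta> \<omega> i y = (\<lambda>vs. wedge (E 1 y) (E 2 y) vs + wedge (E 3 y) (E 4 y) vs
                           + wedge (E 5 y) (E 6 y) vs) \<and>
       cplx_covector (cone_Psi_plus \<eta> \<omega> i y) (cone_Psi_minus \<eta> \<omega> i y) =
         wedge (wedge (cplx_covector (E 1 y) (E 2 y)) (cplx_covector (E 3 y) (E 4 y)))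
               (cplx_covector (E 5 y) (E 6 y))"
    proof (rule ballI)
      fix y assume "y \<in> W \<times> {0<..<pi}"
      then obtain z \<tau> where y: "y = (z, \<tau>)" "z \<in> W" "0 < \<tau>" "\<tau> < pi" by auto
      show "cone_F \<eta> \<omega> i y = (\<lambda>vs. wedge (E 1 y) (E 2 y) vs + wedge (E 3 y) (E 4 y) vs
                           + wedge (E 5 y) (E 6 y) vs) \<and>
       cplx_covector (cone_Psi_plus \<eta> \<omega> i y) (cone_Psi_minus \<eta> \<omega> i y) =
         wedge (wedge (cplx_covector (E 1 y) (E 2 y)) (cplx_covector (E 3 y) (E 4 y)))
               (cplx_covector (E 5 y) (E 6 y))"
        unfolding y(1) by (rule eqs[OF y(2-4)])
    qed
  qed
qed

end

section \<open>Double hypo structures and half-flat sin-cones\<close>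

lemma su2_structure_chart:
  assumes N: "smooth_manifold N" and su2: "su2_structure N \<eta> \<omega>" and i: "i \<in> charts N"
  shows "su2_chart \<eta> \<omega> i (chart_img N i)"
proof -
  obtain v where v: "\<And>p q. p \<in> {1, 2, 3} \<Longrightarrow> q \<in> {1, 2, 3} \<Longrightarrow>
      \<omega> p \<and>\<^sub>f \<omega> q =\<^bsub>N\<^esub> (if p = q then v else 0\<^sub>f)"
    and nz: "\<And>x. x \<in> chart_img N i \<Longrightarrow> (v \<and>\<^sub>f \<eta>) i x \<noteq> (\<lambda>vs. 0)"
    using su2 i unfolding su2_structure_def by metis
  have prod: "wedge (\<omega> p i x) (\<omega> q i x) = (if p = q then v i x else (\<lambda>vs. 0))"
    if "p \<in> {1, 2, 3}" "q \<in> {1, 2, 3}" "x \<in> chart_img N i" for p q x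
    using v[OF that(1,2)] i that(3) by (auto simp: form_eq_def form_wedge_def form_zero_def)
  show ?thesis
  proof
    show "DIM('c) = 5" using su2 by (simp add: su2_structure_def)
    show "open (chart_img N i)" by (rule smooth_manifoldD(1)[OF N i])
    show "smooth_covector_field 1 (chart_img N i) (\<eta> i)" "smooth_covector_field 2 (chart_img N i) (\<omega> 1 i)"
      "smooth_covector_field 2 (chart_img N i) (\<omega> 2 i)" "smooth_covector_field 2 (chart_img N i) (\<omega> 3 i)"
      using su2 i by (auto simp: su2_structure_def diff_form_def)
    fix y assume y: "y \<in> chart_img N i"
    show "wedge (\<omega> 2 i y) (\<omega> 2 i y) = wedge (\<omega> 1 i y) (\<omega> 1 i y)"
      "wedge (\<omega> 3 i y) (\<omega> 3 i y) = wedge (\<omega> 1 i y) (\<omega> 1 i y)"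
      "wedge (\<omega> 1 i y) (\<omega> 2 i y) = (\<lambda>vs. 0)" "wedge (\<omega> 1 i y) (\<omega> 3 i y) = (\<lambda>vs. 0)"
      "wedge (\<omega> 2 i y) (\<omega> 3 i y) = (\<lambda>vs. 0)"
      using prod[of 2 2 y] prod[of 3 3 y] prod[of 1 1 y] prod[of 1 2 y] prod[of 1 3 y] prod[of 2 3 y] y
      by simp_all
    show "wedge (wedge (\<omega> 1 i y) (\<omega> 1 i y)) (\<eta> i y) \<noteq> (\<lambda>vs. 0)"
      using nz[OF y] prod[of 1 1 y] y by (simp add: form_wedge_def)
    show "\<omega> 3 i y [X, Y] \<ge> 0" if "interior_product X (\<omega> 1 i y) = interior_product Y (\<omega> 2 i y)" for X Y
      using su2 i y that unfolding su2_structure_def by blast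
  qed
qed

lemma su3_structure_sin_cone:
  fixes N :: "('a, 'i, 'e::euclidean_space) manifold"
  assumes N: "smooth_manifold N" and su2: "su2_structure N \<eta> \<omega>"
  shows "su3_structure (sin_cone N) (cone_F \<eta> \<omega>) (cone_Psi_plus \<eta> \<omega>) (cone_Psi_minus \<eta> \<omega>)"
  unfolding su3_structure_def
proof (intro conjI ballI)
  show "DIM('e \<times> real) = 6" using su2 by (simp add: su2_structure_def)
  have "diff_form N 1 \<eta>" "diff_form N 2 (\<omega> 1)" "diff_form N 2 (\<omega> 2)" "diff_form N 2 (\<omega> 3)"
    using su2 by (auto simp: su2_structure_def)
  then show "diff_form (sin_cone N) 2 (cone_F \<eta> \<omega>)" "diff_form (sin_cone N) 3 (cone_Psi_plus \<eta> \<omega>)"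
    "diff_form (sin_cone N) 3 (cone_Psi_minus \<eta> \<omega>)"
    by (rule diff_form_cone_structure[OF N])+
  fix i y assume i: "i \<in> charts (sin_cone N)" and y: "y \<in> chart_img (sin_cone N) i"
  then have iN: "i \<in> charts N" by simp
  obtain x t where xt: "y = (x, t)" "x \<in> chart_img N i" "t \<in> {0<..<pi}"
    using y by (auto simp: chart_img_sin_cone)
  show "\<exists>V e. open V \<and> y \<in> V \<and> V \<subseteq> chart_img (sin_cone N) i \<and> coframe_on V e \<and>
        (\<forall>y\<in>V. cone_F \<eta> \<omega> i y = (\<lambda>vs. wedge (e 1 y) (e 2 y) vs + wedge (e 3 y) (e 4 y) vs
                           + wedge (e 5 y) (e 6 y) vs) \<and>
           cplx_covector (cone_Psi_plus \<eta> \<omega> i y) (cone_Psi_minus \<eta> \<omega> i y) =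
             wedge (wedge (cplx_covector (e 1 y) (e 2 y)) (cplx_covector (e 3 y) (e 4 y)))
               (cplx_covector (e 5 y) (e 6 y)))"
    unfolding xt(1) chart_img_sin_cone
    by (rule su2_chart.local_su3_coframe[OF su2_structure_chart[OF N su2 iN] xt(2,3)])
qed

lemma half_flat_sin_cone_iff:
  assumes N: "smooth_manifold N" and su2: "su2_structure N \<eta> \<omega>"
  shows "half_flat (sin_cone N) (cone_F \<eta> \<omega>) (cone_Psi_plus \<eta> \<omega>) (cone_Psi_minus \<eta> \<omega>) \<longleftrightarrow>
    double_hypo N \<eta> \<omega>"
proof -
  have "half_flat (sin_cone N) (cone_F \<eta> \<omega>) (cone_Psi_plus \<eta> \<omega>) (cone_Psi_minus \<eta> \<omega>) \<longleftrightarrow>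
    (\<forall>i\<in>charts N. \<forall>x\<in>chart_img N i. \<forall>t\<in>{0<..<pi}.
      wedge (ext_d (cone_F \<eta> \<omega>) i (x, t)) (cone_F \<eta> \<omega> i (x, t)) = (\<lambda>vs. 0) \<and>
      ext_d (cone_Psi_plus \<eta> \<omega>) i (x, t) = (\<lambda>vs. 0))"
    using su3_structure_sin_cone[OF N su2]
    by (auto simp: half_flat_def form_eq_def chart_img_sin_cone form_wedge_def form_zero_def)
  also have "\<dots> \<longleftrightarrow> (\<forall>i\<in>charts N. \<forall>x\<in>chart_img N i.
      ext_d (\<omega> 1) i x = (\<lambda>vs. 3 * wedge (\<eta> i x) (\<omega> 2 i x) vs) \<and>
      ext_d (\<eta> \<and>\<^sub>f \<omega> 3) i x = (\<lambda>vs. - 2 * wedge (\<omega> 1 i x) (\<omega> 1 i x) vs) \<and>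
      ext_d (\<omega> 3) i x = (\<lambda>vs. 0) \<and> ext_d (\<eta> \<and>\<^sub>f \<omega> 1) i x = (\<lambda>vs. 0) \<and>
      ext_d (\<eta> \<and>\<^sub>f \<omega> 2) i x = (\<lambda>vs. 0))"
    by (intro ball_cong refl su2_chart.half_flat_equations_iff; (rule su2_structure_chart[OF N su2])?)
  also have "\<dots> \<longleftrightarrow> double_hypo N \<eta> \<omega>"
    using su2 by (auto simp: double_hypo_def nearly_hypo_def hypo_def form_eq_def form_scale_def
        form_wedge_def form_zero_def)
  finally show ?thesis .
qed

theorem theorem4p2:
  fixes N :: "('a, 'i, real ^ 5) manifold"
    and \<eta> :: "('i, real ^ 5) form"
    and \<omega> :: "nat \<Rightarrow> ('i, real ^ 5) form"
  assumes "smooth_manifold N"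
    and "su2_structure N \<eta> \<omega>"
  shows "(double_hypo N \<eta> \<omega> \<longleftrightarrow>
            ext_d (\<eta> \<and>\<^sub>f \<omega> 1) =\<^bsub>N\<^esub> 0\<^sub>f \<and>
            ext_d (\<omega> 1) =\<^bsub>N\<^esub> 3 *\<^sub>f (\<eta> \<and>\<^sub>f \<omega> 2) \<and>
            ext_d (\<eta> \<and>\<^sub>f \<omega> 3) =\<^bsub>N\<^esub> (- 2) *\<^sub>f (\<omega> 1 \<and>\<^sub>f \<omega> 1) \<and>
            ext_d (\<omega> 3) =\<^bsub>N\<^esub> 0\<^sub>f)
       \<and> (double_hypo N \<eta> \<omega> \<longleftrightarrow>
            half_flat (sin_cone N) (cone_F \<eta> \<omega>) (cone_Psi_plus \<eta> \<omega>) (cone_Psi_minus \<eta> \<omega>))"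
proof -
  have "ext_d (\<eta> \<and>\<^sub>f \<omega> 2) =\<^bsub>N\<^esub> 0\<^sub>f" if d1: "ext_d (\<omega> 1) =\<^bsub>N\<^esub> 3 *\<^sub>f (\<eta> \<and>\<^sub>f \<omega> 2)"
    unfolding form_eq_def
  proof (intro ballI)
    fix i x assume i: "i \<in> charts N" and x: "x \<in> chart_img N i"
    interpret su2_chart \<eta> \<omega> i "chart_img N i" by (rule su2_structure_chart[OF assms i])
    show "ext_d (\<eta> \<and>\<^sub>f \<omega> 2) i x = 0\<^sub>f i x"
      using ext_d_wedge_2_zero[OF x] d1 i by (simp add: form_eq_def form_zero_def)
  qed
  then show ?thesis
    using assms(2) half_flat_sin_cone_iff[OF assms]
    unfolding double_hypo_def nearly_hypo_def hypo_def by blast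
qed

end
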